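(* Let $\Sigma$ be a compact $k$-dimensional minimal submanifold in the unit ball $B^n$ with $\partial\Sigma\subset S^{n-1}$ and with the outward unit conormal vector of $\Sigma$ along $\partial\Sigma$ equal to the position vector. Given any $v\in S^{n-1}$, let $f_t$ be the one parameter family of conformal transformations of the ball generated by the gradient of the linear function in the direction $v$. Then $$\left.\frac{d^2}{dt^2}\right|_{t=0}|f_t(\partial\Sigma)|=-(k-1)k\int_{\Sigma}|v^\perp|^2\,dv_\Sigma\ \le\ 0 .$$
   Context: $B^n$ is the closed unit ball in $\mathbb{R}^n$ and $S^{n-1}=\partial B^n$. $\Sigma$ is smooth up to its boundary. The family $f_t$ is the flow on $S^{n-1}$ (with $f_0=\mathrm{id}$) of the vector field $X=\nabla^{S^{n-1}}\ell$, where $\ell(x)=x\cdot v$; thus $X(x)=v-(x\cdot v)x$ is the component of $v$ tangent to $S^{n-1}$. Each $f_t$ is a conformal transformation of $S^{n-1}$ and extends to a conformal transformation of $B^n$. $|f_t(\partial\Sigma)|$ denotes the $(k-1)$-dimensional volume of $f_t(\partial\Sigma)$. At a point of $\Sigma$, $v^\perp$ denotes the component of the constant vector $v$ normal to $\Sigma$, and $dv_\Sigma$ is the volume measure of $\Sigma$. *)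

theory Defs
  imports "HOL-Analysis.Analysis" "HOL-Combinatorics.Permutations"
begin

subsection \<open>Smooth maps\<close>

primrec Ck_on :: "nat \<Rightarrow> 'a::real_normed_vector set \<Rightarrow> ('a \<Rightarrow> 'b::real_normed_vector) \<Rightarrow> bool" where
  "Ck_on 0 S f \<longleftrightarrow> continuous_on S f"
| "Ck_on (Suc m) S f \<longleftrightarrow>
     (\<forall>x\<in>S. f differentiable (at x)) \<and> (\<forall>u. Ck_on m S (\<lambda>x. frechet_derivative f (at x) u))"

text \<open>Only meaningful for open sets, as the derivatives are taken in the ambient space.\<close>

definition smooth_on :: "'a::real_normed_vector set \<Rightarrow> ('a \<Rightarrow> 'b::real_normed_vector) \<Rightarrow> bool" where
  "smooth_on S f \<longleftrightarrow> (\<forall>m. Ck_on m S f)"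


subsection \<open>Embedded submanifolds with boundary\<close>

text \<open>The model spaces of dimension \<open>card B\<close> are coordinate subspaces \<open>span B\<close>,
  \<open>B \<subseteq> Basis\<close>, of the ambient space, so that dimension \<open>0\<close> is not special. For \<open>e \<in> B\<close> the
  set below is a closed half-space of \<open>span B\<close>; for \<open>e = 0\<close> it is all of \<open>span B\<close>.\<close>

definition model_slice :: "'a::euclidean_space set \<Rightarrow> 'a \<Rightarrow> 'a set" where
  "model_slice B e = {x \<in> span B. 0 \<le> x \<bullet> e}"

text \<open>\<open>\<psi>\<close> is a diffeomorphism between open sets of the ambient space which carries the model
  slice to \<open>M\<close>; its restriction to the slice is a local parametrization of \<open>M\<close>, smooth up to
  the boundary.\<close>

definition slice_chart ::
    "nat \<Rightarrow> 'a::euclidean_space set \<Rightarrow> 'a set \<Rightarrow> 'a \<Rightarrow> 'a set \<Rightarrow> ('a \<Rightarrow> 'a) \<Rightarrow> bool" where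
  "slice_chart k M B e U \<psi> \<longleftrightarrow>
     B \<subseteq> Basis \<and> card B = k \<and> e \<in> insert 0 B \<and>
     open U \<and> open (\<psi> ` U) \<and> inj_on \<psi> U \<and>
     smooth_on U \<psi> \<and> smooth_on (\<psi> ` U) (inv_into U \<psi>) \<and>
     M \<inter> \<psi> ` U = \<psi> ` (U \<inter> model_slice B e)"

definition submanifold_with_boundary :: "nat \<Rightarrow> 'a::euclidean_space set \<Rightarrow> bool" where
  "submanifold_with_boundary k M \<longleftrightarrow> (\<forall>p\<in>M. \<exists>B e U \<psi>. slice_chart k M B e U \<psi> \<and> p \<in> \<psi> ` U)"

definition manifold_boundary :: "nat \<Rightarrow> 'a::euclidean_space set \<Rightarrow> 'a set" where
  "manifold_boundary k M =
     {p \<in> M. \<exists>B e U \<psi> x. slice_chart k M B e U \<psi> \<and> e \<noteq> 0 \<and> x \<in> U \<and> \<psi> x = p \<and> x \<bullet> e = 0}"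


subsection \<open>Tangent and normal vectors, conormal\<close>

text \<open>Only differentiability at time \<open>0\<close> is required of the curves; for submanifolds with
  boundary this gives the same vectors as smooth curves do. At a boundary point these vectors
  form a closed half-space, hence the span in the definition of the tangent space.\<close>

definition initial_velocity :: "'a::euclidean_space set \<Rightarrow> 'a \<Rightarrow> 'a \<Rightarrow> bool" where
  "initial_velocity M p w \<longleftrightarrow>
     (\<exists>c. c 0 = p \<and> (\<forall>t\<ge>0. c t \<in> M) \<and> (c has_vector_derivative w) (at (0::real) within {0..}))"

definition tangent_space :: "'a::euclidean_space set \<Rightarrow> 'a \<Rightarrow> 'a set" where
  "tangent_space M p = span {w. initial_velocity M p w}"

definition normal_part :: "'a::euclidean_space set \<Rightarrow> 'a \<Rightarrow> 'a \<Rightarrow> 'a" where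
  "normal_part M p w =
     (THE z. w - z \<in> tangent_space M p \<and> (\<forall>u \<in> tangent_space M p. z \<bullet> u = 0))"

definition outward_unit_conormal :: "nat \<Rightarrow> 'a::euclidean_space set \<Rightarrow> 'a \<Rightarrow> 'a \<Rightarrow> bool" where
  "outward_unit_conormal k M p \<eta> \<longleftrightarrow>
     \<eta> \<in> tangent_space M p \<and> norm \<eta> = 1 \<and>
     (\<forall>u \<in> tangent_space (manifold_boundary k M) p. \<eta> \<bullet> u = 0) \<and>
     initial_velocity M p (- \<eta>)"


subsection \<open>Second fundamental form and minimality\<close>

text \<open>\<open>II(u, w)\<close> is the normal part of \<open>D\<^sub>u Y\<close>, where \<open>Y\<close> is any smooth vector field defined near
  \<open>p\<close> in the ambient space which is tangent along \<open>M\<close> and has \<open>Y p = w\<close>.\<close>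

definition second_fundamental_form :: "'a::euclidean_space set \<Rightarrow> 'a \<Rightarrow> 'a \<Rightarrow> 'a \<Rightarrow> 'a" where
  "second_fundamental_form M p u w =
     (THE z. \<exists>W Y. open W \<and> p \<in> W \<and> smooth_on W Y \<and>
        (\<forall>q \<in> M \<inter> W. Y q \<in> tangent_space M q) \<and> Y p = w \<and>
        z = normal_part M p (frechet_derivative Y (at p) u))"

definition orthonormal_basis :: "'a::euclidean_space set \<Rightarrow> 'a set \<Rightarrow> bool" where
  "orthonormal_basis T E \<longleftrightarrow> pairwise orthogonal E \<and> (\<forall>x\<in>E. norm x = 1) \<and> span E = T"

definition mean_curvature :: "'a::euclidean_space set \<Rightarrow> 'a \<Rightarrow> 'a" where
  "mean_curvature M p =
     (\<Sum>x \<in> (SOME E. orthonormal_basis (tangent_space M p) E). second_fundamental_form M p x x)"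

definition minimal_submanifold :: "nat \<Rightarrow> 'a::euclidean_space set \<Rightarrow> bool" where
  "minimal_submanifold k M \<longleftrightarrow>
     submanifold_with_boundary k M \<and> (\<forall>p\<in>M. mean_curvature M p = 0)"


subsection \<open>Riemannian volume\<close>

text \<open>Lebesgue measure of dimension \<open>card B\<close> on \<open>span B\<close>, as a Borel measure on the ambient
  space; compare \<open>lborel_eq\<close>. For \<open>B = {}\<close> it is the unit mass at \<open>0\<close>.\<close>

definition slice_measure :: "'a::euclidean_space set \<Rightarrow> 'a measure" where
  "slice_measure B = distr (\<Pi>\<^sub>M b\<in>B. lborel) borel (\<lambda>g. \<Sum>b\<in>B. g b *\<^sub>R b)"

text \<open>The Gram determinant \<open>det (\<partial>\<^sub>b\<psi> \<bullet> \<partial>\<^sub>c\<psi>)\<close>, \<open>b, c \<in> B\<close>, by the Leibniz formula.\<close>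

definition gram_det :: "'a::euclidean_space set \<Rightarrow> ('a \<Rightarrow> 'a) \<Rightarrow> 'a \<Rightarrow> real" where
  "gram_det B \<psi> x =
     (\<Sum>\<pi> | \<pi> permutes B. of_int (sign \<pi>) *
        (\<Prod>b\<in>B. frechet_derivative \<psi> (at x) b \<bullet> frechet_derivative \<psi> (at x) (\<pi> b)))"

text \<open>The unique Borel measure on the ambient space which is concentrated on \<open>M\<close> and equals
  \<open>sqrt (det g) dx\<close> in every local parametrization.\<close>

definition volume_measure :: "nat \<Rightarrow> 'a::euclidean_space set \<Rightarrow> 'a measure" where
  "volume_measure k M =
     (THE \<mu>. sets \<mu> = sets borel \<and> emeasure \<mu> (- M) = 0 \<and>
        (\<forall>B e U \<psi>. slice_chart k M B e U \<psi> \<longrightarrow>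
          (\<forall>A \<in> sets borel. A \<subseteq> M \<inter> \<psi> ` U \<longrightarrow>
             emeasure \<mu> A =
               (\<integral>\<^sup>+x. ennreal (sqrt (gram_det B \<psi> x)) * indicator (U \<inter> \<psi> -` A) x \<partial>slice_measure B))))"

definition submanifold_volume :: "nat \<Rightarrow> 'a::euclidean_space set \<Rightarrow> real" where
  "submanifold_volume k M = measure (volume_measure k M) M"


subsection \<open>The conformal flow on the sphere\<close>

text \<open>The gradient on the unit sphere of the linear function \<open>x \<mapsto> x \<bullet> v\<close>.\<close>

definition sphere_gradient :: "'a::euclidean_space \<Rightarrow> 'a \<Rightarrow> 'a" where
  "sphere_gradient v x = v - (x \<bullet> v) *\<^sub>R x"

definition flow_on :: "'a::euclidean_space set \<Rightarrow> ('a \<Rightarrow> 'a) \<Rightarrow> (real \<Rightarrow> 'a \<Rightarrow> 'a) \<Rightarrow> bool" where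
  "flow_on S X f \<longleftrightarrow>
     (\<forall>x\<in>S. f 0 x = x \<and>
        (\<forall>t. f t x \<in> S \<and> ((\<lambda>s. f s x) has_vector_derivative X (f t x)) (at t)))"

end

theory Submission
  imports Defs
begin

text \<open>
  By uniqueness of flows, \<open>f\<^sub>t\<close> is the Lorentz boost \<open>F\<^sub>t\<close> in the direction \<open>v\<close>, which is conformal on
  the sphere with factor \<open>1 / (cosh t + (x \<bullet> v) sinh t)\<close>. Hence \<open>|f\<^sub>t(\<partial>M)|\<close> is the integral over \<open>\<partial>M\<close> of
  the \<open>(k - 1)\<close>-st power of this factor, and its second derivative at \<open>0\<close> is the integral of
  \<open>- (k - 1) (1 - k (x \<bullet> v)\<^sup>2)\<close>. The divergence theorem on the minimal submanifold \<open>M\<close> for the vector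
  field \<open>y - k (y \<bullet> v) v\<close>, whose divergence along \<open>M\<close> is \<open>k |v\<^sup>\<bottom>|\<^sup>2\<close> and whose flux through \<open>\<partial>M\<close> is
  \<open>1 - k (x \<bullet> v)\<^sup>2\<close> because the conormal is the position vector, gives the formula. The divergence
  theorem itself is proved in a chart from \<open>\<Sum>\<^sub>b \<partial>\<^sub>b (\<surd>g \<nu>\<^sup>b) = \<surd>g H\<close>, with \<open>\<nu>\<^sup>b\<close> the frame dual to
  the coordinate vectors, and globalized by a partition of unity.
\<close>

subsection \<open>Calculus of continuously differentiable maps\<close>

text \<open>The coefficient k of the field is forced by the flux: on the sphere y - c (y \<bullet>
  v) v has normal component 1 - c (y \<bullet> v)^2, which matches the second variation exactly for
  c = k. Its divergence is then k - k |v^T|^2, with v^T the tangential part, and |v^T|^2 = 1 -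
  |v^\<bottom>|^2 leaves k |v^\<bottom>|^2. Normal part, second fundamental form and volume measure
  are definite descriptions, so each needs existence and uniqueness before it can be computed with.
  For the volume this amounts to independence of the chart, hence to a change of variables formula
  on coordinate subspaces of every dimension, 0 included. Nothing is known of \<open>f\<close> off
  the sphere, whereas charts are diffeomorphisms of open sets of the ambient space. The boost is a
  rational map on an open set containing the sphere, so it can be composed with charts. Christoffel
  symbols never appear: pairing \<Sum>_b \<partial>_b (J \<nu>^b) with tangent vectors gives 0 by
  Jacobi's formula and symmetry of second derivatives, and pairing with normal vectors gives J H
  directly.\<close>

abbreviation pd :: "('a::real_normed_vector \<Rightarrow> 'b::real_normed_vector) \<Rightarrow> 'a \<Rightarrow> 'a \<Rightarrow> 'b" where
  "pd f u x \<equiv> frechet_derivative f (at x) u"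

lemma Ck_on_subset: "Ck_on m S f \<Longrightarrow> T \<subseteq> S \<Longrightarrow> Ck_on m T f"
  by (induction m arbitrary: f) (auto intro: continuous_on_subset)

text \<open>All derivatives are taken in the ambient space, so agreement on an open set passes to
  every order.\<close>

lemma Ck_on_cong:
  assumes "open S" "\<And>x. x \<in> S \<Longrightarrow> f x = g x" "Ck_on m S f"
  shows "Ck_on m S g"
  using assms(2,3)
proof (induction m arbitrary: f g)
  case 0
  then show ?case using continuous_on_cong[of S S f g] by simp
next
  case (Suc m)
  have d: "g differentiable at x" if "x \<in> S" for x
  proof -
    have D: "(f has_derivative frechet_derivative f (at x)) (at x)"
      using Suc.prems(2) that frechet_derivative_works[of f "at x"] by simp
    have "(g has_derivative frechet_derivative f (at x)) (at x)"
      by (rule has_derivative_transform_within_open[OF D assms(1) that]) (rule Suc.prems(1))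
    then show ?thesis by (auto simp: differentiable_def)
  qed
  have e: "pd f u x = pd g u x" if "x \<in> S" for x u
    using frechet_derivative_transform_within_open[of f x S g] Suc.prems assms(1) that by simp
  have "Ck_on m S (pd g u)" for u
    by (rule Suc.IH[of "pd f u" "pd g u", OF e]) (use Suc.prems(2) in simp_all)
  then show ?case
    using d by simp
qed

lemma Ck_on_SucI:
  assumes "open S" "\<And>x. x \<in> S \<Longrightarrow> (f has_derivative f' x) (at x)"
    and "\<And>u. Ck_on m S (\<lambda>x. f' x u)"
  shows "Ck_on (Suc m) S f"
proof -
  have "f' x u = pd f u x" if "x \<in> S" for x u
    using assms(2)[OF that] frechet_derivative_at by metis
  then have "Ck_on m S (pd f u)" for u
    by (intro Ck_on_cong[OF assms(1) _ assms(3)[of u]]) blast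
  then show ?thesis
    using assms(2) by (auto simp: differentiable_def)
qed

lemma Ck_on_SucD:
  assumes "Ck_on (Suc m) S f"
  shows "x \<in> S \<Longrightarrow> (f has_derivative frechet_derivative f (at x)) (at x)"
    and "Ck_on m S (pd f u)"
  using assms by (auto simp: frechet_derivative_works)

lemma Ck_on_Suc: "Ck_on (Suc m) S f \<Longrightarrow> Ck_on m S f"
proof (induction m arbitrary: f)
  case 0
  then show ?case
    by (auto intro!: continuous_at_imp_continuous_on differentiable_imp_continuous_within)
next
  case (Suc m)
  then show ?case by (metis Ck_on.simps(2))
qed

lemma Ck_on_le: "Ck_on n S f \<Longrightarrow> m \<le> n \<Longrightarrow> Ck_on m S f"
  by (induction n) (use Ck_on_Suc le_Suc_eq in blast)+

lemma Ck_on_continuous: "Ck_on m S f \<Longrightarrow> continuous_on S f"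
  using Ck_on_le[of m S f 0] by simp

lemma Ck_on_has_derivative:
  "Ck_on m S f \<Longrightarrow> m > 0 \<Longrightarrow> x \<in> S \<Longrightarrow> (f has_derivative frechet_derivative f (at x)) (at x)"
  by (cases m) (auto simp: frechet_derivative_works)

lemma Ck_on_const [intro, simp]: "open S \<Longrightarrow> Ck_on m S (\<lambda>x. c)"
proof (induction m arbitrary: c)
  case (Suc m)
  then show ?case by (intro Ck_on_SucI[where f'="\<lambda>x u. 0"]) auto
qed simp

lemma Ck_on_id [intro, simp]: "open S \<Longrightarrow> Ck_on m S (\<lambda>x. x)"
proof (cases m)
  case (Suc n)
  assume "open S"
  then show ?thesis unfolding Suc by (intro Ck_on_SucI[where f'="\<lambda>x u. u"]) auto
qed auto

lemma Ck_on_bounded_linear: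
  assumes "open S" "bounded_linear h" "Ck_on m S f"
  shows "Ck_on m S (\<lambda>x. h (f x))"
  using assms(3)
proof (induction m arbitrary: f)
  case 0
  then show ?case using bounded_linear.continuous_on[OF assms(2)] by auto
next
  case (Suc m)
  show ?case
    by (rule Ck_on_SucI[where f'="\<lambda>x u. h (pd f u x)", OF assms(1)])
      (use Suc bounded_linear.has_derivative[OF assms(2) Ck_on_SucD(1)[OF Suc.prems]] in auto)
qed

lemma Ck_on_add:
  assumes "open S" "Ck_on m S f" "Ck_on m S g"
  shows "Ck_on m S (\<lambda>x. f x + g x)"
  using assms(2,3)
proof (induction m arbitrary: f g)
  case 0
  then show ?case by (auto intro: continuous_on_add)
next
  case (Suc m)
  show ?case
    by (rule Ck_on_SucI[where f'="\<lambda>x u. pd f u x + pd g u x", OF assms(1)])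
      (use Suc has_derivative_add[OF Ck_on_SucD(1)[OF Suc.prems(1)] Ck_on_SucD(1)[OF Suc.prems(2)]] in auto)
qed

lemma Ck_on_bilinear:
  assumes "open S" "bounded_bilinear h" "Ck_on m S f" "Ck_on m S g"
  shows "Ck_on m S (\<lambda>x. h (f x) (g x))"
  using assms(3,4)
proof (induction m arbitrary: f g)
  case 0
  then show ?case using bounded_bilinear.continuous_on[OF assms(2)] by auto
next
  case (Suc m)
  show ?case
  proof (rule Ck_on_SucI[where f'="\<lambda>x u. h (f x) (pd g u x) + h (pd f u x) (g x)", OF assms(1)])
    show "((\<lambda>x. h (f x) (g x)) has_derivative (\<lambda>u. h (f x) (pd g u x) + h (pd f u x) (g x))) (at x)"
      if "x \<in> S" for x
      using bounded_bilinear.FDERIV[OF assms(2) Ck_on_SucD(1)[OF Suc.prems(1) that] Ck_on_SucD(1)[OF Suc.prems(2) that]] .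
    show "Ck_on m S (\<lambda>x. h (f x) (pd g u x) + h (pd f u x) (g x))" for u
      using Suc.prems by (intro Ck_on_add assms(1) Suc.IH) (auto intro: Ck_on_Suc)
  qed
qed

lemmas Ck_on_mult = Ck_on_bilinear[OF _ bounded_bilinear_mult]
lemmas Ck_on_scaleR = Ck_on_bilinear[OF _ bounded_bilinear_scaleR]
lemmas Ck_on_inner = Ck_on_bilinear[OF _ bounded_bilinear_inner]

lemma Ck_on_minus: "open S \<Longrightarrow> Ck_on m S f \<Longrightarrow> Ck_on m S (\<lambda>x. - f x)"
  by (rule Ck_on_bounded_linear) (auto intro: bounded_linear_minus bounded_linear_ident)

lemma Ck_on_diff: "open S \<Longrightarrow> Ck_on m S f \<Longrightarrow> Ck_on m S g \<Longrightarrow> Ck_on m S (\<lambda>x. f x - g x)"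
  using Ck_on_add[of S m f "\<lambda>x. - g x"] Ck_on_minus[of S m g] by simp

lemma Ck_on_sum:
  assumes "open S" "\<And>i. i \<in> I \<Longrightarrow> Ck_on m S (f i)"
  shows "Ck_on m S (\<lambda>x. \<Sum>i\<in>I. f i x)"
  using assms(2) by (induction I rule: infinite_finite_induct) (auto simp: assms(1) intro!: Ck_on_add)

lemma Ck_on_prod:
  fixes f :: "'i \<Rightarrow> 'a::real_normed_vector \<Rightarrow> real"
  assumes "open S" "\<And>i. i \<in> I \<Longrightarrow> Ck_on m S (f i)"
  shows "Ck_on m S (\<lambda>x. \<Prod>i\<in>I. f i x)"
  using assms(2) by (induction I rule: infinite_finite_induct) (auto simp: assms(1) intro!: Ck_on_mult)

lemma Ck_on_inverse:
  fixes f :: "'a::real_normed_vector \<Rightarrow> real"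
  assumes "open S" "Ck_on m S f" "\<And>x. x \<in> S \<Longrightarrow> f x \<noteq> 0"
  shows "Ck_on m S (\<lambda>x. inverse (f x))"
  using assms(2)
proof (induction m)
  case 0
  then show ?case using assms(3) by (auto intro!: continuous_on_inverse)
next
  case (Suc m)
  show ?case
  proof (rule Ck_on_SucI[where f'="\<lambda>x u. - (inverse (f x) * pd f u x * inverse (f x))", OF assms(1)])
    show "((\<lambda>x. inverse (f x)) has_derivative (\<lambda>u. - (inverse (f x) * pd f u x * inverse (f x)))) (at x)"
      if "x \<in> S" for x
      using Deriv.has_derivative_inverse[OF assms(3)[OF that] Ck_on_SucD(1)[OF Suc.prems that]] .
    show "Ck_on m S (\<lambda>x. - (inverse (f x) * pd f u x * inverse (f x)))" for u
      using Suc.prems Suc.IH[OF Ck_on_Suc[OF Suc.prems]] by (intro Ck_on_minus Ck_on_mult assms(1)) auto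
  qed
qed

lemma Ck_on_divide:
  fixes f g :: "'a::real_normed_vector \<Rightarrow> real"
  assumes "open S" "Ck_on m S f" "Ck_on m S g" "\<And>x. x \<in> S \<Longrightarrow> g x \<noteq> 0"
  shows "Ck_on m S (\<lambda>x. f x / g x)"
  unfolding divide_inverse using assms by (intro Ck_on_mult Ck_on_inverse)

lemma Ck_on_sqrt:
  fixes f :: "'a::real_normed_vector \<Rightarrow> real"
  assumes "open S" "Ck_on m S f" "\<And>x. x \<in> S \<Longrightarrow> f x > 0"
  shows "Ck_on m S (\<lambda>x. sqrt (f x))"
  using assms(2)
proof (induction m)
  case 0
  then show ?case by (auto intro!: continuous_on_real_sqrt)
next
  case (Suc m)
  show ?case
  proof (rule Ck_on_SucI[where f'="\<lambda>x u. pd f u x * inverse (2 * sqrt (f x))", OF assms(1)])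
    show "((\<lambda>x. sqrt (f x)) has_derivative (\<lambda>u. pd f u x * inverse (2 * sqrt (f x)))) (at x)"
      if "x \<in> S" for x
      by (rule has_derivative_eq_rhs[OF has_derivative_real_sqrt[OF assms(3)[OF that] Ck_on_SucD(1)[OF Suc.prems that]]])
        (simp add: fun_eq_iff divide_simps)
    show "Ck_on m S (\<lambda>x. pd f u x * inverse (2 * sqrt (f x)))" for u
      using Suc.prems Suc.IH[OF Ck_on_Suc[OF Suc.prems]] assms(3)
      by (intro Ck_on_inverse Ck_on_mult Ck_on_const assms(1)) (auto simp: less_imp_neq[THEN not_sym])
  qed
qed

text \<open>The chain rule yields \<open>pd g\<close> in the moving direction
  \<open>pd f u x\<close>. Expanding this direction in \<open>Basis\<close> leaves only partial
  derivatives of \<open>g\<close> in fixed directions, to which the induction hypothesis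
  applies.\<close>

lemma Ck_on_compose:
  fixes f :: "'a::real_normed_vector \<Rightarrow> 'b::euclidean_space" and g :: "'b \<Rightarrow> 'c::real_normed_vector"
  assumes "open S" "open T" "Ck_on m S f" "Ck_on m T g" "f ` S \<subseteq> T"
  shows "Ck_on m S (\<lambda>x. g (f x))"
  using assms(3,4)
proof (induction m arbitrary: g)
  case 0
  then show ?case using continuous_on_compose2[of T g S f] assms(5) by auto
next
  case (Suc m)
  show ?case
  proof (rule Ck_on_SucI[where f'="\<lambda>x u. \<Sum>i\<in>Basis. (pd f u x \<bullet> i) *\<^sub>R pd g i (f x)", OF assms(1)])
    fix x assume x: "x \<in> S"
    have dg: "(g has_derivative frechet_derivative g (at (f x))) (at (f x))"
      using Ck_on_SucD(1)[OF Suc.prems(2)] x assms(5) by auto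
    have comp: "((\<lambda>x. g (f x)) has_derivative (\<lambda>u. pd g (pd f u x) (f x))) (at x)"
      by (rule has_derivative_compose[OF Ck_on_SucD(1)[OF Suc.prems(1) x] dg])
    have rep: "pd g w (f x) = (\<Sum>i\<in>Basis. (w \<bullet> i) *\<^sub>R pd g i (f x))" for w
    proof -
      have "linear (frechet_derivative g (at (f x)))" using dg has_derivative_linear by blast
      then show ?thesis
        by (subst euclidean_representation[symmetric, of w])
          (simp add: linear_sum linear_scale)
    qed
    show "((\<lambda>x. g (f x)) has_derivative (\<lambda>u. \<Sum>i\<in>Basis. (pd f u x \<bullet> i) *\<^sub>R pd g i (f x))) (at x)"
      by (rule has_derivative_eq_rhs[OF comp]) (rule ext, rule rep)
  next
    show "Ck_on m S (\<lambda>x. \<Sum>i\<in>Basis. (pd f u x \<bullet> i) *\<^sub>R pd g i (f x))" for u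
    proof (intro Ck_on_sum Ck_on_scaleR Ck_on_inner assms(1) Ck_on_const)
      show "Ck_on m S (pd f u)" using Suc.prems(1) by simp
      show "Ck_on m S (\<lambda>x. pd g i (f x))" for i
        by (rule Suc.IH[where g="pd g i"]) (use Suc.prems in \<open>auto intro: Ck_on_Suc\<close>)
    qed
  qed
qed

text \<open>Used to glue a function that is smooth inside a chart to its extension by zero.\<close>

lemma Ck_on_on_local:
  assumes "\<And>x. x \<in> S \<Longrightarrow> \<exists>T. open T \<and> x \<in> T \<and> Ck_on m T f"
  shows "Ck_on m S f"
  using assms
proof (induction m arbitrary: f)
  case 0
  have "continuous (at x) f" if "x \<in> S" for x
    using 0[OF that] by (auto simp: continuous_on_eq_continuous_at)
  then show ?case by (simp add: continuous_at_imp_continuous_on)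
next
  case (Suc m)
  show ?case
  proof (simp, intro conjI ballI allI)
    fix x assume "x \<in> S"
    then show "f differentiable at x" using Suc.prems[of x] by auto
  next
    fix u show "Ck_on m S (pd f u)"
    proof (rule Suc.IH)
      fix x assume "x \<in> S"
      then obtain T where "open T" "x \<in> T" "Ck_on (Suc m) T f" using Suc.prems by blast
      then show "\<exists>T. open T \<and> x \<in> T \<and> Ck_on m T (pd f u)" by (intro exI[of _ T]) auto
    qed
  qed
qed

lemma mvt_directional:
  fixes f :: "'a::real_normed_vector \<Rightarrow> real"
  assumes "h > 0" "\<And>s. 0 \<le> s \<Longrightarrow> s \<le> h \<Longrightarrow> (f has_derivative F (x + s *\<^sub>R u)) (at (x + s *\<^sub>R u))"
  shows "\<exists>s. 0 < s \<and> s < h \<and> f (x + h *\<^sub>R u) - f x = h * F (x + s *\<^sub>R u) u"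
proof -
  have d: "((\<lambda>s. f (x + s *\<^sub>R u)) has_real_derivative F (x + s *\<^sub>R u) u) (at s)" if "0 \<le> s" "s \<le> h" for s
  proof -
    have "((\<lambda>s. f (x + s *\<^sub>R u)) has_derivative (\<lambda>t. F (x + s *\<^sub>R u) (t *\<^sub>R u))) (at s)"
    proof (rule has_derivative_compose[where g=f and f="\<lambda>s. x + s *\<^sub>R u"])
      show "(f has_derivative F (x + s *\<^sub>R u)) (at (x + s *\<^sub>R u))" by (rule assms(2)[OF that])
      show "((\<lambda>s. x + s *\<^sub>R u) has_derivative (\<lambda>t. t *\<^sub>R u)) (at s)" by (auto intro!: derivative_eq_intros)
    qed
    moreover have "linear (F (x + s *\<^sub>R u))" using assms(2)[OF that] has_derivative_linear by blast
    ultimately show ?thesis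
      by (simp add: has_field_derivative_def linear_scale mult_commute_abs)
  qed
  show ?thesis
    using MVT2[of 0 h "\<lambda>s. f (x + s *\<^sub>R u)" "\<lambda>s. F (x + s *\<^sub>R u) u"] d assms(1) by auto
qed

text \<open>Symmetry of second derivatives by the classical argument: the mixed second difference is
  symmetric in \<open>u\<close> and \<open>w\<close>, two mean value theorems express it as h^2
  times either mixed derivative at a point near \<open>x\<close>, and h tends to 0. Vector values
  are treated by components.\<close>

lemma pd_commute:
  fixes f :: "'a::real_normed_vector \<Rightarrow> 'b::euclidean_space"
  assumes "open S" "Ck_on 2 S f" "x \<in> S"
  shows "pd (pd f u) w x = pd (pd f w) u x"
proof -
  have real: "pd (pd g u) w x = pd (pd g w) u x" if g: "Ck_on 2 S g" for g :: "'a \<Rightarrow> real"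
  proof -
    obtain r where r: "r > 0" "ball x r \<subseteq> S" using assms(1,3) open_contains_ball by blast
    have Cg: "Ck_on (Suc (Suc 0)) S g" using g by (simp add: numeral_2_eq_2)
    have key: "\<exists>s t. 0 < s \<and> s < h \<and> 0 < t \<and> t < h \<and>
        g (x + h *\<^sub>R u + h *\<^sub>R w) - g (x + h *\<^sub>R w) - (g (x + h *\<^sub>R u) - g x) = h * (h * pd (pd g u) w (x + s *\<^sub>R u + t *\<^sub>R w))"
      if h: "h > 0" "h * (norm u + norm w) < r" for h u w
    proof -
      have inS: "x + s *\<^sub>R u + t *\<^sub>R w \<in> S" if "0 \<le> s" "s \<le> h" "0 \<le> t" "t \<le> h" for s t
      proof -
        have "norm (s *\<^sub>R u + t *\<^sub>R w) \<le> s * norm u + t * norm w"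
          using norm_triangle_ineq[of "s *\<^sub>R u" "t *\<^sub>R w"] that by simp
        also have "\<dots> \<le> h * norm u + h * norm w" using that by (intro add_mono mult_right_mono) auto
        finally have "norm (s *\<^sub>R u + t *\<^sub>R w) < r" using h by (simp add: algebra_simps)
        moreover have "x + s *\<^sub>R u + t *\<^sub>R w - x = s *\<^sub>R u + t *\<^sub>R w" by simp
        ultimately have "dist (x + s *\<^sub>R u + t *\<^sub>R w) x < r" by (simp only: dist_norm)
        then show ?thesis using r by (auto simp: dist_commute)
      qed
      \<comment> \<open>The mixed second difference is the increment of this first difference in
        direction \<open>u\<close>; the second mean value theorem is then applied in direction
        \<open>w\<close>.\<close>
      let ?G = "\<lambda>y. g (y + h *\<^sub>R w) - g y"
      have "(?G has_derivative (\<lambda>v. pd g v (y + h *\<^sub>R w) - pd g v y)) (at y)"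
        if "y + h *\<^sub>R w \<in> S" "y \<in> S" for y
      proof (intro has_derivative_diff Ck_on_SucD(1)[OF Cg that(2)])
        have "((\<lambda>y. y + h *\<^sub>R w) has_derivative (\<lambda>v. v)) (at y)" by (auto intro!: derivative_eq_intros)
        then show "((\<lambda>y. g (y + h *\<^sub>R w)) has_derivative (\<lambda>v. pd g v (y + h *\<^sub>R w))) (at y)"
          by (rule has_derivative_compose[where g=g and f="\<lambda>y. y + h *\<^sub>R w", OF _ Ck_on_SucD(1)[OF Cg that(1)]])
      qed
      note dG = this
      have "\<exists>s. 0 < s \<and> s < h \<and> ?G (x + h *\<^sub>R u) - ?G x = h * (pd g u (x + s *\<^sub>R u + h *\<^sub>R w) - pd g u (x + s *\<^sub>R u))"
        by (intro mvt_directional[where F="\<lambda>y v. pd g v (y + h *\<^sub>R w) - pd g v y"] dG h inS)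
          (use inS[of _ 0] h in simp_all)
      then obtain s where s: "0 < s" "s < h" "?G (x + h *\<^sub>R u) - ?G x = h * (pd g u (x + s *\<^sub>R u + h *\<^sub>R w) - pd g u (x + s *\<^sub>R u))"
        by blast
      have "\<exists>t. 0 < t \<and> t < h \<and> pd g u (x + s *\<^sub>R u + h *\<^sub>R w) - pd g u (x + s *\<^sub>R u) = h * pd (pd g u) w (x + s *\<^sub>R u + t *\<^sub>R w)"
        by (intro mvt_directional[where F="\<lambda>y v. pd (pd g u) v y"] Ck_on_SucD(1)[OF Ck_on_SucD(2)[OF Cg]] inS h)
          (use s in simp_all)
      then obtain t where t: "0 < t" "t < h"
        "pd g u (x + s *\<^sub>R u + h *\<^sub>R w) - pd g u (x + s *\<^sub>R u) = h * pd (pd g u) w (x + s *\<^sub>R u + t *\<^sub>R w)" by blast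
      show ?thesis
      proof (intro exI conjI)
        show "g (x + h *\<^sub>R u + h *\<^sub>R w) - g (x + h *\<^sub>R w) - (g (x + h *\<^sub>R u) - g x)
            = h * (h * pd (pd g u) w (x + s *\<^sub>R u + t *\<^sub>R w))"
          using s(3) unfolding t(3) by linarith
      qed (use s t in simp_all)
    qed
    \<comment> \<open>The summand 1 guards against u = w = 0, and n + 2 makes r / (n + 2) smaller
      than r already at n = 0.\<close>
    define hn where "hn = (\<lambda>n. r / (norm u + norm w + 1) / real (n + 2))"
    have hn: "hn n > 0" "hn n * (norm u + norm w) < r" for n
    proof -
      have p: "norm u + norm w + 1 > 0" by (smt (verit) norm_ge_zero)
      then show "hn n > 0" using r(1) by (simp add: hn_def)
      have "hn n * (norm u + norm w) \<le> hn n * (norm u + norm w + 1)" using \<open>hn n > 0\<close> by simp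
      also have "\<dots> = r / real (n + 2)" using p by (simp add: hn_def)
      also have "\<dots> < r" using r(1) by (simp add: divide_simps)
      finally show "hn n * (norm u + norm w) < r" .
    qed
    have hn0: "hn \<longlonglongrightarrow> 0"
      using tendsto_mult_right_zero[OF LIMSEQ_ignore_initial_segment[OF lim_1_over_n, of 2],
          of "r / (norm u + norm w + 1)"] by (simp add: hn_def del: of_nat_add)
    have "\<forall>n. \<exists>s t s' t'. 0 < s \<and> s < hn n \<and> 0 < t \<and> t < hn n \<and> 0 < s' \<and> s' < hn n \<and> 0 < t' \<and> t' < hn n \<and>
       pd (pd g u) w (x + s *\<^sub>R u + t *\<^sub>R w) = pd (pd g w) u (x + s' *\<^sub>R w + t' *\<^sub>R u)"
    proof
      fix n
      have [simp]: "hn n \<noteq> 0" using hn(1)[of n] by simp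
      have sym: "g (x + hn n *\<^sub>R u + hn n *\<^sub>R w) - g (x + hn n *\<^sub>R w) - (g (x + hn n *\<^sub>R u) - g x)
         = g (x + hn n *\<^sub>R w + hn n *\<^sub>R u) - g (x + hn n *\<^sub>R u) - (g (x + hn n *\<^sub>R w) - g x)"
        by (simp add: algebra_simps)
      obtain s t where 1: "0 < s" "s < hn n" "0 < t" "t < hn n"
         "g (x + hn n *\<^sub>R u + hn n *\<^sub>R w) - g (x + hn n *\<^sub>R w) - (g (x + hn n *\<^sub>R u) - g x) = hn n * (hn n * pd (pd g u) w (x + s *\<^sub>R u + t *\<^sub>R w))"
        using key[OF hn(1)[of n] hn(2)[of n]] by blast
      obtain s' t' where 2: "0 < s'" "s' < hn n" "0 < t'" "t' < hn n"
         "g (x + hn n *\<^sub>R w + hn n *\<^sub>R u) - g (x + hn n *\<^sub>R u) - (g (x + hn n *\<^sub>R w) - g x) = hn n * (hn n * pd (pd g w) u (x + s' *\<^sub>R w + t' *\<^sub>R u))"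
        using key[OF hn(1)[of n], of w u] hn(2)[of n] by (auto simp: add.commute)
      have "pd (pd g u) w (x + s *\<^sub>R u + t *\<^sub>R w) = pd (pd g w) u (x + s' *\<^sub>R w + t' *\<^sub>R u)"
        using 1(5) 2(5) sym by simp
      then show "\<exists>s t s' t'. 0 < s \<and> s < hn n \<and> 0 < t \<and> t < hn n \<and> 0 < s' \<and> s' < hn n \<and> 0 < t' \<and> t' < hn n \<and>
       pd (pd g u) w (x + s *\<^sub>R u + t *\<^sub>R w) = pd (pd g w) u (x + s' *\<^sub>R w + t' *\<^sub>R u)"
        using 1 2 by blast
    qed
    then obtain s t s' t' where st: "\<And>n. 0 < s n \<and> s n < hn n \<and> 0 < t n \<and> t n < hn n \<and> 0 < s' n \<and> s' n < hn n \<and> 0 < t' n \<and> t' n < hn n \<and>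
       pd (pd g u) w (x + s n *\<^sub>R u + t n *\<^sub>R w) = pd (pd g w) u (x + s' n *\<^sub>R w + t' n *\<^sub>R u)"
      by metis
    have lim0: "a \<longlonglongrightarrow> 0" if "\<And>n. 0 < a n \<and> a n < hn n" for a :: "nat \<Rightarrow> real"
      by (rule tendsto_sandwich[OF always_eventually always_eventually tendsto_const hn0])
        (use that in \<open>auto intro: less_imp_le\<close>)
    have c: "isCont (pd (pd g a) b) x" for a b
      using Ck_on_SucD(2)[OF Ck_on_SucD(2)[OF Cg], of a b] assms(1,3)
      by (simp add: continuous_on_eq_continuous_at)
    have l: "(\<lambda>n. x + p n *\<^sub>R a + q n *\<^sub>R b) \<longlonglongrightarrow> x" if "p \<longlonglongrightarrow> 0" "q \<longlonglongrightarrow> 0" for p q :: "nat \<Rightarrow> real" and a b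
      using tendsto_add[OF tendsto_add[OF tendsto_const tendsto_scaleR[OF that(1) tendsto_const]] tendsto_scaleR[OF that(2) tendsto_const], of x a b]
      by simp
    have "(\<lambda>n. pd (pd g u) w (x + s n *\<^sub>R u + t n *\<^sub>R w)) \<longlonglongrightarrow> pd (pd g u) w x"
      by (rule isCont_tendsto_compose[OF c l]) (use st lim0 in blast)+
    moreover have "(\<lambda>n. pd (pd g w) u (x + s' n *\<^sub>R w + t' n *\<^sub>R u)) \<longlonglongrightarrow> pd (pd g w) u x"
      by (rule isCont_tendsto_compose[OF c l]) (use st lim0 in blast)+
    ultimately show ?thesis
      using st LIMSEQ_unique by auto
  qed
  have Cf: "Ck_on (Suc (Suc 0)) S f" using assms(2) by (simp add: numeral_2_eq_2)
  have comp: "pd (pd (\<lambda>x. f x \<bullet> i) a) b x = pd (pd f a) b x \<bullet> i" for i a b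
  proof -
    have 1: "pd (\<lambda>x. f x \<bullet> i) a y = pd f a y \<bullet> i" if "y \<in> S" for y
      using frechet_derivative_at[OF has_derivative_inner_left[OF Ck_on_SucD(1)[OF Cf that], of i]]
      by (rule fun_cong[symmetric])
    have "((\<lambda>y. pd f a y \<bullet> i) has_derivative (\<lambda>b. pd (pd f a) b x \<bullet> i)) (at x)"
      by (intro has_derivative_inner_left Ck_on_SucD(1)[OF Ck_on_SucD(2)[OF Cf]] assms(3))
    then have "(pd (\<lambda>x. f x \<bullet> i) a has_derivative (\<lambda>b. pd (pd f a) b x \<bullet> i)) (at x)"
      by (rule has_derivative_transform_within_open[OF _ assms(1,3)]) (simp add: 1)
    then show ?thesis by (rule fun_cong[OF frechet_derivative_at, symmetric])
  qed
  have "pd (pd f u) w x \<bullet> i = pd (pd f w) u x \<bullet> i" for i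
    using real[of "\<lambda>x. f x \<bullet> i"] Ck_on_bounded_linear[OF assms(1) bounded_linear_inner_left assms(2), of i]
    by (simp add: comp)
  then show ?thesis by (metis euclidean_eqI)
qed

subsection \<open>Coordinates, matrices and Gram determinants\<close>

text \<open>The change of variables theorem of the library is about \<open>real ^ 'n\<close>; the index type below
  makes it available on an arbitrary Euclidean space.\<close>

typedef (overloaded) ('a::euclidean_space) bidx = "Basis :: 'a set"
  morphisms bvec bidx_of
  using nonempty_Basis by blast

instance bidx :: (euclidean_space) finite
proof
  have "bvec ` (UNIV :: 'a bidx set) \<subseteq> Basis" using bvec by auto
  then show "finite (UNIV :: 'a bidx set)"
    by (meson bvec_inject finite_Basis finite_imageD finite_subset inj_onI)
qed

text \<open>The order is arbitrary, taken from an enumeration of \<open>Basis\<close>; it meets the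
  sort constraint on index types in the change of variables theorem.\<close>

instantiation bidx :: (euclidean_space) wellorder
begin

definition less_eq_bidx :: "'a bidx \<Rightarrow> 'a bidx \<Rightarrow> bool" where
  "i \<le> j \<longleftrightarrow> to_nat_on (Basis :: 'a set) (bvec i) \<le> to_nat_on (Basis :: 'a set) (bvec j)"

definition less_bidx :: "'a bidx \<Rightarrow> 'a bidx \<Rightarrow> bool" where
  "i < j \<longleftrightarrow> to_nat_on (Basis :: 'a set) (bvec i) < to_nat_on (Basis :: 'a set) (bvec j)"

instance
proof
  fix x y z :: "'a bidx"
  have inj: "inj_on (to_nat_on (Basis :: 'a set)) Basis"
    by (intro inj_on_to_nat_on countable_finite finite_Basis)
  show "x = y" if "x \<le> y" "y \<le> x"
  proof -
    have "bvec x = bvec y"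
      using that by (intro inj_onD[OF inj]) (auto simp: less_eq_bidx_def bvec)
    then show ?thesis by (simp add: bvec_inject)
  qed
next
  fix P :: "'a bidx \<Rightarrow> bool" and a
  assume "\<And>x. (\<And>y. y < x \<Longrightarrow> P y) \<Longrightarrow> P x"
  then show "P a"
    using measure_induct_rule[of "\<lambda>i. to_nat_on (Basis :: 'a set) (bvec i)" P a]
    by (simp add: less_bidx_def)
qed (auto simp: less_eq_bidx_def less_bidx_def)

end

lemma bvec_Basis [simp]: "bvec i \<in> Basis" by (rule bvec)

lemma bij_betw_bvec: "bij_betw bvec UNIV (Basis :: 'a::euclidean_space set)"
  by (rule bij_betw_imageI) (simp_all add: inj_def bvec_inject type_definition.Rep_range[OF type_definition_bidx])

lemma sum_bvec: "(\<Sum>i\<in>UNIV. f (bvec i)) = sum f (Basis :: 'a::euclidean_space set)"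
  by (rule sum.reindex_bij_betw[OF bij_betw_bvec])

lemma prod_bvec: "(\<Prod>i\<in>UNIV. f (bvec i)) = prod f (Basis :: 'a::euclidean_space set)"
  by (rule prod.reindex_bij_betw[OF bij_betw_bvec])

lemma inner_bvec: "bvec i \<bullet> bvec j = (if i = j then 1 else 0)"
  by (simp add: inner_Basis bvec_inject)

definition cart :: "'a::euclidean_space \<Rightarrow> real ^ 'a bidx" where
  "cart x = (\<chi> i. x \<bullet> bvec i)"

definition uncart :: "real ^ 'a bidx \<Rightarrow> 'a::euclidean_space" where
  "uncart y = (\<Sum>i\<in>UNIV. y $ i *\<^sub>R bvec i)"

lemma uncart_inner_bvec [simp]: "uncart y \<bullet> bvec i = y $ i"
  by (simp add: uncart_def inner_sum_left inner_bvec if_distrib cong: if_cong)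

lemma cart_uncart [simp]: "cart (uncart y) = y"
  by (simp add: cart_def vec_eq_iff)

lemma uncart_cart [simp]: "uncart (cart x) = x"
  unfolding uncart_def cart_def using sum_bvec[of "\<lambda>b. (x \<bullet> b) *\<^sub>R b"]
  by (simp add: euclidean_representation)

lemma uncart_axis [simp]: "uncart (axis j 1) = bvec j"
  by (simp add: uncart_def axis_def if_distrib[of "\<lambda>c. c *\<^sub>R _"] cong: if_cong)

lemma linear_cart: "linear cart"
  by (rule linearI) (simp_all add: cart_def vec_eq_iff inner_add_left)

lemma linear_uncart: "linear uncart"
  by (rule linearI) (simp_all add: uncart_def algebra_simps sum.distrib scaleR_sum_right)

lemma continuous_on_cart: "continuous_on S cart" and continuous_on_uncart: "continuous_on T uncart"
  by (simp_all add: linear_continuous_on linear_cart linear_uncart linear_conv_bounded_linear[symmetric])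

lemma measurable_cart [measurable]: "cart \<in> borel_measurable borel"
  and measurable_uncart [measurable]: "uncart \<in> borel_measurable borel"
  using continuous_on_cart continuous_on_uncart borel_measurable_continuous_onI by blast+

text \<open>Boxes correspond to boxes with the same side lengths, and Lebesgue measure is determined
  by its values on boxes.\<close>

lemma distr_cart: "distr lborel borel cart = lborel"
proof (rule lborel_eqI[symmetric])
  fix l u :: "real ^ 'a bidx" assume le: "\<And>b. b \<in> Basis \<Longrightarrow> l \<bullet> b \<le> u \<bullet> b"
  have le': "l $ i \<le> u $ i" for i using le[of "axis i 1"] by (simp add: inner_axis axis_in_Basis_iff)
  have "cart -` box l u = box (uncart l) (uncart u)"
  proof (intro set_eqI)
    fix x
    have "(\<forall>b\<in>Basis. uncart l \<bullet> b < x \<bullet> b \<and> x \<bullet> b < uncart u \<bullet> b) \<longleftrightarrow>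
      (\<forall>i. uncart l \<bullet> bvec i < x \<bullet> bvec i \<and> x \<bullet> bvec i < uncart u \<bullet> bvec i)"
      by (metis bij_betw_bvec bij_betw_iff_bijections bvec UNIV_I)
    then show "x \<in> cart -` box l u \<longleftrightarrow> x \<in> box (uncart l) (uncart u)"
      by (simp add: mem_box_cart mem_box cart_def)
  qed
  then have "emeasure (distr lborel borel cart) (box l u) = emeasure lborel (box (uncart l) (uncart u))"
    by (simp add: emeasure_distr)
  also have "\<dots> = (\<Prod>b\<in>Basis. (uncart u - uncart l) \<bullet> b)"
  proof (rule emeasure_lborel_box)
    fix b :: 'a assume "b \<in> Basis"
    then obtain i where "b = bvec i" by (metis bidx_of_inverse)
    then show "uncart l \<bullet> b \<le> uncart u \<bullet> b" using le' by simp
  qed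
  also have "(\<Prod>b\<in>Basis. (uncart u - uncart l) \<bullet> b) = (\<Prod>i\<in>UNIV. u $ i - l $ i)"
    unfolding prod_bvec[symmetric] by (simp add: inner_diff_left)
  also have "\<dots> = measure lborel (cbox l u)"
    using le' by (subst content_cbox_cart) (auto simp: interval_ne_empty_cart)
  also have "\<dots> = (\<Prod>b\<in>Basis. (u - l) \<bullet> b)"
    using le by (simp add: content_cbox' box_ne_empty inner_diff_left)
  finally show "emeasure (distr lborel borel cart) (box l u) = (\<Prod>b\<in>Basis. (u - l) \<bullet> b)" .
qed simp

lemma nn_integral_cart:
  assumes [measurable]: "f \<in> borel_measurable borel"
  shows "(\<integral>\<^sup>+y. f (uncart y) \<partial>lborel) = (\<integral>\<^sup>+x. f x \<partial>lborel)"
  by (subst distr_cart[symmetric], subst nn_integral_distr) simp_all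

definition mat_of :: "('a \<Rightarrow> 'a) \<Rightarrow> real ^ 'a::euclidean_space bidx ^ 'a bidx" where
  "mat_of L = (\<chi> i j. L (bvec j) \<bullet> bvec i)"

lemma matrix_cart: "matrix (\<lambda>y. cart (L (uncart y))) = mat_of L"
  by (simp add: matrix_def mat_of_def cart_def)

section \<open>Change of variables for nonnegative integrals\<close>

lemma nn_integral_eq_absolutely_integrable:
  fixes h :: "'a::euclidean_space \<Rightarrow> real"
  assumes "\<And>x. x \<in> A \<Longrightarrow> h x \<ge> 0" "(\<lambda>x. indicator A x * h x) \<in> borel_measurable borel"
  shows "(\<integral>\<^sup>+x. ennreal (h x) * indicator A x \<partial>lborel) =
    (if h absolutely_integrable_on A then ennreal (integral A h) else \<infinity>)"
proof -
  have nn: "(\<integral>\<^sup>+x. ennreal (h x) * indicator A x \<partial>lborel) = (\<integral>\<^sup>+x. ennreal (indicator A x * h x) \<partial>lborel)"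
    by (intro nn_integral_cong) (auto simp: indicator_def)
  have pos: "indicator A x * h x \<ge> 0" for x using assms(1) by (auto simp: indicator_def)
  have ai: "h absolutely_integrable_on A \<longleftrightarrow> integrable lborel (\<lambda>x. indicator A x * h x)"
    using assms(2) by (simp add: set_integrable_def integrable_completion)
  show ?thesis
  proof (cases "h absolutely_integrable_on A")
    case True
    then have "integral A h = (LINT x|lebesgue. indicator A x * h x)"
      using set_lebesgue_integral_eq_integral(2)[OF True] by (simp add: set_lebesgue_integral_def)
    also have "\<dots> = (LINT x|lborel. indicator A x * h x)"
      using assms(2) by (simp add: integral_completion)
    finally show ?thesis
      using True ai nn_integral_eq_integral[of lborel "\<lambda>x. indicator A x * h x"] pos nn by simp
  next
    case False
    then have "(\<integral>\<^sup>+x. ennreal (norm (indicator A x * h x)) \<partial>lborel) = \<infinity>"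
      using ai assms(2) unfolding integrable_iff_bounded
      by (simp add: not_less top_unique)
    then show ?thesis using False nn pos by simp
  qed
qed

text \<open>The change of variables theorem for absolutely integrable functions, conjugated with
  \<open>cart\<close>. Since it also transfers integrability in both directions, the two nonnegative
  integrals are infinite together, and no integrability is assumed.\<close>

lemma nn_integral_lborel_substitution:
  fixes T :: "'a::euclidean_space \<Rightarrow> 'a" and f :: "'a \<Rightarrow> real"
  assumes S: "S \<in> sets borel" and TS: "T ` S \<in> sets borel"
    and der: "\<And>x. x \<in> S \<Longrightarrow> (T has_derivative T' x) (at x within S)"
    and inj: "inj_on T S"
    and f: "f \<in> borel_measurable borel" "\<And>x. f x \<ge> 0"
    and m: "(\<lambda>x. indicator S x * (\<bar>det (mat_of (T' x))\<bar> * f (T x))) \<in> borel_measurable borel"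
  shows "(\<integral>\<^sup>+y. ennreal (f y) * indicator (T ` S) y \<partial>lborel) =
    (\<integral>\<^sup>+x. ennreal (\<bar>det (mat_of (T' x))\<bar> * f (T x)) * indicator S x \<partial>lborel)"
proof -
  note [measurable] = S TS f(1)
  let ?S = "uncart -` S" and ?g = "\<lambda>y. cart (T (uncart y))"
  let ?D = "\<lambda>y. \<bar>det (mat_of (T' (uncart y)))\<bar> * f (uncart (?g y))"
  have S': "?S \<in> sets borel" using measurable_sets_borel[OF measurable_uncart S] by simp
  have gS: "?g ` ?S = uncart -` (T ` S)"
  proof (intro set_eqI iffI)
    fix y assume "y \<in> uncart -` (T ` S)"
    then obtain x where "x \<in> S" "uncart y = T x" by auto
    then show "y \<in> ?g ` ?S" using cart_uncart[of y] by (intro image_eqI[of _ _ "cart x"]) simp_all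
  qed auto
  have ind: "indicator ?S y = indicator S (uncart y)" "indicator (?g ` ?S) y = indicator (T ` S) (uncart y)" for y
    unfolding gS by (auto simp: indicator_def)
  have der': "(?g has_derivative (\<lambda>h. cart (T' (uncart y) (uncart h)))) (at y within ?S)" if "y \<in> ?S" for y
  proof -
    have 1: "(uncart has_derivative uncart) (at y within ?S)" 
      by (simp add: linear_imp_has_derivative linear_uncart)
    have "(T has_derivative T' (uncart y)) (at (uncart y) within uncart ` ?S)"
      by (rule has_derivative_subset[OF der]) (use that in auto)
    from has_derivative_in_compose[OF 1 this]
    have 2: "((\<lambda>x. T (uncart x)) has_derivative (\<lambda>x. T' (uncart y) (uncart x))) (at y within ?S)" .
    show ?thesis
      using linear_cart bounded_linear.has_derivative[OF _ 2] linear_conv_bounded_linear by blast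
  qed
  have inj': "inj_on ?g ?S"
    using inj by (auto simp: inj_on_def) (metis cart_uncart uncart_cart)
  \<comment> \<open>The value \<open>b\<close> stays arbitrary: taking for it the integral on either
    side yields first the equivalence of integrability and then equality of the integrals.\<close>
  have key: "?D absolutely_integrable_on ?S \<and> integral ?S ?D = b \<longleftrightarrow>
     (\<lambda>y. f (uncart y)) absolutely_integrable_on (?g ` ?S) \<and> integral (?g ` ?S) (\<lambda>y. f (uncart y)) = b" for b
  proof -
    have "?S \<in> sets lebesgue" using S' by simp
    from has_absolute_integral_change_of_variables[OF this der' inj', of "\<lambda>y. vec (f (uncart y)) :: real ^ 1" "vec b"]
    show ?thesis
      by (simp add: absolutely_integrable_on_1_iff integral_on_1_eq matrix_cart)
  qed
  have ai: "?D absolutely_integrable_on ?S \<longleftrightarrow> (\<lambda>y. f (uncart y)) absolutely_integrable_on (?g ` ?S)"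
    using key by blast
  have eq: "integral ?S ?D = integral (?g ` ?S) (\<lambda>y. f (uncart y))" if "?D absolutely_integrable_on ?S"
    using key that by blast
  have "(\<integral>\<^sup>+y. ennreal (f y) * indicator (T ` S) y \<partial>lborel) =
    (\<integral>\<^sup>+y. ennreal (f (uncart y)) * indicator (?g ` ?S) y \<partial>lborel)"
    unfolding ind by (subst nn_integral_cart) auto
  also have "\<dots> = (if ?D absolutely_integrable_on ?S then ennreal (integral ?S ?D) else \<infinity>)"
    unfolding ai using eq ai
    by (subst nn_integral_eq_absolutely_integrable) (auto simp: f(2) ind(2))
  also have "\<dots> = (\<integral>\<^sup>+y. ennreal (?D y) * indicator ?S y \<partial>lborel)"
  proof (rule nn_integral_eq_absolutely_integrable[symmetric])
    show "(\<lambda>y. indicator ?S y * ?D y) \<in> borel_measurable borel"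
      unfolding ind using measurable_compose[OF measurable_uncart m] by simp
  qed (simp add: f(2))
  also have "\<dots> = (\<integral>\<^sup>+y. (\<lambda>x. ennreal (indicator S x * (\<bar>det (mat_of (T' x))\<bar> * f (T x)))) (uncart y) \<partial>lborel)"
    by (intro nn_integral_cong) (auto simp: indicator_def)
  also have "\<dots> = (\<integral>\<^sup>+x. ennreal (indicator S x * (\<bar>det (mat_of (T' x))\<bar> * f (T x))) \<partial>lborel)"
    by (rule nn_integral_cart) (use m in measurable)
  also have "\<dots> = (\<integral>\<^sup>+x. ennreal (\<bar>det (mat_of (T' x))\<bar> * f (T x)) * indicator S x \<partial>lborel)"
    by (intro nn_integral_cong) (auto simp: indicator_def)
  finally show ?thesis .
qed

section \<open>Projections to coordinate subspaces and padded Gram matrices\<close>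

definition proj :: "'a::euclidean_space set \<Rightarrow> 'a \<Rightarrow> 'a" where
  "proj B x = (\<Sum>b\<in>B. (x \<bullet> b) *\<^sub>R b)"

lemma linear_proj: "linear (proj B)"
  by (rule linearI) (simp_all add: proj_def inner_add_left algebra_simps sum.distrib scaleR_sum_right)

lemma continuous_on_proj: "continuous_on S (proj B)"
  unfolding proj_def by (intro continuous_intros)

lemma measurable_proj [measurable]: "proj B \<in> borel_measurable borel"
  using continuous_on_proj borel_measurable_continuous_onI by blast

lemma proj_in_span [simp]: "proj B x \<in> span B"
  unfolding proj_def by (intro span_sum span_scale span_base)

lemma proj_span:
  assumes "B \<subseteq> Basis" "x \<in> span B"
  shows "proj B x = x"
proof -
  have fin: "finite B" using assms(1) finite_Basis finite_subset by blast
  have "proj B b = b" if "b \<in> B" for b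
    unfolding proj_def using assms(1) that fin
    by (subst sum.cong[OF refl, of _ _ "\<lambda>c. if c = b then b else 0"])
      (auto simp: inner_Basis subset_eq)
  then show ?thesis
    using linear_eq_on_span[OF linear_proj linear_ident, of B B x] assms(2) by auto
qed

lemma inner_proj:
  assumes "B \<subseteq> Basis" "c \<in> Basis"
  shows "proj B x \<bullet> c = (if c \<in> B then x \<bullet> c else 0)"
proof -
  have fin: "finite B" using assms(1) finite_Basis finite_subset by blast
  have "proj B x \<bullet> c = (\<Sum>b\<in>B. (x \<bullet> b) * (b \<bullet> c))" by (simp add: proj_def inner_sum_left)
  also have "\<dots> = (\<Sum>b\<in>B. if b = c then x \<bullet> c else 0)"
    using assms by (intro sum.cong) (auto simp: inner_Basis subset_eq)
  finally show ?thesis using fin by auto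
qed

lemma span_iff_inner_zero:
  assumes "B \<subseteq> Basis"
  shows "x \<in> span B \<longleftrightarrow> (\<forall>c\<in>Basis - B. x \<bullet> c = 0)"
proof
  assume "x \<in> span B"
  then have "x \<bullet> c = 0" if "c \<in> Basis - B" for c
    using inner_proj[OF assms, of c x] proj_span[OF assms, of x] that by simp
  then show "\<forall>c\<in>Basis - B. x \<bullet> c = 0" by blast
next
  assume "\<forall>c\<in>Basis - B. x \<bullet> c = 0"
  then have "proj B x \<bullet> c = x \<bullet> c" if "c \<in> Basis" for c
    using inner_proj[OF assms that, of x] that by simp
  then have "proj B x = x" by (rule euclidean_eqI)
  then show "x \<in> span B" by (metis proj_in_span)
qed

text \<open>Bilinearity of this form, \<open>gform_sum\<close>, is what turns a change of basis into
  a congruence of Gram matrices.\<close>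

definition gform :: "'a::euclidean_space set \<Rightarrow> ('a \<Rightarrow> 'b::real_inner) \<Rightarrow> 'a \<Rightarrow> 'a \<Rightarrow> real" where
  "gform B d u w = d (proj B u) \<bullet> d (proj B w) + (u - proj B u) \<bullet> (w - proj B w)"

text \<open>The Gram matrix of \<open>d\<close> on \<open>span B\<close>, extended by the identity on the complement, so that
  matrices of one fixed size suffice for all dimensions.\<close>

definition gmat :: "'a::euclidean_space set \<Rightarrow> ('a \<Rightarrow> 'b::real_inner) \<Rightarrow> real ^ 'a bidx ^ 'a bidx" where
  "gmat B d = (\<chi> i j. gform B d (bvec i) (bvec j))"

lemma proj_Basis: "B \<subseteq> Basis \<Longrightarrow> b \<in> Basis \<Longrightarrow> proj B b = (if b \<in> B then b else 0)"
  by (rule euclidean_eqI) (auto simp: inner_proj inner_Basis)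

lemma gmat_nth:
  assumes "B \<subseteq> Basis" "linear d"
  shows "gmat B d $ i $ j = (if bvec i \<in> B \<and> bvec j \<in> B then d (bvec i) \<bullet> d (bvec j) else if i = j then 1 else 0)"
  using assms by (auto simp: gmat_def gform_def proj_Basis linear_0 inner_bvec)

lemma gform_sum:
  fixes I :: "'i set" and J :: "'j set"
  assumes "linear d"
  shows "gform B d (\<Sum>i\<in>I. f i *\<^sub>R u i) (\<Sum>j\<in>J. g j *\<^sub>R w j) = (\<Sum>i\<in>I. \<Sum>j\<in>J. f i * g j * gform B d (u i) (w j))"
proof -
  have l: "linear (\<lambda>x. d (proj B x))"
    using linear_compose[OF linear_proj assms, of B] by (simp add: o_def)
  have e1: "d (proj B (\<Sum>i\<in>I. f i *\<^sub>R u i)) = (\<Sum>i\<in>I. f i *\<^sub>R d (proj B (u i)))" for I :: "'i set" and f u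
    by (simp add: linear_sum[OF l] linear_scale[OF l])
  have e1': "d (proj B (\<Sum>i\<in>I. f i *\<^sub>R u i)) = (\<Sum>i\<in>I. f i *\<^sub>R d (proj B (u i)))" for I :: "'j set" and f u
    by (simp add: linear_sum[OF l] linear_scale[OF l])
  have e2: "(\<Sum>i\<in>I. f i *\<^sub>R u i) - proj B (\<Sum>i\<in>I. f i *\<^sub>R u i) = (\<Sum>i\<in>I. f i *\<^sub>R (u i - proj B (u i)))" for I :: "'i set" and f u
    by (simp add: linear_sum[OF linear_proj] linear_scale[OF linear_proj] sum_subtractf algebra_simps)
  have e2': "(\<Sum>i\<in>I. f i *\<^sub>R u i) - proj B (\<Sum>i\<in>I. f i *\<^sub>R u i) = (\<Sum>i\<in>I. f i *\<^sub>R (u i - proj B (u i)))" for I :: "'j set" and f u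
    by (simp add: linear_sum[OF linear_proj] linear_scale[OF linear_proj] sum_subtractf algebra_simps)
  have e3: "(\<Sum>i\<in>I. f i *\<^sub>R a i) \<bullet> (\<Sum>j\<in>J. g j *\<^sub>R b j) = (\<Sum>i\<in>I. \<Sum>j\<in>J. f i * g j * (a i \<bullet> b j))"
    for a :: "'i \<Rightarrow> 'c::real_inner" and b
    unfolding inner_sum_left unfolding inner_sum_right by (simp add: mult_ac)
  show ?thesis
    unfolding gform_def e1 e1' e2 e2' e3 by (simp only: sum.distrib[symmetric] distrib_left)
qed

text \<open>A permutation moving an index outside \<open>I\<close> meets a zero entry of the
  padding, so the Leibniz sum of the full matrix reduces to permutations of \<open>I\<close>;
  \<open>map_permutation\<close> carries these to permutations of \<open>B\<close> with the same
  sign.\<close>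

lemma gram_det_eq_det:
  assumes B: "B \<subseteq> Basis" and "linear (frechet_derivative \<psi> (at x))"
  shows "gram_det B \<psi> x = det (gmat B (frechet_derivative \<psi> (at x)))"
proof -
  let ?d = "frechet_derivative \<psi> (at x)"
  let ?G = "gmat B ?d"
  define I where "I = {i. bvec i \<in> B}"
  note G = gmat_nth[OF assms]
  have bijI: "bij_betw bvec I B"
    unfolding I_def bij_betw_def inj_on_def using B by (auto simp: bvec_inject image_iff) (metis bidx_of_inverse subsetD)
  have bijB: "bij_betw bidx_of B I"
    unfolding I_def bij_betw_def inj_on_def using B
    by (auto simp: image_iff bidx_of_inverse subset_eq) (metis bidx_of_inverse subsetD bvec_inverse)+
  have inv1: "\<And>b. b \<in> B \<Longrightarrow> bvec (bidx_of b) = b" using B bidx_of_inverse by blast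
  have "det ?G = (\<Sum>p\<in>{p. p permutes UNIV}. of_int (sign p) * (\<Prod>i\<in>UNIV. ?G $ i $ p i))"
    by (simp add: det_def)
  also have "\<dots> = (\<Sum>p\<in>{p. p permutes I}. of_int (sign p) * (\<Prod>i\<in>UNIV. ?G $ i $ p i))"
  proof (rule sum.mono_neutral_right)
    show "\<forall>p\<in>{p. p permutes UNIV} - {p. p permutes I}. of_int (sign p) * (\<Prod>i\<in>UNIV. ?G $ i $ p i) = 0"
    proof
      fix p assume p: "p \<in> {p. p permutes UNIV} - {p. p permutes I}"
      then obtain i where "i \<notin> I" "p i \<noteq> i"
        by (auto simp: permutes_def)
      then have "?G $ i $ p i = 0" by (simp add: G I_def)
      then show "of_int (sign p) * (\<Prod>i\<in>UNIV. ?G $ i $ p i) = 0"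
        by (metis UNIV_I finite_code mult_zero_right prod_zero)
    qed
  qed (auto simp: permutes_subset finite_permutations)
  also have "\<dots> = (\<Sum>p\<in>{p. p permutes I}. of_int (sign p) * (\<Prod>i\<in>I. ?G $ i $ p i))"
  proof (intro sum.cong refl arg_cong2[of _ _ _ _ "(*)"])
    fix p assume "p \<in> {p. p permutes I}"
    then show "(\<Prod>i\<in>UNIV. ?G $ i $ p i) = (\<Prod>i\<in>I. ?G $ i $ p i)"
      by (intro prod.mono_neutral_right) (auto simp: G I_def permutes_def)
  qed
  also have "\<dots> = (\<Sum>\<pi>\<in>{\<pi>. \<pi> permutes B}. of_int (sign \<pi>) * (\<Prod>b\<in>B. ?d b \<bullet> ?d (\<pi> b)))"
  proof (rule sum.reindex_bij_witness[where i = "map_permutation B bidx_of" and j = "map_permutation I bvec"])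
    fix p assume "p \<in> {p. p permutes I}"
    then have p: "p permutes I" by simp
    show "map_permutation B bidx_of (map_permutation I bvec p) = p"
      by (rule map_permutation_compose_inv[OF bijI p]) (simp add: bvec_inverse)
    show "map_permutation I bvec p \<in> {\<pi>. \<pi> permutes B}"
      using map_permutation_permutes[OF bijI p] by simp
    have sg: "sign (map_permutation I bvec p) = sign p"
      by (rule sign_map_permutation) (use p bijI in \<open>auto simp: bij_betw_def\<close>)
    have "(\<Prod>b\<in>B. ?d b \<bullet> ?d (map_permutation I bvec p b)) = (\<Prod>i\<in>I. ?d (bvec i) \<bullet> ?d (map_permutation I bvec p (bvec i)))"
      by (rule prod.reindex_bij_betw[OF bijI, symmetric])
    also have "\<dots> = (\<Prod>i\<in>I. ?G $ i $ p i)"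
    proof (rule prod.cong[OF refl])
      fix i assume i: "i \<in> I"
      then have "p i \<in> I" using p by (simp add: permutes_in_image)
      then show "?d (bvec i) \<bullet> ?d (map_permutation I bvec p (bvec i)) = ?G $ i $ p i"
        using i bijI by (subst map_permutation_apply) (auto simp: G I_def bij_betw_def)
    qed
    finally show "of_int (sign (map_permutation I bvec p)) * (\<Prod>b\<in>B. ?d b \<bullet> ?d (map_permutation I bvec p b)) =
      of_int (sign p) * (\<Prod>i\<in>I. ?G $ i $ p i)" using sg by simp
  next
    fix p assume "p \<in> {\<pi>. \<pi> permutes B}"
    then have p: "p permutes B" by simp
    show "map_permutation I bvec (map_permutation B bidx_of p) = p"
      by (rule map_permutation_compose_inv[OF bijB p]) (simp add: inv1)
    show "map_permutation B bidx_of p \<in> {\<pi>. \<pi> permutes I}"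
      using map_permutation_permutes[OF bijB p] by simp
  qed
  finally show ?thesis by (simp add: gram_det_def)
qed

text \<open>The quadratic form stays positive on the segment from the identity to \<open>A\<close>,
  so no matrix on it is singular. The determinant starts at 1 and cannot become nonpositive without
  vanishing in between.\<close>

lemma matrix_quadratic_pos_imp_det_pos:
  fixes A :: "real ^ 'n ^ 'n"
  assumes "\<And>y. y \<noteq> 0 \<Longrightarrow> y \<bullet> (A *v y) > 0"
  shows "det A > 0"
proof (rule ccontr)
  assume neg: "\<not> det A > 0"
  let ?A = "\<lambda>t. (1 - t) *\<^sub>R mat 1 + t *\<^sub>R A :: real ^ 'n ^ 'n"
  have cont: "continuous_on {0..1} (\<lambda>t. det (?A t))"
    unfolding det_def by (intro continuous_intros)
  have "\<exists>t\<ge>0. t \<le> 1 \<and> det (?A t) = 0"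
    by (rule IVT2'[OF _ _ _ cont]) (use neg in auto)
  then obtain t where t: "0 \<le> t" "t \<le> 1" "det (?A t) = 0" by blast
  then have "\<not> (\<exists>B. B ** ?A t = mat 1)"
    using invertible_det_nz invertible_left_inverse by blast
  then obtain y where y: "y \<noteq> 0" "?A t *v y = 0"
    unfolding matrix_left_invertible_ker by blast
  have "?A t *v y = (1 - t) *\<^sub>R y + t *\<^sub>R (A *v y)"
    by (simp add: matrix_vector_mult_add_rdistrib scaleR_matrix_vector_assoc[symmetric])
  then have "(1 - t) * (y \<bullet> y) + t * (y \<bullet> (A *v y)) = 0"
    using y(2) by (metis inner_add_right inner_scaleR_right inner_zero_right)
  moreover have "y \<bullet> y > 0" "y \<bullet> (A *v y) > 0" using y(1) assms by auto
  ultimately show False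
    using t by (smt (verit) mult_nonneg_nonneg mult_pos_pos)
qed

lemma det_gmat_pos:
  assumes B: "B \<subseteq> Basis" and d: "linear d" and inj: "\<And>w. w \<in> span B \<Longrightarrow> d w = 0 \<Longrightarrow> w = 0"
  shows "det (gmat B d) > 0"
proof (rule matrix_quadratic_pos_imp_det_pos)
  fix y :: "real ^ 'a bidx" assume y: "y \<noteq> 0"
  have "y \<bullet> (gmat B d *v y) = gform B d (uncart y) (uncart y)"
    unfolding uncart_def gform_sum[OF d]
    by (simp add: inner_vec_def matrix_vector_mult_def gmat_def sum_distrib_left mult_ac)
  also have "\<dots> > 0"
  proof (rule ccontr)
    let ?u = "uncart y"
    assume "\<not> gform B d ?u ?u > 0"
    then have "d (proj B ?u) = 0" "?u - proj B ?u = 0"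
      unfolding gform_def by (smt (verit) inner_ge_zero inner_gt_zero_iff)+
    moreover from this have "proj B ?u = ?u" by simp
    ultimately have "?u = 0" using inj[of ?u] proj_in_span[of B ?u] by simp
    moreover have "cart (0::'a) = 0" by (rule linear_0[OF linear_cart])
    ultimately show False using y by (metis cart_uncart)
  qed
  finally show "y \<bullet> (gmat B d *v y) > 0" .
qed

text \<open>\<open>L\<close> matches \<open>d\<close> with \<open>d'\<close> on \<open>B\<close> and
  carries the complementary unit vectors injectively to complementary unit vectors of
  \<open>C\<close>. It therefore pulls the padded form of \<open>d'\<close> back to that of
  \<open>d\<close>, which reads G = L^T G' L.\<close>

lemma det_gmat_transform:
  assumes B: "B \<subseteq> Basis" and C: "C \<subseteq> Basis" and lin: "linear d" "linear d'"
    and L: "\<And>b. b \<in> B \<Longrightarrow> L b \<in> span C \<and> d' (L b) = d b"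
    and J: "\<And>b. b \<in> Basis - B \<Longrightarrow> L b \<in> Basis - C" "inj_on L (Basis - B)"
  shows "det (gmat B d) = (det (mat_of L))\<^sup>2 * det (gmat C d')"
proof -
  have "gmat B d = transpose (mat_of L) ** gmat C d' ** mat_of L"
  proof (intro vec_eq_iff[THEN iffD2] allI)
    fix i j
    have rep: "u = (\<Sum>k\<in>UNIV. (u \<bullet> bvec k) *\<^sub>R bvec k)" for u :: 'a
      using uncart_cart[of u] by (simp add: uncart_def cart_def)
    have "(transpose (mat_of L) ** gmat C d' ** mat_of L) $ i $ j
       = (\<Sum>l\<in>UNIV. \<Sum>k\<in>UNIV. (L (bvec i) \<bullet> bvec k) * (L (bvec j) \<bullet> bvec l) * gform C d' (bvec k) (bvec l))"
      by (simp add: matrix_matrix_mult_def transpose_def mat_of_def gmat_def sum_distrib_right sum_distrib_left mult_ac)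
    also have "\<dots> = (\<Sum>k\<in>UNIV. \<Sum>l\<in>UNIV. (L (bvec i) \<bullet> bvec k) * (L (bvec j) \<bullet> bvec l) * gform C d' (bvec k) (bvec l))"
      by (rule sum.swap)
    also have "\<dots> = gform C d' (L (bvec i)) (L (bvec j))"
      by (subst (5) rep, subst (3) rep, rule gform_sum[OF lin(2), symmetric])
    also have "\<dots> = gmat B d $ i $ j"
    proof -
      have 1: "proj C (L b) = L b \<and> d' (L b) = d b" if "b \<in> B" for b
        using L[OF that] proj_span[OF C] by blast
      have 2: "proj C (L b) = 0" if "b \<in> Basis - B" for b
        using J(1)[OF that] proj_Basis[OF C] by auto
      have 3: "L b \<bullet> L c = (if b = c then 1 else 0)" if "b \<in> Basis - B" "c \<in> Basis - B" for b c
        using J that by (auto simp: inner_Basis inj_on_def)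
      have 4: "d' 0 = 0" using lin(2) by (rule linear_0)
      show ?thesis
        unfolding gmat_nth[OF B lin(1)] gform_def
        by (cases "bvec i \<in> B"; cases "bvec j \<in> B") (auto simp: 1 2 3 4 bvec_inject)
    qed
    finally show "gmat B d $ i $ j = (transpose (mat_of L) ** gmat C d' ** mat_of L) $ i $ j" by simp
  qed
  then show ?thesis by (simp add: det_mul power2_eq_square)
qed

subsection \<open>Lebesgue measure on coordinate subspaces\<close>

lemma finite_subset_Basis: "B \<subseteq> (Basis :: 'a::euclidean_space set) \<Longrightarrow> finite B"
  using finite_Basis finite_subset by blast

lemma sets_slice_measure [simp, measurable_cong]: "sets (slice_measure B) = sets borel"
  by (simp add: slice_measure_def)

lemma space_slice_measure [simp]: "space (slice_measure B) = UNIV"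
  by (simp add: slice_measure_def)

definition unit_cube_off :: "'a::euclidean_space set \<Rightarrow> 'a set" where
  "unit_cube_off B = {z. \<forall>c\<in>Basis - B. 0 \<le> z \<bullet> c \<and> z \<bullet> c \<le> 1}"

lemma unit_cube_off_borel [measurable]: "unit_cube_off B \<in> sets borel"
proof -
  have "unit_cube_off B = (\<Inter>c\<in>Basis - B. {z. 0 \<le> z \<bullet> c \<and> z \<bullet> c \<le> 1})"
    by (auto simp: unit_cube_off_def)
  moreover have "closed (\<Inter>c\<in>Basis - B. {z. 0 \<le> z \<bullet> c \<and> z \<bullet> c \<le> 1})"
    by (intro closed_INT ballI closed_Collect_conj closed_Collect_le continuous_intros)
  ultimately show ?thesis by (simp add: borel_closed)
qed

text \<open>Thickening a subset of \<open>span B\<close> by the unit cube of the complementary coordinates turns its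
  lower-dimensional measure into Lebesgue measure.\<close>

lemma nn_integral_slice_measure:
  assumes B: "B \<subseteq> Basis" and f [measurable]: "f \<in> borel_measurable borel"
  shows "(\<integral>\<^sup>+x. f x \<partial>slice_measure B) = (\<integral>\<^sup>+z. f (proj B z) * indicator (unit_cube_off B) z \<partial>lborel)"
proof -
  interpret product_sigma_finite "\<lambda>_::'a. lborel :: real measure"
    by standard
  have fin: "finite B" "finite (Basis - B)" using finite_subset_Basis[OF B] by auto
  have un: "B \<union> (Basis - B) = Basis" using B by auto
  let ?s = "\<lambda>g :: 'a \<Rightarrow> real. \<Sum>b\<in>Basis. g b *\<^sub>R b"
  have [measurable]: "?s \<in> borel_measurable (\<Pi>\<^sub>M b\<in>Basis. lborel)"
    by (intro borel_measurable_sum borel_measurable_scaleR) measurable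
  have [measurable]: "(\<lambda>g :: 'a \<Rightarrow> real. \<Sum>b\<in>B. g b *\<^sub>R b) \<in> borel_measurable (\<Pi>\<^sub>M b\<in>B. lborel)"
    by (intro borel_measurable_sum borel_measurable_scaleR) measurable
  have inner_s: "?s g \<bullet> c = g c" if "c \<in> Basis" for g c
    using that by (simp add: inner_sum_left inner_Basis if_distrib cong: if_cong)
  have "(\<integral>\<^sup>+z. f (proj B z) * indicator (unit_cube_off B) z \<partial>lborel)
     = (\<integral>\<^sup>+g. f (proj B (?s g)) * indicator (unit_cube_off B) (?s g) \<partial>(\<Pi>\<^sub>M b\<in>Basis. lborel))"
    by (subst lborel_eq, subst nn_integral_distr) measurable
  also have "\<dots> = (\<integral>\<^sup>+g. \<integral>\<^sup>+h. f (proj B (?s (merge B (Basis - B) (g, h)))) *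
      indicator (unit_cube_off B) (?s (merge B (Basis - B) (g, h))) \<partial>(\<Pi>\<^sub>M b\<in>Basis - B. lborel) \<partial>(\<Pi>\<^sub>M b\<in>B. lborel))"
  proof -
    have disj: "B \<inter> (Basis - B) = {}" by auto
    have m: "(\<lambda>g. f (proj B (?s g)) * indicator (unit_cube_off B) (?s g)) \<in> borel_measurable (\<Pi>\<^sub>M b\<in>B \<union> (Basis - B). lborel)"
      unfolding un by measurable
    show ?thesis
      using product_nn_integral_fold[OF disj fin m] unfolding un .
  qed
  \<comment> \<open>The thickening factor splits into one-dimensional indicators of the unit
    interval, each of integral 1.\<close>
  also have "\<dots> = (\<integral>\<^sup>+g. \<integral>\<^sup>+h. f (\<Sum>b\<in>B. g b *\<^sub>R b) * (\<Prod>c\<in>Basis - B. indicator {0..1::real} (h c))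
      \<partial>(\<Pi>\<^sub>M b\<in>Basis - B. lborel) \<partial>(\<Pi>\<^sub>M b\<in>B. lborel))"
  proof (intro nn_integral_cong)
    fix g h :: "'a \<Rightarrow> real"
    let ?m = "merge B (Basis - B) (g, h)"
    have "proj B (?s ?m) = (\<Sum>b\<in>B. g b *\<^sub>R b)"
      unfolding proj_def using B by (intro sum.cong) (auto simp: inner_s merge_def)
    then have e1: "f (proj B (?s ?m)) = f (\<Sum>b\<in>B. g b *\<^sub>R b)" by simp
    have "?s ?m \<in> unit_cube_off B \<longleftrightarrow> (\<forall>c\<in>Basis - B. h c \<in> {0..1})"
      by (auto simp: unit_cube_off_def inner_s merge_def)
    moreover have "(\<Prod>c\<in>Basis - B. indicator {0..1::real} (h c)) = (if \<forall>c\<in>Basis - B. h c \<in> {0..1} then 1 else 0 :: ennreal)"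
    proof (cases "\<forall>c\<in>Basis - B. h c \<in> {0..1}")
      case False
      then have "\<exists>c\<in>Basis - B. indicator {0..1::real} (h c) = (0 :: ennreal)"
        by (force simp: indicator_def)
      then show ?thesis using prod_zero[OF fin(2)] False by simp
    qed simp
    ultimately have e2: "indicator (unit_cube_off B) (?s ?m) = (\<Prod>c\<in>Basis - B. indicator {0..1::real} (h c) :: ennreal)"
      by (auto simp: indicator_def)
    show "f (proj B (?s ?m)) * indicator (unit_cube_off B) (?s ?m)
       = f (\<Sum>b\<in>B. g b *\<^sub>R b) * (\<Prod>c\<in>Basis - B. indicator {0..1::real} (h c))"
      by (simp only: e1 e2)
  qed
  also have "\<dots> = (\<integral>\<^sup>+g. f (\<Sum>b\<in>B. g b *\<^sub>R b) \<partial>(\<Pi>\<^sub>M b\<in>B. lborel))"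
  proof (intro nn_integral_cong)
    fix g :: "'a \<Rightarrow> real"
    have "(\<integral>\<^sup>+h. f (\<Sum>b\<in>B. g b *\<^sub>R b) * (\<Prod>c\<in>Basis - B. indicator {0..1::real} (h c)) \<partial>(\<Pi>\<^sub>M b\<in>Basis - B. lborel))
       = f (\<Sum>b\<in>B. g b *\<^sub>R b) * (\<integral>\<^sup>+h. (\<Prod>c\<in>Basis - B. indicator {0..1::real} (h c)) \<partial>(\<Pi>\<^sub>M b\<in>Basis - B. lborel))"
      by (rule nn_integral_cmult) measurable
    also have "(\<integral>\<^sup>+h. (\<Prod>c\<in>Basis - B. indicator {0..1::real} (h c)) \<partial>(\<Pi>\<^sub>M b\<in>Basis - B. lborel)) =
        (\<Prod>c\<in>Basis - B. \<integral>\<^sup>+t. indicator {0..1::real} t \<partial>lborel)"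
      by (rule product_nn_integral_prod[OF fin(2)]) simp
    also have "\<dots> = 1" by simp
    finally show "(\<integral>\<^sup>+h. f (\<Sum>b\<in>B. g b *\<^sub>R b) * (\<Prod>c\<in>Basis - B. indicator {0..1::real} (h c)) \<partial>(\<Pi>\<^sub>M b\<in>Basis - B. lborel))
      = f (\<Sum>b\<in>B. g b *\<^sub>R b)" by simp
  qed
  also have "\<dots> = (\<integral>\<^sup>+x. f x \<partial>slice_measure B)"
    unfolding slice_measure_def by (rule nn_integral_distr[symmetric]) measurable
  finally show ?thesis by simp
qed

lemma AE_slice_measure:
  assumes B: "B \<subseteq> Basis"
  shows "AE x in slice_measure B. x \<in> span B"
proof -
  have m [measurable]: "- span B \<in> sets borel" by (simp add: borel_closed)
  have "emeasure (slice_measure B) (- span B) = (\<integral>\<^sup>+x. indicator (- span B) x \<partial>slice_measure B)"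
    by simp
  also have "\<dots> = (\<integral>\<^sup>+z. indicator (- span B) (proj B z) * indicator (unit_cube_off B) z \<partial>lborel)"
    by (rule nn_integral_slice_measure[OF B]) measurable
  also have "\<dots> = 0" by simp
  finally show ?thesis by (intro AE_I[of _ _ "- span B"]) auto
qed

text \<open>The thickened ball lies in a box: coordinates in \<open>B\<close> are bounded by the
  radius, the others by 1.\<close>

lemma emeasure_slice_measure_cball:
  assumes B: "B \<subseteq> Basis"
  shows "emeasure (slice_measure B) (cball 0 R) < \<infinity>"
proof -
  have [measurable]: "cball 0 R \<in> sets (borel :: 'a measure)" by (simp add: borel_closed)
  have "emeasure (slice_measure B) (cball 0 R) = (\<integral>\<^sup>+x. indicator (cball 0 R) x \<partial>slice_measure B)"
    by simp
  also have "\<dots> = (\<integral>\<^sup>+z. indicator (cball 0 R) (proj B z) * indicator (unit_cube_off B) z \<partial>lborel)"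
    by (rule nn_integral_slice_measure[OF B]) measurable
  also have "\<dots> \<le> (\<integral>\<^sup>+(z::'a). indicator (cbox (- (\<bar>R\<bar> + 1) *\<^sub>R One) ((\<bar>R\<bar> + 1) *\<^sub>R One)) z \<partial>lborel)"
  proof (rule nn_integral_mono)
    fix z :: 'a
    have "z \<in> cbox (- (\<bar>R\<bar> + 1) *\<^sub>R One) ((\<bar>R\<bar> + 1) *\<^sub>R One)" if "norm (proj B z) \<le> R" "z \<in> unit_cube_off B"
    proof -
      have "\<bar>z \<bullet> c\<bar> \<le> \<bar>R\<bar> + 1" if c: "c \<in> Basis" for c
      proof (cases "c \<in> B")
        case True
        then have "\<bar>z \<bullet> c\<bar> = \<bar>proj B z \<bullet> c\<bar>" using inner_proj[OF B c, of z] by simp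
        also have "\<dots> \<le> norm (proj B z)" using c by (rule Basis_le_norm)
        finally show ?thesis using \<open>norm (proj B z) \<le> R\<close> by linarith
      next
        case False
        then have "0 \<le> z \<bullet> c" "z \<bullet> c \<le> 1" using \<open>z \<in> unit_cube_off B\<close> c by (auto simp: unit_cube_off_def)
        then show ?thesis by simp
      qed
      then show ?thesis unfolding mem_box by (force simp: abs_le_iff)
    qed
    then show "indicator (cball 0 R) (proj B z) * indicator (unit_cube_off B) z
       \<le> (indicator (cbox (- (\<bar>R\<bar> + 1) *\<^sub>R One) ((\<bar>R\<bar> + 1) *\<^sub>R One)) z :: ennreal)"
      by (auto simp: indicator_def)
  qed
  also have "\<dots> < \<infinity>" using emeasure_lborel_cbox_finite by simp
  finally show ?thesis .
qed

text \<open>\<open>T\<close> is extended to the thickened sets by sending the complementary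
  coordinates of \<open>B\<close> to those of \<open>C\<close> along \<open>j\<close>, which matches
  the two unit cubes, and the full-dimensional substitution is applied to the extension. The weight
  \<open>w\<close> is a separate parameter so that measurability is asked of it directly and not of
  the Jacobian.\<close>

lemma nn_integral_slice_substitution:
  fixes T :: "'a::euclidean_space \<Rightarrow> 'a" and f :: "'a \<Rightarrow> real"
  assumes B: "B \<subseteq> Basis" and C: "C \<subseteq> Basis" and j: "bij_betw j (Basis - B) (Basis - C)"
    and S: "S \<in> sets borel" and TS: "T ` S \<in> sets borel" and SB: "S \<subseteq> span B" and TC: "T ` S \<subseteq> span C"
    and der: "\<And>x. x \<in> S \<Longrightarrow> (T has_derivative T' x) (at x within S)"
    and inj: "inj_on T S"
    and f: "f \<in> borel_measurable borel" "\<And>x. f x \<ge> 0"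
    and w: "\<And>x. x \<in> S \<Longrightarrow>
      \<bar>det (mat_of (\<lambda>h. T' x (proj B h) + (\<Sum>b\<in>Basis - B. (h \<bullet> b) *\<^sub>R j b)))\<bar> * f (T x) = w x"
    and m: "(\<lambda>x. indicator S x * w x) \<in> borel_measurable borel"
  shows "(\<integral>\<^sup>+y. ennreal (f y) * indicator (T ` S) y \<partial>slice_measure C) =
    (\<integral>\<^sup>+x. ennreal (w x) * indicator S x \<partial>slice_measure B)"
proof -
  note [measurable] = S TS f(1)
  define J where "J h = (\<Sum>b\<in>Basis - B. (h \<bullet> b) *\<^sub>R j b)" for h
  have linJ: "linear J"
    by (rule linearI) (simp_all add: J_def inner_add_left algebra_simps sum.distrib scaleR_sum_right)
  have jB: "j b \<in> Basis" "j b \<notin> C" if "b \<in> Basis - B" for b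
    using bij_betwE[OF j] that by auto
  have J1: "J z \<bullet> j b = z \<bullet> b" if "b \<in> Basis - B" for z b
  proof -
    have "J z \<bullet> j b = (\<Sum>b'\<in>Basis - B. (z \<bullet> b') * (j b' \<bullet> j b))"
      by (simp add: J_def inner_sum_left)
    also have "\<dots> = (\<Sum>b'\<in>Basis - B. if b' = b then z \<bullet> b else 0)"
      using that j jB by (intro sum.cong) (auto simp: inner_Basis bij_betw_def inj_on_def)
    finally show ?thesis using that by simp
  qed
  have J2: "J z \<bullet> c = 0" if "c \<in> C" for z c
  proof -
    have "j b \<bullet> c = 0" if b: "b \<in> Basis - B" for b
      using jB[OF b] \<open>c \<in> C\<close> C by (intro inner_not_same_Basis) auto
    then show ?thesis by (simp add: J_def inner_sum_left)
  qed
  define T1 where "T1 z = T (proj B z) + J z" for z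
  define S1 where "S1 = {z. proj B z \<in> S} \<inter> unit_cube_off B"
  have pT1: "proj C (T1 z) = T (proj B z)" if "proj B z \<in> S" for z
  proof -
    have "proj C (J z) = 0" unfolding proj_def using J2 by simp
    moreover have "proj C (T (proj B z)) = T (proj B z)" using that TC by (intro proj_span[OF C]) auto
    ultimately show ?thesis by (simp add: T1_def linear_add[OF linear_proj])
  qed
  have iT1: "T1 z \<bullet> j b = z \<bullet> b" if "proj B z \<in> S" "b \<in> Basis - B" for z b
  proof -
    have "T (proj B z) \<bullet> j b = 0"
      using that TC jB span_iff_inner_zero[OF C, of "T (proj B z)"] by blast
    then show ?thesis using J1[OF that(2)] by (simp add: T1_def inner_add_left)
  qed
  have cube: "T1 z \<in> unit_cube_off C \<longleftrightarrow> z \<in> unit_cube_off B" if "proj B z \<in> S" for z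
  proof -
    have "T1 z \<in> unit_cube_off C \<longleftrightarrow> (\<forall>b\<in>Basis - B. 0 \<le> T1 z \<bullet> j b \<and> T1 z \<bullet> j b \<le> 1)"
      unfolding unit_cube_off_def mem_Collect_eq bij_betw_imp_surj_on[OF j, symmetric] by simp
    then show ?thesis using iT1[OF that] by (auto simp: unit_cube_off_def)
  qed
  have image: "T1 ` S1 = {y. proj C y \<in> T ` S} \<inter> unit_cube_off C"
  proof (intro set_eqI iffI)
    fix y assume "y \<in> T1 ` S1"
    then show "y \<in> {y. proj C y \<in> T ` S} \<inter> unit_cube_off C"
      using pT1 cube by (auto simp: S1_def)
  next
    fix y assume y: "y \<in> {y. proj C y \<in> T ` S} \<inter> unit_cube_off C"
    then obtain x where x: "x \<in> S" "proj C y = T x" by auto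
    \<comment> \<open>The preimage of \<open>y\<close>: its part in span B is the preimage under
      \<open>T\<close> of the projection, and its other coordinates are those of \<open>y\<close>
      read back along \<open>j\<close>.\<close>
    define z where "z = x + (\<Sum>b\<in>Basis - B. (y \<bullet> j b) *\<^sub>R b)"
    have zb: "z \<bullet> b = y \<bullet> j b" if "b \<in> Basis - B" for b
    proof -
      have "x \<bullet> b = 0" using x(1) SB span_iff_inner_zero[OF B, of x] that by blast
      moreover have "(\<Sum>c\<in>Basis - B. (y \<bullet> j c) * (c \<bullet> b)) = (\<Sum>c\<in>Basis - B. if c = b then y \<bullet> j b else 0)"
        using that by (intro sum.cong) (auto simp: inner_Basis)
      ultimately show ?thesis using that by (simp add: z_def inner_add_left inner_sum_left)
    qed
    have pz: "proj B z = x"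
    proof (rule euclidean_eqI)
      fix c :: 'a assume c: "c \<in> Basis"
      have "(\<Sum>b\<in>Basis - B. (y \<bullet> j b) *\<^sub>R b) \<bullet> c = 0" if "c \<in> B"
        unfolding inner_sum_left using that c by (intro sum.neutral) (auto simp: inner_Basis)
      moreover have "x \<bullet> c = 0" if "c \<notin> B"
        using x(1) SB span_iff_inner_zero[OF B, of x] that c by blast
      ultimately show "proj B z \<bullet> c = x \<bullet> c"
        unfolding inner_proj[OF B c] by (auto simp: z_def inner_add_left)
    qed
    have "T1 z = y"
    proof (rule euclidean_eqI)
      fix c :: 'a assume c: "c \<in> Basis"
      show "T1 z \<bullet> c = y \<bullet> c"
      proof (cases "c \<in> C")
        case True
        then have "T1 z \<bullet> c = proj C (T1 z) \<bullet> c" using inner_proj[OF C c] by simp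
        also have "\<dots> = proj C y \<bullet> c" using pT1[of z] pz x by simp
        finally show ?thesis using True inner_proj[OF C c] by simp
      next
        case False
        then obtain b where b: "b \<in> Basis - B" "c = j b" using j c by (auto simp: bij_betw_def image_iff)
        then show ?thesis using iT1[of z b] pz x zb by simp
      qed
    qed
    moreover have "z \<in> S1" using cube[of z] pz x y \<open>T1 z = y\<close> by (simp add: S1_def)
    ultimately show "y \<in> T1 ` S1" by blast
  qed
  have S1m [measurable]: "S1 \<in> sets borel"
    unfolding S1_def by (intro sets.Int unit_cube_off_borel) (use measurable_sets_borel[OF measurable_proj S] in \<open>simp add: vimage_def\<close>)
  have im1m: "T1 ` S1 \<in> sets borel"
    unfolding image by (intro sets.Int unit_cube_off_borel) (use measurable_sets_borel[OF measurable_proj TS] in \<open>simp add: vimage_def\<close>)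
  have inj1: "inj_on T1 S1"
  proof (rule inj_onI)
    fix z z' assume z: "z \<in> S1" "z' \<in> S1" "T1 z = T1 z'"
    then have p: "proj B z \<in> S" "proj B z' \<in> S" by (auto simp: S1_def)
    then have eq: "proj B z = proj B z'" using z(3) pT1 inj by (metis inj_onD)
    show "z = z'"
    proof (rule euclidean_eqI)
      fix c :: 'a assume c: "c \<in> Basis"
      show "z \<bullet> c = z' \<bullet> c"
      proof (cases "c \<in> B")
        case True
        then show ?thesis using eq inner_proj[OF B c] by metis
      next
        case False
        then show ?thesis using iT1[of z c] iT1[of z' c] p z(3) c by simp
      qed
    qed
  qed
  have der1: "(T1 has_derivative (\<lambda>h. T' (proj B z) (proj B h) + J h)) (at z within S1)" if "z \<in> S1" for z
  proof -
    have 1: "(proj B has_derivative proj B) (at z within S1)"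
      by (rule linear_imp_has_derivative[OF linear_proj])
    have 2: "(T has_derivative T' (proj B z)) (at (proj B z) within proj B ` S1)"
      by (rule has_derivative_subset[OF der]) (use that in \<open>auto simp: S1_def\<close>)
    have 3: "((\<lambda>z. T (proj B z)) has_derivative (\<lambda>h. T' (proj B z) (proj B h))) (at z within S1)"
      by (rule has_derivative_in_compose[OF 1 2])
    show ?thesis
      unfolding T1_def[abs_def] by (intro has_derivative_add 3 linear_imp_has_derivative linJ)
  qed
  have w1: "\<bar>det (mat_of (\<lambda>h. T' (proj B z) (proj B h) + J h))\<bar> * f (proj C (T1 z)) = w (proj B z)" if "z \<in> S1" for z
    using w[of "proj B z"] pT1[of z] that by (simp add: S1_def J_def)
  have indS1: "indicator S1 z = (indicator S (proj B z) * indicator (unit_cube_off B) z :: 'b::{zero_neq_one,semiring_1})" for z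
    by (auto simp: S1_def indicator_def)
  have "(\<integral>\<^sup>+y. ennreal (f y) * indicator (T ` S) y \<partial>slice_measure C) =
    (\<integral>\<^sup>+y. ennreal (f (proj C y)) * indicator (T ` S) (proj C y) * indicator (unit_cube_off C) y \<partial>lborel)"
    by (rule nn_integral_slice_measure[OF C]) measurable
  also have "\<dots> = (\<integral>\<^sup>+y. ennreal (f (proj C y)) * indicator (T1 ` S1) y \<partial>lborel)"
    unfolding image by (intro nn_integral_cong) (auto simp: indicator_def)
  also have "\<dots> = (\<integral>\<^sup>+z. ennreal (\<bar>det (mat_of (\<lambda>h. T' (proj B z) (proj B h) + J h))\<bar> * f (proj C (T1 z))) * indicator S1 z \<partial>lborel)"
  proof (rule nn_integral_lborel_substitution[OF S1m im1m der1 inj1])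
    have "(\<lambda>z. indicator S1 z * (\<bar>det (mat_of (\<lambda>h. T' (proj B z) (proj B h) + J h))\<bar> * f (proj C (T1 z)))) =
       (\<lambda>z. indicator (unit_cube_off B) z * (indicator S (proj B z) * w (proj B z)))"
    proof
      fix z
      show "indicator S1 z * (\<bar>det (mat_of (\<lambda>h. T' (proj B z) (proj B h) + J h))\<bar> * f (proj C (T1 z))) =
        indicator (unit_cube_off B) z * (indicator S (proj B z) * w (proj B z))"
        using w1[of z] by (cases "z \<in> S1") (auto simp: S1_def indicator_def)
    qed
    moreover have "\<dots> \<in> borel_measurable borel"
      using measurable_compose[OF measurable_proj m, of B] by measurable
    ultimately show "(\<lambda>z. indicator S1 z * (\<bar>det (mat_of (\<lambda>h. T' (proj B z) (proj B h) + J h))\<bar> * f (proj C (T1 z)))) \<in> borel_measurable borel"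
      by simp
  qed (use f(2) in auto)
  also have "\<dots> = (\<integral>\<^sup>+z. ennreal (indicator S (proj B z) * w (proj B z)) * indicator (unit_cube_off B) z \<partial>lborel)"
    using w1 by (intro nn_integral_cong) (auto simp: indicator_def S1_def)
  also have "\<dots> = (\<integral>\<^sup>+x. ennreal (indicator S x * w x) \<partial>slice_measure B)"
    by (rule nn_integral_slice_measure[OF B, symmetric]) (use m in measurable)
  also have "\<dots> = (\<integral>\<^sup>+x. ennreal (w x) * indicator S x \<partial>slice_measure B)"
    by (intro nn_integral_cong) (auto simp: indicator_def)
  finally show ?thesis .
qed

section \<open>Integration by parts on half-spaces of coordinate subspaces\<close>

lemma integrable_slice_measure:
  fixes G :: "'a::euclidean_space \<Rightarrow> real"
  assumes B: "B \<subseteq> Basis" and A [measurable]: "A \<in> sets borel" and G: "continuous_on UNIV G"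
    and supp: "\<And>x. norm x > R \<Longrightarrow> G x = 0"
  shows "integrable (slice_measure B) (\<lambda>x. indicator A x * G x)"
proof -
  have [measurable]: "G \<in> borel_measurable borel" using G by (rule borel_measurable_continuous_onI)
  have "compact (G ` cball 0 R)" by (intro compact_continuous_image continuous_on_subset[OF G]) auto
  then obtain K where K: "\<And>x. x \<in> cball 0 R \<Longrightarrow> norm (G x) \<le> K"
    using compact_imp_bounded[of "G ` cball 0 R"] unfolding bounded_iff by blast
  show ?thesis
  proof (rule integrableI_bounded_set[where A="cball 0 R" and B="\<bar>K\<bar>"])
    show "AE x in slice_measure B. x \<in> cball 0 R \<longrightarrow> norm (indicator A x * G x) \<le> \<bar>K\<bar>"
      using K by (intro AE_I2) (force simp: indicator_def)
    show "AE x in slice_measure B. x \<notin> cball 0 R \<longrightarrow> indicator A x * G x = 0"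
      using supp by (intro AE_I2) auto
  qed (use emeasure_slice_measure_cball[OF B] in auto)
qed

lemma integral_slice_measure_insert:
  fixes G :: "'a::euclidean_space \<Rightarrow> real"
  assumes B: "B \<subseteq> Basis" and b: "b \<in> B" and G: "integrable (slice_measure B) G"
  shows "(LINT x|slice_measure B. G x) = (LINT p|slice_measure (B - {b}). LINT t|lborel. G (p + t *\<^sub>R b))"
proof -
  interpret product_sigma_finite "\<lambda>_::'a. lborel :: real measure"
    by standard
  have fin: "finite (B - {b})" using finite_subset_Basis[OF B] by auto
  have ins: "insert b (B - {b}) = B" using b by auto
  have Gm [measurable]: "G \<in> borel_measurable borel" using borel_measurable_integrable[OF G] by simp
  let ?s = "\<lambda>B. \<lambda>g :: 'a \<Rightarrow> real. \<Sum>b\<in>B. g b *\<^sub>R b"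
  have sm [measurable]: "?s D \<in> borel_measurable (\<Pi>\<^sub>M b\<in>D. lborel)" for D
    by (intro borel_measurable_sum borel_measurable_scaleR) measurable
  have int: "integrable (\<Pi>\<^sub>M b\<in>B. lborel) (\<lambda>g. G (?s B g))"
    using G unfolding slice_measure_def by (subst (asm) integrable_distr_eq) auto
  have "(LINT x|slice_measure B. G x) = (LINT g|(\<Pi>\<^sub>M b\<in>B. lborel). G (?s B g))"
    unfolding slice_measure_def by (rule integral_distr) auto
  also have "\<dots> = (LINT g|(\<Pi>\<^sub>M b\<in>B - {b}. lborel). LINT t|lborel. G (?s B (g(b := t))))"
    using product_integral_insert[OF fin, of b "\<lambda>g. G (?s B g)"] int unfolding ins by simp
  also have "\<dots> = (LINT g|(\<Pi>\<^sub>M b\<in>B - {b}. lborel). LINT t|lborel. G (?s (B - {b}) g + t *\<^sub>R b))"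
  proof -
    have "?s B (g(b := t)) = ?s (B - {b}) g + t *\<^sub>R b" for g t
    proof -
      have "?s B (g(b := t)) = t *\<^sub>R b + (\<Sum>c\<in>B - {b}. (g(b := t)) c *\<^sub>R c)"
        using sum.remove[OF finite_subset_Basis[OF B] b, of "\<lambda>c. (g(b := t)) c *\<^sub>R c"] by simp
      also have "(\<Sum>c\<in>B - {b}. (g(b := t)) c *\<^sub>R c) = ?s (B - {b}) g" by (intro sum.cong) auto
      finally show ?thesis by simp
    qed
    then show ?thesis by simp
  qed
  also have "\<dots> = (LINT p|slice_measure (B - {b}). LINT t|lborel. G (p + t *\<^sub>R b))"
    unfolding slice_measure_def
  proof (rule integral_distr[symmetric])
    show "(\<lambda>p. LINT t|lborel. G (p + t *\<^sub>R b)) \<in> borel_measurable borel"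
      by (intro lborel.borel_measurable_lebesgue_integral) measurable
  qed measurable
  finally show ?thesis .
qed

lemma integral_derivative_compact_support:
  fixes g :: "real \<Rightarrow> real"
  assumes der: "\<And>t. (g has_real_derivative g' t) (at t)" and cont: "continuous_on UNIV g'"
    and supp: "\<And>t. \<bar>t\<bar> > R \<Longrightarrow> g t = 0" "\<And>t. \<bar>t\<bar> > R \<Longrightarrow> g' t = 0"
  shows "(LINT t|lborel. g' t) = 0" "(LINT t|lborel. indicator {0..} t * g' t) = - g 0"
proof -
  have cg': "isCont g' t" for t using cont by (simp add: continuous_on_eq_continuous_at)
  have ftc: "(LINT t|lborel. indicator {a..b} t * g' t) = g b - g a" if "a \<le> b" for a b
    using integral_FTC_Icc_real[OF that, of g g'] der cg' by (simp add: mult.commute)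
  \<comment> \<open>Positive and strictly beyond \<open>R\<close> even if \<open>R\<close> is
    negative, so that both functions vanish at the ends of the truncated intervals.\<close>
  define K where "K = \<bar>R\<bar> + 1"
  have "(LINT t|lborel. g' t) = (LINT t|lborel. indicator {- K..K} t * g' t)"
    by (intro Bochner_Integration.integral_cong) (auto simp: indicator_def K_def intro!: supp(2))
  then show "(LINT t|lborel. g' t) = 0"
    using ftc[of "- K" K] supp(1)[of K] supp(1)[of "- K"] by (simp add: K_def)
  have "(LINT t|lborel. indicator {0..} t * g' t) = (LINT t|lborel. indicator {0..K} t * g' t)"
    by (intro Bochner_Integration.integral_cong) (auto simp: indicator_def K_def intro!: supp(2))
  then show "(LINT t|lborel. indicator {0..} t * g' t) = - g 0"
    using ftc[of 0 K] supp(1)[of K] by (simp add: K_def)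
qed

text \<open>Fubini integrates along the coordinate \<open>b\<close> first. For b = e each line is
  cut at 0 and the lower limit leaves minus the value of \<open>F\<close> there; for any other
  \<open>b\<close> the half-space is invariant along the line, and compact support makes the inner
  integral vanish.\<close>

lemma integral_pd_slice:
  fixes F :: "'a::euclidean_space \<Rightarrow> real"
  assumes B: "B \<subseteq> Basis" and b: "b \<in> B" and e: "e \<in> insert 0 B"
    and F: "Ck_on 1 UNIV F" and supp: "\<And>x. norm x > R \<Longrightarrow> F x = 0"
  shows "integrable (slice_measure B) (\<lambda>x. indicator (model_slice B e) x * pd F b x)"
    and "(LINT x|slice_measure B. indicator (model_slice B e) x * pd F b x) =
      (if b = e then - (LINT x|slice_measure (B - {e}). F x) else 0)"
proof -
  have cF: "continuous_on UNIV (pd F b)" using F by simp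
  have dF: "(F has_derivative frechet_derivative F (at x)) (at x)" for x
    using Ck_on_has_derivative[OF F] by simp
  have suppd: "pd F b x = 0" if "norm x > R" for x
  proof -
    have "open {x :: 'a. norm x > R}" by (intro open_Collect_less continuous_intros)
    then have "frechet_derivative F (at x) = frechet_derivative (\<lambda>x. 0) (at x)"
      using that supp dF by (intro frechet_derivative_transform_within_open[of F x "{x. norm x > R}"]) (auto simp: differentiable_def)
    then show ?thesis by simp
  qed
  have half [measurable]: "{x. 0 \<le> x \<bullet> e} \<in> sets borel"
    by (intro borel_closed closed_Collect_le continuous_intros)
  have mod: "model_slice B e = span B \<inter> {x. 0 \<le> x \<bullet> e}" by (auto simp: model_slice_def)
  have modm: "model_slice B e \<in> sets borel" unfolding mod by (intro sets.Int half) (simp add: borel_closed)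
  show "integrable (slice_measure B) (\<lambda>x. indicator (model_slice B e) x * pd F b x)"
    by (rule integrable_slice_measure[OF B modm cF suppd])
  \<comment> \<open>The measure lives on span B, so membership in span B may be dropped from the
    slice; the remaining half-space indicator is easy to follow along lines.\<close>
  have "(LINT x|slice_measure B. indicator (model_slice B e) x * pd F b x)
      = (LINT x|slice_measure B. indicator {x. 0 \<le> x \<bullet> e} x * pd F b x)"
  proof (rule integral_cong_AE)
    show "AE x in slice_measure B. indicator (model_slice B e) x * pd F b x = indicator {x. 0 \<le> x \<bullet> e} x * pd F b x"
      using AE_slice_measure[OF B] by eventually_elim (auto simp: mod indicator_def)
  qed (use modm half borel_measurable_continuous_onI[OF cF] in measurable)
  also have "\<dots> = (LINT p|slice_measure (B - {b}). LINT t|lborel. indicator {x. 0 \<le> x \<bullet> e} (p + t *\<^sub>R b) * pd F b (p + t *\<^sub>R b))"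
    by (rule integral_slice_measure_insert[OF B b integrable_slice_measure[OF B half cF suppd]])
  also have "\<dots> = (LINT p|slice_measure (B - {b}). (if b = e then - F p else 0))"
  proof (rule integral_cong_AE)
    have nb: "norm b = 1" using B b by auto
    have Bb: "B - {b} \<subseteq> Basis" using B by auto
    show "AE p in slice_measure (B - {b}). (LINT t|lborel. indicator {x. 0 \<le> x \<bullet> e} (p + t *\<^sub>R b) * pd F b (p + t *\<^sub>R b)) = (if b = e then - F p else 0)"
      using AE_slice_measure[OF Bb]
    proof eventually_elim
      fix p assume p: "p \<in> span (B - {b})"
      have der: "((\<lambda>t. F (p + t *\<^sub>R b)) has_real_derivative pd F b (p + t *\<^sub>R b)) (at t)" for t
      proof -
        have "((\<lambda>t. p + t *\<^sub>R b) has_derivative (\<lambda>s. s *\<^sub>R b)) (at t)" by (auto intro!: derivative_eq_intros)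
        from has_derivative_compose[OF this dF]
        have "((\<lambda>t. F (p + t *\<^sub>R b)) has_derivative (\<lambda>s. pd F (s *\<^sub>R b) (p + t *\<^sub>R b))) (at t)" .
        moreover have "pd F (s *\<^sub>R b) (p + t *\<^sub>R b) = s * pd F b (p + t *\<^sub>R b)" for s
          using linear_scale[OF has_derivative_linear[OF dF]] by simp
        ultimately show ?thesis by (simp add: has_field_derivative_def mult_commute_abs)
      qed
      have cont: "continuous_on UNIV (\<lambda>t. pd F b (p + t *\<^sub>R b))"
        by (rule continuous_on_compose2[OF cF]) (auto intro!: continuous_intros)
      have far: "norm (p + t *\<^sub>R b) > R" if "\<bar>t\<bar> > \<bar>R\<bar> + norm p" for t
      proof -
        have "\<bar>t\<bar> = norm (t *\<^sub>R b)" using nb by simp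
        also have "\<dots> \<le> norm (p + t *\<^sub>R b) + norm p" using norm_triangle_ineq4[of "p + t *\<^sub>R b" p] by simp
        finally show ?thesis using that by linarith
      qed
      note ftc = integral_derivative_compact_support[OF der cont, of "\<bar>R\<bar> + norm p", OF supp[OF far] suppd[OF far]]
      show "(LINT t|lborel. indicator {x. 0 \<le> x \<bullet> e} (p + t *\<^sub>R b) * pd F b (p + t *\<^sub>R b)) = (if b = e then - F p else 0)"
      proof (cases "b = e")
        case True
        have "p \<bullet> b = 0" using p span_iff_inner_zero[of "B - {b}" p] B b by blast
        then have "indicator {x. 0 \<le> x \<bullet> e} (p + t *\<^sub>R b) = (indicator {0..} t :: real)" for t
          using True nb by (auto simp: indicator_def inner_add_left dot_square_norm)
        then show ?thesis using ftc(2) True by simp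
      next
        case False
        then have "b \<bullet> e = 0" using B b e inner_not_same_Basis[of b e] by (cases "e = 0") auto
        then have "indicator {x. 0 \<le> x \<bullet> e} (p + t *\<^sub>R b) = (indicator {x. 0 \<le> x \<bullet> e} p :: real)" for t
          by (auto simp: indicator_def inner_add_left)
        then show ?thesis using ftc(1) False by simp
      qed
    qed
    show "(\<lambda>p. LINT t|lborel. indicator {x. 0 \<le> x \<bullet> e} (p + t *\<^sub>R b) * pd F b (p + t *\<^sub>R b)) \<in> borel_measurable (slice_measure (B - {b}))"
    proof (intro lborel.borel_measurable_lebesgue_integral)
      have [measurable]: "(\<lambda>x. pd F b (fst x + snd x *\<^sub>R b)) \<in> borel_measurable (borel \<Otimes>\<^sub>M borel)"
        by (rule measurable_compose[OF _ borel_measurable_continuous_onI[OF cF]]) measurable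
      show "(\<lambda>(p, t). indicator {x. 0 \<le> x \<bullet> e} (p + t *\<^sub>R b) * pd F b (p + t *\<^sub>R b)) \<in> borel_measurable (slice_measure (B - {b}) \<Otimes>\<^sub>M lborel)"
        by measurable
    qed
    show "(\<lambda>p. if b = e then - F p else 0) \<in> borel_measurable (slice_measure (B - {b}))"
      using borel_measurable_continuous_onI[OF Ck_on_continuous[OF F]] by measurable
  qed
  also have "\<dots> = (if b = e then - (LINT x|slice_measure (B - {e}). F x) else 0)"
    by auto
  finally show "(LINT x|slice_measure B. indicator (model_slice B e) x * pd F b x) =
      (if b = e then - (LINT x|slice_measure (B - {e}). F x) else 0)" .
qed

subsection \<open>Geometry of a chart\<close>

lemma model_slice_0: "model_slice B 0 = span B"
  by (auto simp: model_slice_def)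

lemma closed_model_slice: "closed (model_slice B e)"
proof -
  have "model_slice B e = span B \<inter> {x. 0 \<le> x \<bullet> e}" by (auto simp: model_slice_def)
  moreover have "closed {x. 0 \<le> x \<bullet> e}" by (intro closed_Collect_le continuous_intros)
  ultimately show ?thesis by (simp add: closed_Int)
qed

lemma borel_Int_vimage:
  fixes f :: "'a::topological_space \<Rightarrow> 'b::topological_space"
  assumes "open U" "continuous_on U f" "A \<in> sets borel"
  shows "U \<inter> f -` A \<in> sets borel"
proof -
  have "f \<in> borel_measurable (restrict_space borel U)"
    using assms(2) by (rule borel_measurable_continuous_on_restrict)
  from measurable_sets[OF this assms(3)]
  have "f -` A \<inter> U \<in> sets (restrict_space borel U)" by (simp add: space_restrict_space)
  then show ?thesis using assms(1) by (simp add: sets_restrict_space_iff Int_commute)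
qed

locale chart =
  fixes k :: nat and M :: "'a::euclidean_space set" and B :: "'a set" and e :: 'a
    and U :: "'a set" and \<psi> :: "'a \<Rightarrow> 'a"
  assumes slice_chart: "slice_chart k M B e U \<psi>"
begin

definition \<phi> :: "'a \<Rightarrow> 'a" where "\<phi> = inv_into U \<psi>"

abbreviation d\<psi> :: "'a \<Rightarrow> 'a \<Rightarrow> 'a" where "d\<psi> x \<equiv> frechet_derivative \<psi> (at x)"

lemma B: "B \<subseteq> Basis" and card_B: "card B = k" and e: "e \<in> insert 0 B"
  and open_U: "open U" and open_image: "open (\<psi> ` U)" and inj: "inj_on \<psi> U"
  and Ck_psi: "Ck_on n U \<psi>" and Ck_phi: "Ck_on n (\<psi> ` U) \<phi>"
  and M_eq: "M \<inter> \<psi> ` U = \<psi> ` (U \<inter> model_slice B e)"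
  using slice_chart unfolding slice_chart_def smooth_on_def \<phi>_def by blast+

lemma finite_B: "finite B" using B by (rule finite_subset_Basis)

lemma phi_psi [simp]: "x \<in> U \<Longrightarrow> \<phi> (\<psi> x) = x"
  using inj by (simp add: \<phi>_def)

lemma psi_phi [simp]: "y \<in> \<psi> ` U \<Longrightarrow> \<psi> (\<phi> y) = y"
  by (simp add: \<phi>_def f_inv_into_f)

lemma phi_in [simp]: "y \<in> \<psi> ` U \<Longrightarrow> \<phi> y \<in> U"
  by (simp add: \<phi>_def inv_into_into)

lemma in_M_iff: "x \<in> U \<Longrightarrow> \<psi> x \<in> M \<longleftrightarrow> x \<in> model_slice B e"
  using M_eq inj by (auto simp: inj_on_def)

lemma in_M_imp_slice: "x \<in> U \<Longrightarrow> \<psi> x \<in> M \<Longrightarrow> x \<in> model_slice B e"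
  using in_M_iff by blast

lemma slice_span: "x \<in> model_slice B e \<Longrightarrow> x \<in> span B"
  by (simp add: model_slice_def)

lemma has_derivative_psi: "x \<in> U \<Longrightarrow> (\<psi> has_derivative d\<psi> x) (at x)"
  using Ck_on_has_derivative[OF Ck_psi[of 1]] by simp

lemma has_derivative_phi: "y \<in> \<psi> ` U \<Longrightarrow> (\<phi> has_derivative frechet_derivative \<phi> (at y)) (at y)"
  using Ck_on_has_derivative[OF Ck_phi[of 1]] by simp

lemma linear_dpsi: "x \<in> U \<Longrightarrow> linear (d\<psi> x)"
  using has_derivative_psi has_derivative_linear by blast

lemma dphi_dpsi: assumes "x \<in> U" shows "pd \<phi> (d\<psi> x h) (\<psi> x) = h"
proof -
  have "((\<lambda>x. \<phi> (\<psi> x)) has_derivative (\<lambda>h. pd \<phi> (d\<psi> x h) (\<psi> x))) (at x)"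
    by (rule has_derivative_compose[OF has_derivative_psi[OF assms] has_derivative_phi[OF imageI[OF assms]]])
  moreover have "((\<lambda>x. \<phi> (\<psi> x)) has_derivative (\<lambda>h. h)) (at x)"
    by (rule has_derivative_transform_within_open[OF has_derivative_ident open_U assms]) simp
  ultimately have "(\<lambda>h. pd \<phi> (d\<psi> x h) (\<psi> x)) = (\<lambda>h. h)" by (rule has_derivative_unique)
  then show ?thesis by (simp add: fun_eq_iff)
qed

lemma dpsi_dphi: assumes "x \<in> U" shows "d\<psi> x (pd \<phi> h (\<psi> x)) = h"
proof -
  have y: "\<psi> x \<in> \<psi> ` U" using assms by simp
  have 1: "(\<psi> has_derivative d\<psi> x) (at (\<phi> (\<psi> x)))"
    using has_derivative_psi[OF assms] assms by simp
  have "((\<lambda>y. \<psi> (\<phi> y)) has_derivative (\<lambda>h. d\<psi> x (pd \<phi> h (\<psi> x)))) (at (\<psi> x))"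
    by (rule has_derivative_compose[where g=\<psi> and f=\<phi> and g'="d\<psi> x" and f'="frechet_derivative \<phi> (at (\<psi> x))",
          OF has_derivative_phi[OF y] 1])
  moreover have "((\<lambda>y. \<psi> (\<phi> y)) has_derivative (\<lambda>h. h)) (at (\<psi> x))"
    by (rule has_derivative_transform_within_open[OF has_derivative_ident open_image y]) simp
  ultimately have "(\<lambda>h. d\<psi> x (pd \<phi> h (\<psi> x))) = (\<lambda>h. h)" by (rule has_derivative_unique)
  then show ?thesis by (simp add: fun_eq_iff)
qed

lemma dpsi_inj:
  assumes "x \<in> U" "d\<psi> x h = d\<psi> x h'"
  shows "h = h'"
  by (rule trans[OF dphi_dpsi[OF assms(1), symmetric]]) (simp only: assms(2) dphi_dpsi[OF assms(1)])

lemma dpsi_eq_0: "x \<in> U \<Longrightarrow> d\<psi> x h = 0 \<Longrightarrow> h = 0"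
  using dpsi_inj[of x h 0] linear_0[OF linear_dpsi] by simp

lemma gram_det_eq: "x \<in> U \<Longrightarrow> gram_det D \<psi> x = det (gmat D (d\<psi> x))" if "D \<subseteq> Basis"
  using gram_det_eq_det that linear_dpsi by blast

text \<open>The ambient derivative is injective on the whole space, so positivity holds for every
  set of coordinates, in particular for those of the boundary.\<close>

lemma gram_det_pos:
  assumes "x \<in> U" "D \<subseteq> Basis"
  shows "gram_det D \<psi> x > 0"
  unfolding gram_det_eq[OF assms(2,1)]
  by (rule det_gmat_pos[OF assms(2) linear_dpsi[OF assms(1)]]) (rule dpsi_eq_0[OF assms(1)])

lemma Ck_pd_psi: "Ck_on n U (pd \<psi> u)"
  using Ck_psi[of "Suc n"] by simp

lemma Ck_gram_det: "Ck_on n U (gram_det D \<psi>)"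
  unfolding gram_det_def[abs_def]
  by (intro Ck_on_sum Ck_on_mult Ck_on_prod Ck_on_inner Ck_on_const open_U Ck_pd_psi)

lemma Ck_sqrt_gram_det: "D \<subseteq> Basis \<Longrightarrow> Ck_on n U (\<lambda>x. sqrt (gram_det D \<psi> x))"
  by (intro Ck_on_sqrt open_U Ck_gram_det gram_det_pos)

text \<open>Directions of \<open>span B\<close> that point into the half-space suffice, because derivatives are linear.\<close>

lemma derivative_zero_on_slice:
  fixes h :: "'a \<Rightarrow> 'b::real_normed_vector"
  assumes x: "x \<in> V" "open V" "x \<in> model_slice B e"
    and h: "(h has_derivative h') (at x)" "\<And>z. z \<in> V \<Longrightarrow> z \<in> model_slice B e \<Longrightarrow> h z = c"
    and u: "u \<in> span B"
  shows "h' u = 0"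
proof -
  have lin: "linear h'" using h(1) has_derivative_linear by blast
  have pos: "h' w = 0" if w: "w \<in> span B" "0 \<le> w \<bullet> e" for w
  proof -
    have sl: "x + t *\<^sub>R w \<in> model_slice B e" if "t \<ge> 0" for t
      using x(3) w that by (auto simp: model_slice_def inner_add_left intro: span_add span_scale)
    have 1: "((\<lambda>t. x + t *\<^sub>R w) has_derivative (\<lambda>t. t *\<^sub>R w)) (at 0 within {0..})"
      by (auto intro!: derivative_eq_intros)
    have "((\<lambda>t. h (x + t *\<^sub>R w)) has_derivative (\<lambda>t. h' (t *\<^sub>R w))) (at 0 within {0..})"
      by (rule has_derivative_compose[OF 1]) (use h(1) in simp)
    then have "((\<lambda>t. h (x + t *\<^sub>R w)) has_vector_derivative h' w) (at 0 within {0..})"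
      by (simp add: has_vector_derivative_def linear_scale[OF lin])
    moreover have "((\<lambda>t. h (x + t *\<^sub>R w)) has_vector_derivative 0) (at 0 within {0..})"
    proof -
      have "continuous (at 0) (\<lambda>t::real. x + t *\<^sub>R w)" by (intro continuous_intros)
      then have "\<forall>\<^sub>F t in at (0::real). x + t *\<^sub>R w \<in> V"
        using x(1,2) topological_tendstoD[of "\<lambda>t. x + t *\<^sub>R w" x "at 0" V] by (simp add: continuous_at)
      then have "\<forall>\<^sub>F t in at (0::real) within {0..}. x + t *\<^sub>R w \<in> V"
        by (rule filter_leD[OF at_le[OF subset_UNIV]])
      moreover have "\<forall>\<^sub>F t in at (0::real) within {0..}. t \<in> {0..}"
        by (simp add: eventually_at_filter)
      ultimately have "\<forall>\<^sub>F t in at (0::real) within {0..}. c = h (x + t *\<^sub>R w)"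
        by eventually_elim (use sl h(2) in auto)
      moreover have "c = h (x + 0 *\<^sub>R w)" using h(2) x by simp
      ultimately show ?thesis
        using has_derivative_transform_eventually[of "\<lambda>t. c" "\<lambda>t. 0" 0 "{0..}" "\<lambda>t. h (x + t *\<^sub>R w)"]
        by (simp add: has_vector_derivative_def)
    qed
    ultimately show ?thesis
      by (rule vector_derivative_unique_within[rotated]) (simp add: at_within_Ici_at_right)
  qed
  show ?thesis
  proof (cases "0 \<le> u \<bullet> e")
    case False
    then have "h' (- u) = 0" using u by (intro pos) (auto intro: span_neg)
    then show ?thesis by (simp add: linear_neg[OF lin])
  qed (use pos u in auto)
qed

text \<open>Pulled back by the chart, a curve in \<open>M\<close> runs in the model slice, and the
  limits of its one-sided difference quotients inherit the linear equations and, at a boundary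
  point, the inequality. Conversely a straight segment in the slice realizes each such
  direction.\<close>

lemma initial_velocity_iff:
  assumes x: "x \<in> U" "x \<in> model_slice B e"
  shows "initial_velocity M (\<psi> x) w \<longleftrightarrow> (\<exists>u\<in>span B. (x \<bullet> e = 0 \<longrightarrow> 0 \<le> u \<bullet> e) \<and> w = d\<psi> x u)"
proof
  assume "initial_velocity M (\<psi> x) w"
  then obtain c where c: "c 0 = \<psi> x" "\<And>t. t \<ge> 0 \<Longrightarrow> c t \<in> M"
    "(c has_vector_derivative w) (at 0 within {0..})" unfolding initial_velocity_def by blast
  define u where "u = pd \<phi> w (\<psi> x)"
  define a where "a t = \<phi> (c t)" for t
  have a: "(a has_vector_derivative u) (at 0 within {0..})"
    unfolding has_vector_derivative_def a_def u_def
  proof -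
    have d: "(\<phi> has_derivative frechet_derivative \<phi> (at (\<psi> x))) (at (c 0))"
      using has_derivative_phi[of "\<psi> x"] x c(1) by simp
    have "linear (frechet_derivative \<phi> (at (\<psi> x)))" using d has_derivative_linear by blast
    then show "((\<lambda>t. \<phi> (c t)) has_derivative (\<lambda>t. t *\<^sub>R pd \<phi> w (\<psi> x))) (at 0 within {0..})"
      using has_derivative_compose[OF c(3)[unfolded has_vector_derivative_def] d] by (simp add: linear_scale)
  qed
  have "continuous (at 0 within {0..}) c"
    using c(3) has_vector_derivative_continuous by blast
  then have "\<forall>\<^sub>F t in at 0 within {0..}. c t \<in> \<psi> ` U"
    using topological_tendstoD[of c "c 0" _ "\<psi> ` U"] open_image c(1) x by (simp add: continuous_within)
  moreover have "\<forall>\<^sub>F t in at (0::real) within {0..}. t \<in> {0..} \<and> t \<noteq> 0"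
    by (simp add: eventually_at_filter)
  ultimately have ev: "\<forall>\<^sub>F t in at 0 within {0..}. t > 0 \<and> a t \<in> model_slice B e"
  proof eventually_elim
    case (elim t)
    then have "c t \<in> M \<inter> \<psi> ` U" using c(2) by auto
    then show ?case using elim M_eq by (auto simp: a_def)
  qed
  have lim: "((\<lambda>t. (a t \<bullet> c - x \<bullet> c) / t) \<longlongrightarrow> u \<bullet> c) (at 0 within {0..})" for c
  proof -
    have "((\<lambda>t. a t \<bullet> c) has_real_derivative u \<bullet> c) (at 0 within {0..})"
      using bounded_linear.has_vector_derivative[OF bounded_linear_inner_left a]
      by (simp add: has_real_derivative_iff_has_vector_derivative)
    then show ?thesis using c(1) x by (simp add: has_field_derivative_iff a_def)
  qed
  have nt: "at (0::real) within {0..} \<noteq> bot" by (simp add: at_within_Ici_at_right)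
  have "u \<in> span B"
    unfolding span_iff_inner_zero[OF B]
  proof
    fix c assume c: "c \<in> Basis - B"
    have "\<forall>\<^sub>F t in at 0 within {0..}. (a t \<bullet> c - x \<bullet> c) / t = 0"
      using ev
    proof eventually_elim
      case (elim t)
      then have "a t \<bullet> c = 0" "x \<bullet> c = 0"
        using c x(2) slice_span span_iff_inner_zero[OF B] by blast+
      then show ?case by simp
    qed
    then have "((\<lambda>t. (a t \<bullet> c - x \<bullet> c) / t) \<longlongrightarrow> 0) (at 0 within {0..})" by (rule tendsto_eventually)
    then show "u \<bullet> c = 0" using lim nt tendsto_unique by blast
  qed
  moreover have "0 \<le> u \<bullet> e" if "x \<bullet> e = 0"
  proof (rule tendsto_lowerbound[OF lim _ nt])
    show "\<forall>\<^sub>F t in at 0 within {0..}. 0 \<le> (a t \<bullet> e - x \<bullet> e) / t"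
      using ev by eventually_elim (use that in \<open>auto simp: model_slice_def\<close>)
  qed
  moreover have "w = d\<psi> x u" using x dpsi_dphi by (simp add: u_def)
  ultimately show "\<exists>u\<in>span B. (x \<bullet> e = 0 \<longrightarrow> 0 \<le> u \<bullet> e) \<and> w = d\<psi> x u" by blast
next
  assume "\<exists>u\<in>span B. (x \<bullet> e = 0 \<longrightarrow> 0 \<le> u \<bullet> e) \<and> w = d\<psi> x u"
  then obtain u where u: "u \<in> span B" "x \<bullet> e = 0 \<longrightarrow> 0 \<le> u \<bullet> e" "w = d\<psi> x u" by blast
  have xe: "0 \<le> x \<bullet> e" using x(2) by (simp add: model_slice_def)
  obtain r where r: "r > 0" "ball x r \<subseteq> U" using open_U x(1) open_contains_ball by blast
  \<comment> \<open>The time for which the segment from \<open>x\<close> in direction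
    \<open>u\<close> stays in the ball of radius r and, from an interior point of the half-space,
    does not cross the face. The summands 1 prevent division by 0.\<close>
  define \<tau> where "\<tau> = (if x \<bullet> e = 0 then r / (norm u + 1) else min (r / (norm u + 1)) (x \<bullet> e / (\<bar>u \<bullet> e\<bar> + 1)))"
  have n1: "norm u + 1 > 0" "\<bar>u \<bullet> e\<bar> + 1 > 0" by (simp_all add: add_nonneg_pos)
  have \<tau>: "\<tau> > 0" using r xe n1 by (auto simp: \<tau>_def)
  have \<tau>r: "\<tau> * norm u < r"
  proof -
    have "\<tau> * norm u \<le> r / (norm u + 1) * norm u" by (intro mult_right_mono) (auto simp: \<tau>_def)
    also have "\<dots> < r" using r(1) n1 by (simp add: field_simps)
    finally show ?thesis .
  qed
  have inU: "x + t *\<^sub>R u \<in> U" if "0 \<le> t" "t \<le> \<tau>" for t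
  proof -
    have "norm (t *\<^sub>R u) \<le> \<tau> * norm u" using that by (simp add: mult_right_mono)
    then show ?thesis using r(2) \<tau>r by (auto simp: dist_norm subset_eq)
  qed
  have insl: "x + t *\<^sub>R u \<in> model_slice B e" if t: "0 \<le> t" "t \<le> \<tau>" for t
  proof -
    have "0 \<le> x \<bullet> e + t * (u \<bullet> e)"
    proof (cases "x \<bullet> e = 0")
      case False
      have "t * \<bar>u \<bullet> e\<bar> \<le> x \<bullet> e / (\<bar>u \<bullet> e\<bar> + 1) * \<bar>u \<bullet> e\<bar>"
        using t False by (intro mult_right_mono) (auto simp: \<tau>_def)
      also have "\<dots> \<le> x \<bullet> e" using xe n1 by (simp add: field_simps)
      finally have "t * \<bar>u \<bullet> e\<bar> \<le> x \<bullet> e" .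
      moreover have "t * - \<bar>u \<bullet> e\<bar> \<le> t * (u \<bullet> e)" using t by (intro mult_left_mono) auto
      ultimately show ?thesis by simp
    qed (use u t in auto)
    then show ?thesis using x(2) u(1) by (auto simp: model_slice_def inner_add_left intro: span_add span_scale)
  qed
  \<comment> \<open>\<open>initial_velocity\<close> demands a curve in \<open>M\<close> for all
    nonnegative times, so the segment stops at time \<tau>.\<close>
  define c where "c t = \<psi> (x + min t \<tau> *\<^sub>R u)" for t
  have "(c has_vector_derivative w) (at 0 within {0..})"
  proof -
    have 1: "((\<lambda>t. x + t *\<^sub>R u) has_derivative (\<lambda>t. t *\<^sub>R u)) (at 0 within {0..})"
      by (auto intro!: derivative_eq_intros)
    have "((\<lambda>t. \<psi> (x + t *\<^sub>R u)) has_derivative (\<lambda>t. d\<psi> x (t *\<^sub>R u))) (at 0 within {0..})"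
      by (rule has_derivative_compose[OF 1]) (use has_derivative_psi x in simp)
    then have 2: "((\<lambda>t. \<psi> (x + t *\<^sub>R u)) has_vector_derivative w) (at 0 within {0..})"
      using linear_scale[OF linear_dpsi[OF x(1)]] u(3) by (simp add: has_vector_derivative_def)
    show ?thesis
      by (rule has_vector_derivative_transform_within[OF 2 \<tau>]) (auto simp: c_def dist_real_def min_def)
  qed
  moreover have "c 0 = \<psi> x" using \<tau> by (simp add: c_def)
  moreover have "c t \<in> M" if "t \<ge> 0" for t
    unfolding c_def using inU[of "min t \<tau>"] insl[of "min t \<tau>"] that \<tau> M_eq by auto
  ultimately show "initial_velocity M (\<psi> x) w" unfolding initial_velocity_def by blast
qed

text \<open>At a boundary point only half of the directions are initial velocities; the negatives of
  the others are, and the span recovers the whole image.\<close>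

lemma tangent_space_eq:
  assumes x: "x \<in> U" "x \<in> model_slice B e"
  shows "tangent_space M (\<psi> x) = d\<psi> x ` span B"
proof -
  note lin = linear_dpsi[OF x(1)]
  have sub: "subspace (d\<psi> x ` span B)" by (rule linear_subspace_image[OF lin subspace_span])
  have "d\<psi> x u \<in> span {w. initial_velocity M (\<psi> x) w}" if u: "u \<in> span B" for u
  proof (cases "0 \<le> u \<bullet> e")
    case True
    then show ?thesis using u x initial_velocity_iff by (intro span_base) auto
  next
    case False
    then have "d\<psi> x (- u) \<in> span {w. initial_velocity M (\<psi> x) w}"
      using u x initial_velocity_iff by (intro span_base) (auto intro!: bexI[of _ "- u"] span_neg)
    then show ?thesis using span_neg[of "d\<psi> x (- u)"] by (simp add: linear_neg[OF lin])
  qed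
  then show ?thesis
    unfolding tangent_space_def
  proof (intro equalityI span_minimal[OF _ sub])
    show "{w. initial_velocity M (\<psi> x) w} \<subseteq> d\<psi> x ` span B"
      using initial_velocity_iff[OF x] by blast
  qed blast
qed

end

section \<open>Boundary points and the boundary as a submanifold\<close>

lemma submanifold_chart:
  assumes "submanifold_with_boundary k M" "p \<in> M"
  obtains B e U \<psi> x where "chart k M B e U \<psi>" "x \<in> U" "x \<in> model_slice B e" "\<psi> x = p"
proof -
  obtain B e U \<psi> where c: "slice_chart k M B e U \<psi>" "p \<in> \<psi> ` U"
    using assms unfolding submanifold_with_boundary_def by blast
  then interpret chart k M B e U \<psi> by unfold_locales
  show ?thesis
    using that[OF chart_axioms] c(2) assms(2) in_M_imp_slice by blast
qed

text \<open>Initial velocities do not refer to charts. The inward vector \<open>e\<close> is one; if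
  the second chart saw no boundary at this point, its negative would be one as well, contradicting
  the half-space condition in the first chart.\<close>

lemma boundary_point_invariant:
  assumes "chart k M B e U \<psi>" "chart k M B' e' U' \<psi>'"
    and x: "x \<in> U" "x \<in> model_slice B e" and y: "y \<in> U'" "y \<in> model_slice B' e'"
    and eq: "\<psi> x = \<psi>' y" and bd: "e \<noteq> 0" "x \<bullet> e = 0"
  shows "e' \<noteq> 0 \<and> y \<bullet> e' = 0"
proof (rule ccontr)
  interpret c1: chart k M B e U \<psi> by fact
  interpret c2: chart k M B' e' U' \<psi>' by fact
  assume neg: "\<not> (e' \<noteq> 0 \<and> y \<bullet> e' = 0)"
  have eB: "e \<in> B" "e \<bullet> e = 1" using c1.e c1.B bd(1) by (auto simp: inner_Basis subset_eq)
  have "initial_velocity M (\<psi> x) (c1.d\<psi> x e)"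
    unfolding c1.initial_velocity_iff[OF x] using eB by (auto intro!: bexI[of _ e] span_base)
  then obtain u where u: "u \<in> span B'" "c1.d\<psi> x e = c2.d\<psi> y u"
    unfolding eq c2.initial_velocity_iff[OF y] by blast
  have "initial_velocity M (\<psi> x) (c2.d\<psi> y (- u))"
    unfolding eq c2.initial_velocity_iff[OF y] using neg u(1) by (auto intro!: bexI[of _ "- u"] span_neg)
  then obtain w where w: "w \<in> span B" "0 \<le> w \<bullet> e" "c2.d\<psi> y (- u) = c1.d\<psi> x w"
    unfolding c1.initial_velocity_iff[OF x] using bd by blast
  have "c1.d\<psi> x w = c1.d\<psi> x (- e)"
    using w(3) u(2) by (simp add: linear_neg[OF c1.linear_dpsi[OF x(1)]] linear_neg[OF c2.linear_dpsi[OF y(1)]])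
  then have "w = - e" using c1.dpsi_inj[OF x(1)] by blast
  then show False using w(2) eB by simp
qed

context chart
begin

lemma in_boundary_iff:
  assumes "x \<in> U" "x \<in> model_slice B e"
  shows "\<psi> x \<in> manifold_boundary k M \<longleftrightarrow> e \<noteq> 0 \<and> x \<bullet> e = 0"
proof
  assume "\<psi> x \<in> manifold_boundary k M"
  then obtain B' e' U' \<psi>' y where c: "\<psi> x \<in> M" "slice_chart k M B' e' U' \<psi>'" "e' \<noteq> 0" "y \<in> U'" "\<psi>' y = \<psi> x" "y \<bullet> e' = 0"
    unfolding manifold_boundary_def by blast
  interpret c': chart k M B' e' U' \<psi>' using c(2) by unfold_locales
  show "e \<noteq> 0 \<and> x \<bullet> e = 0"
    using boundary_point_invariant[OF c'.chart_axioms chart_axioms c(4) _ assms c(5,3,6)] c'.in_M_imp_slice c by simp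
next
  assume "e \<noteq> 0 \<and> x \<bullet> e = 0"
  moreover have "\<psi> x \<in> M" using assms M_eq by blast
  ultimately show "\<psi> x \<in> manifold_boundary k M"
    unfolding manifold_boundary_def using slice_chart assms(1) by blast
qed

lemma boundary_slice: "e \<noteq> 0 \<Longrightarrow> model_slice (B - {e}) 0 = {x \<in> model_slice B e. x \<bullet> e = 0}"
proof -
  assume "e \<noteq> 0"
  then have eB: "e \<in> B" "e \<in> Basis" using e B by auto
  have "x \<in> span (B - {e}) \<longleftrightarrow> x \<in> span B \<and> x \<bullet> e = 0" for x
    using span_iff_inner_zero[OF B, of x] span_iff_inner_zero[of "B - {e}" x] B eB by blast
  then show ?thesis by (auto simp: model_slice_def)
qed

text \<open>The same ambient diffeomorphism serves with the coordinate \<open>e\<close> removed;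
  half-space vector 0 expresses that the boundary has no boundary. As \<open>e\<close> lies in
  \<open>B\<close>, k is positive and \<open>k - 1\<close> is a true difference.\<close>

lemma boundary_chart: "chart (k - 1) (manifold_boundary k M) (B - {e}) 0 U \<psi>" if "e \<noteq> 0"
proof
  have "manifold_boundary k M \<subseteq> M" by (auto simp: manifold_boundary_def)
  then have "manifold_boundary k M \<inter> \<psi> ` U = \<psi> ` (U \<inter> model_slice (B - {e}) 0)"
    unfolding boundary_slice[OF that] using in_boundary_iff in_M_iff that by blast
  moreover have "card (B - {e}) = k - 1" using card_B e that by (simp add: card_Diff_singleton)
  ultimately show "slice_chart (k - 1) (manifold_boundary k M) (B - {e}) 0 U \<psi>"
    using slice_chart unfolding slice_chart_def by auto
qed

lemma boundary_empty: "e = 0 \<Longrightarrow> manifold_boundary k M \<inter> \<psi> ` U = {}"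
proof -
  assume "e = 0"
  moreover have "manifold_boundary k M \<subseteq> M" by (auto simp: manifold_boundary_def)
  ultimately show ?thesis using in_boundary_iff in_M_iff by blast
qed

end

lemma submanifold_boundary: "submanifold_with_boundary k M \<Longrightarrow> submanifold_with_boundary (k - 1) (manifold_boundary k M)"
  unfolding submanifold_with_boundary_def[of "k - 1"]
proof
  fix p assume M: "submanifold_with_boundary k M" and p: "p \<in> manifold_boundary k M"
  then have "p \<in> M" by (simp add: manifold_boundary_def)
  then obtain B e U \<psi> x where c: "chart k M B e U \<psi>" "x \<in> U" "x \<in> model_slice B e" "\<psi> x = p"
    using submanifold_chart[OF M] by metis
  then interpret chart k M B e U \<psi> by simp
  have "e \<noteq> 0" using in_boundary_iff c p by blast
  then show "\<exists>B e U \<psi>. slice_chart (k - 1) (manifold_boundary k M) B e U \<psi> \<and> p \<in> \<psi> ` U"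
    using boundary_chart c unfolding chart_def by blast
qed

text \<open>The boundary is closed in \<open>M\<close>: a chart with e = 0, and the part x \<bullet>
  e > 0 of any other chart, are neighbourhoods without boundary points.\<close>

lemma compact_boundary:
  assumes M: "submanifold_with_boundary k M" and "compact M"
  shows "compact (manifold_boundary k M)"
proof -
  define W where "W = \<Union>{V. open V \<and> V \<inter> manifold_boundary k M = {}}"
  have sub: "manifold_boundary k M \<subseteq> M" by (auto simp: manifold_boundary_def)
  have "p \<in> W" if p: "p \<in> M" "p \<notin> manifold_boundary k M" for p
  proof -
    obtain B e U \<psi> x where c: "chart k M B e U \<psi>" "x \<in> U" "x \<in> model_slice B e" "\<psi> x = p"
      using submanifold_chart[OF M p(1)] by metis
    then interpret chart k M B e U \<psi> by simp
    show "p \<in> W"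
    proof (cases "e = 0")
      case True
      then show ?thesis using boundary_empty open_image c unfolding W_def by blast
    next
      case False
      let ?V = "\<psi> ` U \<inter> \<phi> -` {z. z \<bullet> e > 0}"
      have "open {z. z \<bullet> e > 0}" by (intro open_Collect_less continuous_intros)
      then have "open ?V" by (intro continuous_open_preimage Ck_on_continuous[OF Ck_phi[of 0]] open_image)
      moreover have "?V \<inter> manifold_boundary k M = {}"
        using in_boundary_iff in_M_iff sub by fastforce
      moreover have "p \<in> ?V"
        using in_boundary_iff[OF c(2,3)] p(2) False c by (auto simp: model_slice_def)
      ultimately show ?thesis unfolding W_def by blast
    qed
  qed
  then have "manifold_boundary k M = M - W" using sub by (auto simp: W_def)
  moreover have "open W" by (auto simp: W_def)
  ultimately show ?thesis using assms(2) by (simp add: compact_diff)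
qed

text \<open>The transition map is differentiable in the ambient space. Its derivative carries span B
  into span B' because the map carries slice to slice, and differentiation in slice directions sees
  only the slice; \<open>det_gmat_transform\<close> then compares the two densities.\<close>

lemma gram_det_transition:
  assumes "chart k M B e U \<psi>" "chart k M B' e' U' \<psi>'" and j: "bij_betw j (Basis - B) (Basis - B')"
    and x: "x \<in> U" "x \<in> model_slice B e" and y: "\<psi> x \<in> \<psi>' ` U'"
  defines "T' \<equiv> \<lambda>h. pd (inv_into U' \<psi>') (frechet_derivative \<psi> (at x) h) (\<psi> x)"
  shows "((\<lambda>x. inv_into U' \<psi>' (\<psi> x)) has_derivative T') (at x)"
    and "sqrt (gram_det B \<psi> x) = \<bar>det (mat_of (\<lambda>h. T' (proj B h) + (\<Sum>b\<in>Basis - B. (h \<bullet> b) *\<^sub>R j b)))\<bar>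
      * sqrt (gram_det B' \<psi>' (inv_into U' \<psi>' (\<psi> x)))"
proof -
  interpret c1: chart k M B e U \<psi> by fact
  interpret c2: chart k M B' e' U' \<psi>' by fact
  let ?T = "\<lambda>x. c2.\<phi> (\<psi> x)"
  have T: "(?T has_derivative T') (at x)"
    unfolding T'_def c2.\<phi>_def[symmetric]
    by (rule has_derivative_compose[OF c1.has_derivative_psi[OF x(1)] c2.has_derivative_phi[OF y]])
  then show "((\<lambda>x. inv_into U' \<psi>' (\<psi> x)) has_derivative T') (at x)" by (simp add: c2.\<phi>_def)
  have z: "?T x \<in> U'" using y by simp
  have linT: "linear T'" using T has_derivative_linear by blast
  define V where "V = U \<inter> \<psi> -` (\<psi>' ` U')"
  have "open V" unfolding V_def
    by (intro continuous_open_preimage Ck_on_continuous[OF c1.Ck_psi[of 0]] c1.open_U c2.open_image)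
  have T'span: "T' b \<in> span B'" if b: "b \<in> span B" for b
    unfolding span_iff_inner_zero[OF c2.B]
  proof
    fix c assume c: "c \<in> Basis - B'"
    show "T' b \<bullet> c = 0"
    proof (rule c1.derivative_zero_on_slice[where V=V and h="\<lambda>x. ?T x \<bullet> c" and h'="\<lambda>h. T' h \<bullet> c" and x=x and c=0])
      fix z assume "z \<in> V" "z \<in> model_slice B e"
      then have "\<psi> z \<in> M \<inter> \<psi>' ` U'" using c1.in_M_iff by (auto simp: V_def)
      then have "?T z \<in> span B'" using c2.M_eq c2.slice_span by auto
      then show "?T z \<bullet> c = 0" using c span_iff_inner_zero[OF c2.B] by blast
    qed (use x y b \<open>open V\<close> T in \<open>auto simp: V_def intro: has_derivative_inner_left\<close>)
  qed
  let ?L = "\<lambda>h. T' (proj B h) + (\<Sum>b\<in>Basis - B. (h \<bullet> b) *\<^sub>R j b)"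
  have LB: "?L b = T' b" if "b \<in> B" for b
  proof -
    have "(\<Sum>c\<in>Basis - B. (b \<bullet> c) *\<^sub>R j c) = 0"
      using that c1.B by (intro sum.neutral) (auto simp: inner_Basis)
    then show ?thesis using that c1.B by (simp add: proj_Basis subset_iff)
  qed
  have Lc: "?L b = j b" if b: "b \<in> Basis - B" for b
  proof -
    have "(\<Sum>c\<in>Basis - B. (b \<bullet> c) *\<^sub>R j c) = (\<Sum>c\<in>Basis - B. if c = b then j b else 0)"
      using b by (intro sum.cong) (auto simp: inner_Basis)
    then show ?thesis using b c1.B by (simp add: proj_Basis linear_0[OF linT])
  qed
  have "det (gmat B (c1.d\<psi> x)) = (det (mat_of ?L))\<^sup>2 * det (gmat B' (c2.d\<psi> (?T x)))"
  proof (rule det_gmat_transform[OF c1.B c2.B c1.linear_dpsi[OF x(1)] c2.linear_dpsi[OF z]])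
    fix b assume b: "b \<in> B"
    have "c2.d\<psi> (?T x) (pd c2.\<phi> (c1.d\<psi> x b) (\<psi>' (?T x))) = c1.d\<psi> x b"
      by (rule c2.dpsi_dphi[OF z])
    then have "c2.d\<psi> (?T x) (T' b) = c1.d\<psi> x b" using y by (simp add: T'_def c2.\<phi>_def[symmetric])
    then show "?L b \<in> span B' \<and> c2.d\<psi> (?T x) (?L b) = c1.d\<psi> x b"
      using T'span[of b] b LB[OF b] by (simp add: span_base)
  next
    show "?L b \<in> Basis - B'" if "b \<in> Basis - B" for b
      using Lc[OF that] bij_betwE[OF j] that by simp
    show "inj_on ?L (Basis - B)"
      using Lc j by (auto simp: bij_betw_def inj_on_def)
  qed
  then show "sqrt (gram_det B \<psi> x) = \<bar>det (mat_of ?L)\<bar> * sqrt (gram_det B' \<psi>' (inv_into U' \<psi>' (\<psi> x)))"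
    using c1.gram_det_eq[OF c1.B x(1)] c2.gram_det_eq[OF c2.B z]
    by (simp add: real_sqrt_mult c2.\<phi>_def)
qed

text \<open>Substitution along the transition map: its Jacobian, padded by a bijection of the
  complementary coordinates, is exactly the quotient of the two densities. Equal cardinality of
  \<open>B\<close> and \<open>B'\<close> provides the bijection.\<close>

lemma chart_volume_unique:
  assumes "chart k M B e U \<psi>" "chart k M B' e' U' \<psi>'"
    and A: "A \<in> sets borel" "A \<subseteq> M" "A \<subseteq> \<psi> ` U" "A \<subseteq> \<psi>' ` U'"
  shows "(\<integral>\<^sup>+x. ennreal (sqrt (gram_det B \<psi> x)) * indicator (U \<inter> \<psi> -` A) x \<partial>slice_measure B) =
    (\<integral>\<^sup>+x. ennreal (sqrt (gram_det B' \<psi>' x)) * indicator (U' \<inter> \<psi>' -` A) x \<partial>slice_measure B')"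
proof -
  interpret c1: chart k M B e U \<psi> by fact
  interpret c2: chart k M B' e' U' \<psi>' by fact
  let ?S = "U \<inter> \<psi> -` A" and ?S' = "U' \<inter> \<psi>' -` A"
  have S: "?S \<in> sets borel" and S': "?S' \<in> sets borel"
    using A(1) c1.open_U c2.open_U Ck_on_continuous[OF c1.Ck_psi] Ck_on_continuous[OF c2.Ck_psi]
    by (auto intro!: borel_Int_vimage)
  have Ssl: "x \<in> model_slice B e" if "x \<in> ?S" for x using that A(2) c1.in_M_imp_slice by auto
  have Ssl': "x \<in> model_slice B' e'" if "x \<in> ?S'" for x using that A(2) c2.in_M_imp_slice by auto
  have "card (Basis - B) = card (Basis - B')"
    using c1.B c2.B c1.card_B c2.card_B by (simp add: card_Diff_subset finite_subset_Basis)
  then obtain j where j: "bij_betw j (Basis - B) (Basis - B')"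
    using finite_same_card_bij[of "Basis - B" "Basis - B'"] by auto
  let ?T = "\<lambda>x. inv_into U' \<psi>' (\<psi> x)"
  have TS: "?T ` ?S = ?S'"
  proof (intro equalityI subsetI)
    fix y assume "y \<in> ?T ` ?S"
    then obtain x where x: "x \<in> ?S" "y = c2.\<phi> (\<psi> x)" by (auto simp: c2.\<phi>_def)
    then show "y \<in> ?S'" using A(4) by auto
  next
    fix y assume y: "y \<in> ?S'"
    then have "y = ?T (c1.\<phi> (\<psi>' y))" "c1.\<phi> (\<psi>' y) \<in> ?S"
      using A(3) c2.phi_psi[of y] unfolding c2.\<phi>_def by auto
    then show "y \<in> ?T ` ?S" by blast
  qed
  \<comment> \<open>Cut off outside U', where \<psi>' is unconstrained, so that the function is
    Borel and nonnegative everywhere.\<close>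
  define f where "f y = indicator U' y * sqrt (gram_det B' \<psi>' y)" for y
  have gm: "(\<lambda>y. indicator V y * sqrt (gram_det D \<psi>1 y)) \<in> borel_measurable borel"
    if "V \<in> sets borel" "V \<subseteq> W" "Ck_on 0 W (\<lambda>x. sqrt (gram_det D \<psi>1 x))" for V W D and \<psi>1 :: "'a \<Rightarrow> 'a"
    using borel_measurable_continuous_on_indicator[OF that(1), of "\<lambda>y. sqrt (gram_det D \<psi>1 y)"] that(2,3)
    by (auto intro: continuous_on_subset)
  have "(\<integral>\<^sup>+y. ennreal (f y) * indicator (?T ` ?S) y \<partial>slice_measure B') =
    (\<integral>\<^sup>+x. ennreal (sqrt (gram_det B \<psi> x)) * indicator ?S x \<partial>slice_measure B)"
  proof (rule nn_integral_slice_substitution[OF c1.B c2.B j, where T="?T" and f=f and S="?S"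
        and w="\<lambda>x. sqrt (gram_det B \<psi> x)"
        and T'="\<lambda>x h. pd (inv_into U' \<psi>') (frechet_derivative \<psi> (at x) h) (\<psi> x)"])
    show "?S \<in> sets borel" "?T ` ?S \<in> sets borel" using S S' TS by auto
    show "?S \<subseteq> span B" using Ssl c1.slice_span by blast
    show "?T ` ?S \<subseteq> span B'" unfolding TS using Ssl' c2.slice_span by blast
    show "inj_on ?T ?S"
    proof (rule inj_onI)
      fix x x' assume "x \<in> ?S" "x' \<in> ?S" "?T x = ?T x'"
      then have "\<psi> x = \<psi> x'" using A(4) c2.psi_phi unfolding c2.\<phi>_def by (metis IntD2 subsetD vimage_eq)
      then show "x = x'" using \<open>x \<in> ?S\<close> \<open>x' \<in> ?S\<close> c1.inj by (auto dest: inj_onD)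
    qed
    fix x
    show "(?T has_derivative (\<lambda>h. pd (inv_into U' \<psi>') (frechet_derivative \<psi> (at x) h) (\<psi> x))) (at x within ?S)" if "x \<in> ?S"
    proof -
      have "x \<in> U" "\<psi> x \<in> \<psi>' ` U'" using that A(4) by auto
      from gram_det_transition(1)[OF assms(1,2) j this(1) Ssl[OF that] this(2)]
      show ?thesis by (rule has_derivative_at_withinI)
    qed
    show "\<bar>det (mat_of (\<lambda>h. pd (inv_into U' \<psi>') (frechet_derivative \<psi> (at x) (proj B h)) (\<psi> x) +
        (\<Sum>b\<in>Basis - B. (h \<bullet> b) *\<^sub>R j b)))\<bar> * f (?T x) = sqrt (gram_det B \<psi> x)" if "x \<in> ?S"
    proof -
      have T: "?T x \<in> U'" using TS that by blast
      have "x \<in> U" "\<psi> x \<in> \<psi>' ` U'" using that A(4) by auto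
      note gt = gram_det_transition(2)[OF assms(1,2) j this(1) Ssl[OF that] this(2)]
      show ?thesis unfolding gt using T by (simp only: f_def indicator_simps mult_1)
    qed
  next
    show "f \<in> borel_measurable borel"
      unfolding f_def[abs_def] by (rule gm[OF _ _ c2.Ck_sqrt_gram_det[OF c2.B]]) (auto simp: c2.open_U)
    show "f y \<ge> 0" for y using c2.gram_det_pos[OF _ c2.B, of y] by (auto simp: f_def indicator_def)
    show "(\<lambda>x. indicator ?S x * sqrt (gram_det B \<psi> x)) \<in> borel_measurable borel"
      by (rule gm[OF S _ c1.Ck_sqrt_gram_det[OF c1.B]]) auto
  qed
  moreover have "(\<integral>\<^sup>+y. ennreal (f y) * indicator (?T ` ?S) y \<partial>slice_measure B') =
      (\<integral>\<^sup>+x. ennreal (sqrt (gram_det B' \<psi>' x)) * indicator ?S' x \<partial>slice_measure B')"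
    unfolding TS by (intro nn_integral_cong) (auto simp: f_def indicator_def)
  ultimately show ?thesis by simp
qed

subsection \<open>The volume measure\<close>

text \<open>The predicate under the definite description in \<open>volume_measure\<close>, named so
  that existence and uniqueness can be stated and used for other measures.\<close>

definition volume_spec :: "nat \<Rightarrow> 'a::euclidean_space set \<Rightarrow> 'a measure \<Rightarrow> bool" where
  "volume_spec k M \<mu> \<longleftrightarrow> sets \<mu> = sets borel \<and> emeasure \<mu> (- M) = 0 \<and>
    (\<forall>B e U \<psi>. slice_chart k M B e U \<psi> \<longrightarrow>
      (\<forall>A \<in> sets borel. A \<subseteq> M \<inter> \<psi> ` U \<longrightarrow>
         emeasure \<mu> A =
           (\<integral>\<^sup>+x. ennreal (sqrt (gram_det B \<psi> x)) * indicator (U \<inter> \<psi> -` A) x \<partial>slice_measure B)))"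

lemma volume_measure_eq_The: "volume_measure k M = (THE \<mu>. volume_spec k M \<mu>)"
  by (simp add: volume_measure_def volume_spec_def)

lemma volume_specD:
  assumes "volume_spec k M \<mu>"
  shows "sets \<mu> = sets borel" "emeasure \<mu> (- M) = 0"
    and "chart k M B e U \<psi> \<Longrightarrow> A \<in> sets borel \<Longrightarrow> A \<subseteq> M \<inter> \<psi> ` U \<Longrightarrow>
      emeasure \<mu> A = (\<integral>\<^sup>+x. ennreal (sqrt (gram_det B \<psi> x)) * indicator (U \<inter> \<psi> -` A) x \<partial>slice_measure B)"
  using assms unfolding volume_spec_def chart_def by blast+

lemma volume_spec_AE:
  assumes "volume_spec k M \<mu>" "M \<in> sets borel"
  shows "AE x in \<mu>. x \<in> M"
  using assms volume_specD(1,2)[OF assms(1)] by (intro AE_I[of _ _ "- M"]) auto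

section \<open>The volume in a single chart\<close>

context chart
begin

definition chart_density :: "'a \<Rightarrow> real" where
  "chart_density x = indicator (U \<inter> model_slice B e) x * sqrt (gram_det B \<psi> x)"

text \<open>Off \<open>U\<close> nothing is known about \<psi>, not even measurability; the
  extension by 0 is a Borel map along which a measure can be pushed forward.\<close>

definition psi_ext :: "'a \<Rightarrow> 'a" where
  "psi_ext x = indicator U x *\<^sub>R \<psi> x"

definition chart_measure :: "'a measure" where
  "chart_measure = distr (density (slice_measure B) (\<lambda>x. ennreal (chart_density x))) borel psi_ext"

lemma U_borel [measurable]: "U \<in> sets borel" and image_borel [measurable]: "\<psi> ` U \<in> sets borel"
  and slice_borel [measurable]: "model_slice B e \<in> sets borel"
  using open_U open_image closed_model_slice[of B e] by (simp_all add: borel_closed del: closed_model_slice)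

lemma chart_density_nonneg: "chart_density x \<ge> 0"
  using gram_det_pos[OF _ B, of x] by (auto simp: chart_density_def indicator_def)

lemma borel_measurable_chart_density [measurable]: "chart_density \<in> borel_measurable borel"
proof -
  have "continuous_on (U \<inter> model_slice B e) (\<lambda>x. sqrt (gram_det B \<psi> x))"
    using Ck_on_continuous[OF Ck_sqrt_gram_det[OF B, of 0]] by (rule continuous_on_subset) auto
  from borel_measurable_continuous_on_indicator[OF _ this]
  show ?thesis by (simp add: chart_density_def[abs_def] sets.Int U_borel slice_borel)
qed

lemma borel_measurable_psi_ext [measurable]: "psi_ext \<in> borel_measurable borel"
  unfolding psi_ext_def[abs_def]
  by (rule borel_measurable_continuous_on_indicator[OF U_borel Ck_on_continuous[OF Ck_psi]])

lemma sets_chart_measure [simp, measurable_cong]: "sets chart_measure = sets borel"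
  by (simp add: chart_measure_def)

lemma nn_integral_chart_measure:
  assumes [measurable]: "h \<in> borel_measurable borel"
  shows "(\<integral>\<^sup>+y. h y \<partial>chart_measure) = (\<integral>\<^sup>+x. ennreal (chart_density x) * h (psi_ext x) \<partial>slice_measure B)"
  unfolding chart_measure_def
  by (subst nn_integral_distr, measurable, subst nn_integral_density) (simp_all add: measurable_compose[OF borel_measurable_psi_ext])

lemma emeasure_chart_measure:
  assumes A: "A \<in> sets borel"
  shows "emeasure chart_measure A =
    (\<integral>\<^sup>+x. ennreal (sqrt (gram_det B \<psi> x)) * indicator (U \<inter> \<psi> -` (A \<inter> M)) x \<partial>slice_measure B)"
proof -
  have "emeasure chart_measure A = (\<integral>\<^sup>+y. indicator A y \<partial>chart_measure)"
    using A by simp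
  also have "\<dots> = (\<integral>\<^sup>+x. ennreal (chart_density x) * indicator A (psi_ext x) \<partial>slice_measure B)"
    using A by (intro nn_integral_chart_measure) simp
  also have "\<dots> = (\<integral>\<^sup>+x. ennreal (sqrt (gram_det B \<psi> x)) * indicator (U \<inter> \<psi> -` (A \<inter> M)) x \<partial>slice_measure B)"
    using in_M_iff by (intro nn_integral_cong) (auto simp: chart_density_def psi_ext_def indicator_def)
  finally show ?thesis .
qed

text \<open>Both sides evaluate to the chart formula on every Borel set. Integrals over the part of
  \<open>M\<close> inside the chart thereby become integrals over span B.\<close>

lemma density_volume_spec:
  assumes \<mu>: "volume_spec k M \<mu>" and M [measurable]: "M \<in> sets borel"
  shows "density \<mu> (indicator (M \<inter> \<psi> ` U)) = chart_measure"
proof (rule measure_eqI)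
  note [measurable_cong] = volume_specD(1)[OF \<mu>]
  show "sets (density \<mu> (indicator (M \<inter> \<psi> ` U))) = sets chart_measure"
    using volume_specD(1)[OF \<mu>] by simp
  fix A assume "A \<in> sets (density \<mu> (indicator (M \<inter> \<psi> ` U)))"
  then have A [measurable]: "A \<in> sets borel" using volume_specD(1)[OF \<mu>] by simp
  have "emeasure (density \<mu> (indicator (M \<inter> \<psi> ` U))) A = (\<integral>\<^sup>+x. indicator (M \<inter> \<psi> ` U) x * indicator A x \<partial>\<mu>)"
    by (rule emeasure_density) measurable
  also have "\<dots> = (\<integral>\<^sup>+x. indicator (A \<inter> (M \<inter> \<psi> ` U)) x \<partial>\<mu>)"
    by (intro nn_integral_cong) (auto simp: indicator_def)
  also have "\<dots> = emeasure \<mu> (A \<inter> (M \<inter> \<psi> ` U))" by (rule nn_integral_indicator) measurable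
  also have "\<dots> = (\<integral>\<^sup>+x. ennreal (sqrt (gram_det B \<psi> x)) * indicator (U \<inter> \<psi> -` (A \<inter> (M \<inter> \<psi> ` U))) x \<partial>slice_measure B)"
    by (rule volume_specD(3)[OF \<mu> chart_axioms]) auto
  also have "U \<inter> \<psi> -` (A \<inter> (M \<inter> \<psi> ` U)) = U \<inter> \<psi> -` (A \<inter> M)" by auto
  finally show "emeasure (density \<mu> (indicator (M \<inter> \<psi> ` U))) A = emeasure chart_measure A"
    by (simp add: emeasure_chart_measure)
qed

lemma nn_integral_volume:
  assumes \<mu>: "volume_spec k M \<mu>" and M [measurable]: "M \<in> sets borel"
    and h [measurable]: "h \<in> borel_measurable borel" and A [measurable]: "A \<in> sets borel" and sub: "A \<subseteq> M \<inter> \<psi> ` U"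
  shows "(\<integral>\<^sup>+y. h y * indicator A y \<partial>\<mu>) =
    (\<integral>\<^sup>+x. h (\<psi> x) * ennreal (sqrt (gram_det B \<psi> x)) * indicator (U \<inter> \<psi> -` A) x \<partial>slice_measure B)"
proof -
  note [measurable_cong] = volume_specD(1)[OF \<mu>]
  have "(\<integral>\<^sup>+y. h y * indicator A y \<partial>\<mu>) = (\<integral>\<^sup>+y. indicator (M \<inter> \<psi> ` U) y * (h y * indicator A y) \<partial>\<mu>)"
    using sub by (intro nn_integral_cong) (auto simp: indicator_def)
  also have "\<dots> = (\<integral>\<^sup>+y. h y * indicator A y \<partial>density \<mu> (indicator (M \<inter> \<psi> ` U)))"
    by (rule nn_integral_density[symmetric]) measurable
  also have "\<dots> = (\<integral>\<^sup>+x. ennreal (chart_density x) * (h (psi_ext x) * indicator A (psi_ext x)) \<partial>slice_measure B)"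
    unfolding density_volume_spec[OF \<mu> M] by (rule nn_integral_chart_measure) measurable
  also have "\<dots> = (\<integral>\<^sup>+x. h (\<psi> x) * ennreal (sqrt (gram_det B \<psi> x)) * indicator (U \<inter> \<psi> -` A) x \<partial>slice_measure B)"
  proof (intro nn_integral_cong)
    fix x
    show "ennreal (chart_density x) * (h (psi_ext x) * indicator A (psi_ext x)) =
       h (\<psi> x) * ennreal (sqrt (gram_det B \<psi> x)) * indicator (U \<inter> \<psi> -` A) x"
      using in_M_imp_slice[of x] sub
      by (cases "x \<in> U"; cases "\<psi> x \<in> A") (auto simp: chart_density_def psi_ext_def indicator_def mult.commute)
  qed
  finally show ?thesis .
qed

text \<open>The coordinate integrand \<open>q\<close> is a parameter of its own: in the divergence
  theorem it is a sum of partial derivatives, defined on the whole space, which has the geometric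
  meaning only on the slice.\<close>

lemma integral_volume:
  assumes \<mu>: "volume_spec k M \<mu>" and M [measurable]: "M \<in> sets borel"
    and h [measurable]: "(h :: 'a \<Rightarrow> real) \<in> borel_measurable borel"
    and supp: "\<And>y. y \<in> M \<Longrightarrow> y \<notin> \<psi> ` U \<Longrightarrow> h y = 0"
    and q: "\<And>x. x \<in> U \<Longrightarrow> x \<in> model_slice B e \<Longrightarrow> q x = h (\<psi> x) * sqrt (gram_det B \<psi> x)"
      "\<And>x. x \<notin> U \<Longrightarrow> q x = 0"
    and int: "integrable (slice_measure B) (\<lambda>x. indicator (model_slice B e) x * q x)"
  shows "integrable \<mu> h" and "(LINT y|\<mu>. h y) = (LINT x|slice_measure B. indicator (model_slice B e) x * q x)"
proof -
  note [measurable_cong] = volume_specD(1)[OF \<mu>]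
  have eq: "chart_density x * h (psi_ext x) = indicator (model_slice B e) x * q x" for x
    using q[of x] by (cases "x \<in> U"; cases "x \<in> model_slice B e") (auto simp: chart_density_def psi_ext_def)
  have dens: "density \<mu> (indicator (M \<inter> \<psi> ` U)) = density \<mu> (\<lambda>y. ennreal (indicator (M \<inter> \<psi> ` U) y))"
    by (intro arg_cong[of _ _ "density \<mu>"]) (auto simp: indicator_def)
  have i1: "integrable chart_measure h"
    unfolding chart_measure_def using chart_density_nonneg int
    by (subst integrable_distr_eq, measurable, subst integrable_real_density) (auto simp: eq)
  have e1: "(LINT y|chart_measure. h y) = (LINT x|slice_measure B. indicator (model_slice B e) x * q x)"
    unfolding chart_measure_def using chart_density_nonneg
    by (subst integral_distr, measurable, subst integral_real_density) (auto simp: eq)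
  have i2: "integrable \<mu> (\<lambda>y. indicator (M \<inter> \<psi> ` U) y * h y)"
    using i1 unfolding density_volume_spec[OF \<mu> M, symmetric] dens
    by (subst (asm) integrable_real_density) auto
  have e2: "(LINT y|\<mu>. indicator (M \<inter> \<psi> ` U) y * h y) = (LINT y|chart_measure. h y)"
    unfolding density_volume_spec[OF \<mu> M, symmetric] dens
    by (subst integral_real_density) auto
  have ae: "AE y in \<mu>. indicator (M \<inter> \<psi> ` U) y * h y = h y"
    using volume_spec_AE[OF \<mu> M] by eventually_elim (use supp in \<open>auto simp: indicator_def\<close>)
  show "integrable \<mu> h"
    using integrable_cong_AE[OF _ _ ae] i2 by (auto simp: borel_measurable_integrable)
  have "(LINT y|\<mu>. h y) = (LINT y|\<mu>. indicator (M \<inter> \<psi> ` U) y * h y)"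
    using ae by (intro integral_cong_AE) auto
  then show "(LINT y|\<mu>. h y) = (LINT x|slice_measure B. indicator (model_slice B e) x * q x)"
    using e1 e2 by simp
qed

end

text \<open>Compactness gives finitely many chart images; making them disjoint allows measures to be
  added piece by piece.\<close>

lemma finite_atlas:
  assumes M: "submanifold_with_boundary k M" and "compact M"
  obtains n :: nat and B e U \<psi> D where "\<forall>i<n. chart k M (B i) (e i) (U i) (\<psi> i)"
    "\<forall>i. D i \<in> sets borel" "disjoint_family D" "\<forall>i<n. D i \<subseteq> \<psi> i ` U i" "M \<subseteq> (\<Union>i<n. D i)"
proof -
  have "\<forall>p\<in>M. \<exists>c. case c of (B, e, U, \<psi>) \<Rightarrow> chart k M B e U \<psi> \<and> p \<in> \<psi> ` U"
    using M unfolding submanifold_with_boundary_def chart_def by fastforce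
  from bchoice[OF this]
  obtain c where "\<forall>p\<in>M. case c p of (B, e, U, \<psi>) \<Rightarrow> chart k M B e U \<psi> \<and> p \<in> \<psi> ` U"
    by (rule exE)
  note c = bspec[OF this]
  define B e U \<psi> where "B p = fst (c p)" and "e p = fst (snd (c p))" and "U p = fst (snd (snd (c p)))"
    and "\<psi> p = snd (snd (snd (c p)))" for p
  have ch: "chart k M (B p) (e p) (U p) (\<psi> p)" "p \<in> \<psi> p ` U p" if "p \<in> M" for p
    using c[OF that] by (auto simp: B_def e_def U_def \<psi>_def split: prod.splits)
  have "\<And>p. p \<in> M \<Longrightarrow> open (\<psi> p ` U p)" using ch(1) chart.open_image by blast
  moreover have "M \<subseteq> (\<Union>p\<in>M. \<psi> p ` U p)" using ch(2) by blast
  ultimately obtain P where P: "P \<subseteq> M" "finite P" "M \<subseteq> (\<Union>p\<in>P. \<psi> p ` U p)"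
    by (rule compactE_image[OF assms(2)])
  obtain n :: nat and p where p: "P = p ` {i. i < n}"
    using finite_imp_nat_seg_image_inj_on[OF P(2)] by blast
  \<comment> \<open>The empty tail makes this a sequence, the form that \<open>disjointed\<close>
    expects.\<close>
  define W where "W i = (if i < n then \<psi> (p i) ` U (p i) else {})" for i
  have Wb: "W i \<in> sets borel" for i
    using ch(1)[THEN chart.open_image] P(1) p by (auto simp: W_def)
  show ?thesis
  proof (rule that[of n "\<lambda>i. B (p i)" "\<lambda>i. e (p i)" "\<lambda>i. U (p i)" "\<lambda>i. \<psi> (p i)" "disjointed W"])
    show "\<forall>i<n. chart k M (B (p i)) (e (p i)) (U (p i)) (\<psi> (p i))"
      using ch(1) P(1) p by blast
    show "\<forall>i. disjointed W i \<in> sets borel"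
      using sets.range_disjointed_sets[of W borel] Wb by auto
    show "\<forall>i<n. disjointed W i \<subseteq> \<psi> (p i) ` U (p i)"
    proof (intro allI impI)
      fix i assume "i < n"
      then show "disjointed W i \<subseteq> \<psi> (p i) ` U (p i)" using disjointed_subset[of W i] by (simp add: W_def)
    qed
    show "M \<subseteq> (\<Union>i<n. disjointed W i)"
    proof
      fix x assume "x \<in> M"
      then obtain i where "i < n" "x \<in> \<psi> (p i) ` U (p i)" using P(3) p by auto
      then have "x \<in> W i" by (simp add: W_def)
      then have "x \<in> (\<Union>i. disjointed W i)" using UN_disjointed_eq[of W] by blast
      then obtain j where j: "x \<in> disjointed W j" by blast
      then have "x \<in> W j" using disjointed_subset[of W j] by blast
      then have "j < n" by (auto simp: W_def split: if_splits)
      then show "x \<in> (\<Union>i<n. disjointed W i)" using j by blast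
    qed
  qed (rule disjoint_family_disjointed)
qed

text \<open>A Borel set splits into a null set off \<open>M\<close> and finitely many disjoint
  pieces inside charts, on each of which the chart formula prescribes the value.\<close>

lemma volume_spec_unique:
  assumes M: "submanifold_with_boundary k M" "compact M"
    and \<mu>: "volume_spec k M \<mu>" "volume_spec k M \<nu>"
  shows "\<mu> = \<nu>"
proof (rule measure_eqI)
  show "sets \<mu> = sets \<nu>" using \<mu> volume_specD(1) by metis
  fix A assume "A \<in> sets \<mu>"
  then have A: "A \<in> sets borel" using \<mu> volume_specD(1) by metis
  have Mb: "M \<in> sets borel" using M(2) by (simp add: borel_compact)
  obtain n :: nat and B e U \<psi> D where atlas: "\<forall>i<n. chart k M (B i) (e i) (U i) (\<psi> i)"
    "\<forall>i. D i \<in> sets borel" "disjoint_family D" "\<forall>i<n. D i \<subseteq> \<psi> i ` U i" "M \<subseteq> (\<Union>i<n. D i)"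
    by (rule finite_atlas[OF M])
  note at = atlas(1)[rule_format] and Db = atlas(2)[rule_format] and DW = atlas(4)[rule_format] and cov = atlas(5)
  have disj: "disjoint_family_on (\<lambda>i. A \<inter> M \<inter> D i) {..<n}"
    using atlas(3) unfolding disjoint_family_on_def by blast
  have un: "(\<Union>i\<in>{..<n}. A \<inter> M \<inter> D i) = A \<inter> M" using cov by blast
  have val: "emeasure \<rho> A = (\<Sum>i<n. \<integral>\<^sup>+x. ennreal (sqrt (gram_det (B i) (\<psi> i) x)) * indicator (U i \<inter> \<psi> i -` (A \<inter> M \<inter> D i)) x \<partial>slice_measure (B i))"
    if \<rho>: "volume_spec k M \<rho>" for \<rho>
  proof -
    have "emeasure \<rho> A = emeasure \<rho> (A \<inter> M)"
      using volume_spec_AE[OF \<rho> Mb] A Mb volume_specD(1)[OF \<rho>] by (intro emeasure_eq_AE) auto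
    also have "\<dots> = (\<Sum>i<n. emeasure \<rho> (A \<inter> M \<inter> D i))"
      using sum_emeasure[of "\<lambda>i. A \<inter> M \<inter> D i" "{..<n}" \<rho>] A Mb Db disj volume_specD(1)[OF \<rho>]
      unfolding un by (auto simp: image_subset_iff)
    also have "\<dots> = (\<Sum>i<n. \<integral>\<^sup>+x. ennreal (sqrt (gram_det (B i) (\<psi> i) x)) * indicator (U i \<inter> \<psi> i -` (A \<inter> M \<inter> D i)) x \<partial>slice_measure (B i))"
    proof (intro sum.cong refl)
      fix i assume "i \<in> {..<n}"
      then have i: "i < n" by simp
      have Di: "A \<inter> M \<inter> D i \<in> sets borel" using A Mb Db by auto
      have "A \<inter> M \<inter> D i \<subseteq> M \<inter> \<psi> i ` U i" using DW[OF i] by auto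
      then show "emeasure \<rho> (A \<inter> M \<inter> D i) = (\<integral>\<^sup>+x. ennreal (sqrt (gram_det (B i) (\<psi> i) x)) * indicator (U i \<inter> \<psi> i -` (A \<inter> M \<inter> D i)) x \<partial>slice_measure (B i))"
        by (rule volume_specD(3)[OF \<rho> at[OF i] Di])
    qed
    finally show ?thesis .
  qed
  show "emeasure \<mu> A = emeasure \<nu> A" using val[OF \<mu>(1)] val[OF \<mu>(2)] by simp
qed

text \<open>The chart measures, restricted to the disjoint pieces of a finite atlas, are summed. The
  formula in an arbitrary further chart holds on each piece by \<open>chart_volume_unique\<close>
  and then by additivity.\<close>

lemma volume_spec_exists:
  assumes M: "submanifold_with_boundary k M" "compact M"
  shows "\<exists>\<mu>. volume_spec k M \<mu>"
proof -
  have Mb: "M \<in> sets borel" using M(2) by (simp add: borel_compact)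
  obtain n :: nat and B e U \<psi> D where atlas: "\<forall>i<n. chart k M (B i) (e i) (U i) (\<psi> i)"
    "\<forall>i. D i \<in> sets borel" "disjoint_family D" "\<forall>i<n. D i \<subseteq> \<psi> i ` U i" "M \<subseteq> (\<Union>i<n. D i)"
    by (rule finite_atlas[OF M])
  note at = atlas(1)[rule_format] and Db = atlas(2)[rule_format] and DW = atlas(4)[rule_format] and cov = atlas(5)
  define \<nu> where "\<nu> i = chart.chart_measure (B i) (e i) (U i) (\<psi> i)" for i
  have sets\<nu>: "sets (\<nu> i) = sets borel" if "i < n" for i
    unfolding \<nu>_def by (rule chart.sets_chart_measure[OF at[OF that]])
  define m where "m A = (\<Sum>i<n. emeasure (\<nu> i) (A \<inter> D i))" for A
  define \<mu> where "\<mu> = measure_of UNIV (sets borel) m"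
  have sets\<mu>: "sets \<mu> = sets borel"
    unfolding \<mu>_def using sets.sets_measure_of_eq[of borel] by (simp add: space_borel)
  have em\<mu>: "emeasure \<mu> A = m A" if A: "A \<in> sets borel" for A
    unfolding \<mu>_def
  proof (rule emeasure_measure_of_sigma[OF _ _ _ A])
    show "sigma_algebra UNIV (sets borel)" using sets.sigma_algebra_axioms[of borel] by (simp add: space_borel)
    show "positive (sets borel) m" by (simp add: positive_def m_def)
    show "countably_additive (sets borel) m"
    proof (rule countably_additiveI)
      fix X :: "nat \<Rightarrow> 'a set" assume X: "range X \<subseteq> sets borel" "disjoint_family X"
      have "(\<Sum>j. m (X j)) = (\<Sum>i<n. \<Sum>j. emeasure (\<nu> i) (X j \<inter> D i))"
        unfolding m_def by (rule suminf_sum) simp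
      also have "\<dots> = (\<Sum>i<n. emeasure (\<nu> i) (\<Union> (range X) \<inter> D i))"
      proof (intro sum.cong refl)
        fix i assume "i \<in> {..<n}"
        then have "range (\<lambda>j. X j \<inter> D i) \<subseteq> sets (\<nu> i)" using X(1) Db sets\<nu> by auto
        moreover have "disjoint_family (\<lambda>j. X j \<inter> D i)" using X(2) unfolding disjoint_family_on_def by blast
        ultimately have "(\<Sum>j. emeasure (\<nu> i) (X j \<inter> D i)) = emeasure (\<nu> i) (\<Union>j. X j \<inter> D i)"
          by (rule suminf_emeasure)
        then show "(\<Sum>j. emeasure (\<nu> i) (X j \<inter> D i)) = emeasure (\<nu> i) (\<Union> (range X) \<inter> D i)" by simp
      qed
      finally show "(\<Sum>j. m (X j)) = m (\<Union> (range X))" by (simp add: m_def)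
    qed
  qed
  have "volume_spec k M \<mu>"
    unfolding volume_spec_def
  proof (intro conjI allI impI ballI)
    show "sets \<mu> = sets borel" by (rule sets\<mu>)
    have "emeasure (\<nu> i) (- M \<inter> D i) = 0" if i: "i < n" for i
    proof -
      have "emeasure (\<nu> i) (- M \<inter> D i) = (\<integral>\<^sup>+x. ennreal (sqrt (gram_det (B i) (\<psi> i) x)) *
          indicator (U i \<inter> \<psi> i -` (- M \<inter> D i \<inter> M)) x \<partial>slice_measure (B i))"
        unfolding \<nu>_def using Mb Db by (intro chart.emeasure_chart_measure[OF at[OF i]]) auto
      also have "- M \<inter> D i \<inter> M = {}" by auto
      finally show ?thesis by simp
    qed
    then show "emeasure \<mu> (- M) = 0" using em\<mu>[of "- M"] Mb by (simp add: m_def)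
    fix B' e' U' \<psi>' A
    assume c: "slice_chart k M B' e' U' \<psi>'" and A: "A \<in> sets borel" "A \<subseteq> M \<inter> \<psi>' ` U'"
    interpret c': chart k M B' e' U' \<psi>' using c by unfold_locales
    have step: "emeasure (\<nu> i) (A \<inter> D i) = emeasure c'.chart_measure (A \<inter> D i)" if i: "i < n" for i
    proof -
      interpret ci: chart k M "B i" "e i" "U i" "\<psi> i" by (rule at[OF i])
      have 1: "A \<inter> D i \<inter> M = A \<inter> D i" using A by auto
      have "emeasure ci.chart_measure (A \<inter> D i) = emeasure c'.chart_measure (A \<inter> D i)"
        using A Db DW[OF i] unfolding ci.emeasure_chart_measure[OF sets.Int[OF A(1) Db]] c'.emeasure_chart_measure[OF sets.Int[OF A(1) Db]] 1
        by (intro chart_volume_unique[OF ci.chart_axioms c'.chart_axioms]) auto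
      then show ?thesis by (simp add: \<nu>_def)
    qed
    have "emeasure \<mu> A = (\<Sum>i<n. emeasure c'.chart_measure (A \<inter> D i))"
      using em\<mu>[OF A(1)] step by (simp add: m_def)
    also have "\<dots> = emeasure c'.chart_measure (\<Union>i<n. A \<inter> D i)"
      using A Db atlas(3) by (intro sum_emeasure) (auto simp: disjoint_family_on_def)
    also have "(\<Union>i<n. A \<inter> D i) = A" using A cov by auto
    also have "emeasure c'.chart_measure A = (\<integral>\<^sup>+x. ennreal (sqrt (gram_det B' \<psi>' x)) * indicator (U' \<inter> \<psi>' -` (A \<inter> M)) x \<partial>slice_measure B')"
      by (rule c'.emeasure_chart_measure[OF A(1)])
    also have "A \<inter> M = A" using A by auto
    finally show "emeasure \<mu> A = (\<integral>\<^sup>+x. ennreal (sqrt (gram_det B' \<psi>' x)) * indicator (U' \<inter> \<psi>' -` A) x \<partial>slice_measure B')" .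
  qed
  then show ?thesis by blast
qed

lemma volume_spec_volume_measure:
  assumes "submanifold_with_boundary k M" "compact M"
  shows "volume_spec k M (volume_measure k M)"
  unfolding volume_measure_eq_The
  using volume_spec_exists[OF assms] volume_spec_unique[OF assms] by (metis (no_types, lifting) theI)

lemma volume_measure_eqI:
  assumes "submanifold_with_boundary k M" "compact M" "volume_spec k M \<mu>"
  shows "volume_measure k M = \<mu>"
  using volume_spec_unique[OF assms(1,2) volume_spec_volume_measure[OF assms(1,2)] assms(3)] .

text \<open>On a closed coordinate ball the density is bounded and the coordinate measure finite, so
  every point has a neighbourhood of finite volume; finitely many of these cover
  \<open>M\<close>.\<close>

lemma finite_volume_spec:
  assumes M: "submanifold_with_boundary k M" "compact M" and \<mu>: "volume_spec k M \<mu>"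
  shows "finite_measure \<mu>"
proof
  have Mb: "M \<in> sets borel" using M(2) by (simp add: borel_compact)
  have loc: "\<exists>V. open V \<and> p \<in> V \<and> emeasure \<mu> (M \<inter> V) < \<infinity>" if p: "p \<in> M" for p
  proof -
    obtain B e U \<psi> x where c: "chart k M B e U \<psi>" "x \<in> U" "x \<in> model_slice B e" "\<psi> x = p"
      using submanifold_chart[OF M(1) p] by metis
    then interpret chart k M B e U \<psi> by simp
    obtain r where r: "r > 0" "cball x r \<subseteq> U" using open_U c(2) open_contains_cball by blast
    define V where "V = \<psi> ` U \<inter> \<phi> -` ball x r"
    have V: "open V" unfolding V_def
      by (intro continuous_open_preimage Ck_on_continuous[OF Ck_phi[of 0]] open_image) auto
    have pV: "p \<in> V" using c r by (auto simp: V_def)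
    have "compact ((\<lambda>x. sqrt (gram_det B \<psi> x)) ` cball x r)"
      using Ck_on_continuous[OF Ck_sqrt_gram_det[OF B, of 0]] r(2)
      by (intro compact_continuous_image) (auto intro: continuous_on_subset)
    then have "bounded ((\<lambda>x. sqrt (gram_det B \<psi> x)) ` cball x r)" by (rule compact_imp_bounded)
    then obtain K where K: "\<And>z. z \<in> cball x r \<Longrightarrow> \<bar>sqrt (gram_det B \<psi> z)\<bar> \<le> K"
      unfolding bounded_iff real_norm_def by blast
    have "emeasure \<mu> (M \<inter> V) = (\<integral>\<^sup>+z. ennreal (sqrt (gram_det B \<psi> z)) * indicator (U \<inter> \<psi> -` (M \<inter> V)) z \<partial>slice_measure B)"
      using Mb V by (intro volume_specD(3)[OF \<mu> chart_axioms]) (auto simp: V_def)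
    also have "\<dots> \<le> (\<integral>\<^sup>+z. ennreal K * indicator (cball 0 (norm x + r)) z \<partial>slice_measure B)"
    proof (intro nn_integral_mono)
      fix z
      show "ennreal (sqrt (gram_det B \<psi> z)) * indicator (U \<inter> \<psi> -` (M \<inter> V)) z \<le> ennreal K * indicator (cball 0 (norm x + r)) z"
      proof (cases "z \<in> U \<inter> \<psi> -` (M \<inter> V)")
        case True
        then have "\<phi> (\<psi> z) \<in> ball x r" "z \<in> U" unfolding V_def by blast+
        then have "z \<in> ball x r" by simp
        then have "z \<in> cball x r" "z \<in> cball 0 (norm x + r)"
          using norm_triangle_ineq2[of z x] by (auto simp: dist_norm norm_minus_commute)
        then show ?thesis using abs_le_D1[OF K[of z]] True by (auto simp: ennreal_leI)
      qed simp
    qed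
    also have "\<dots> = ennreal K * emeasure (slice_measure B) (cball 0 (norm x + r))"
      by (rule nn_integral_cmult_indicator) (simp add: borel_closed)
    also have "\<dots> < \<infinity>" using emeasure_slice_measure_cball[OF B] by (simp add: ennreal_mult_less_top)
    finally show ?thesis using V pV by blast
  qed
  then obtain V where V: "\<And>p. p \<in> M \<Longrightarrow> open (V p) \<and> p \<in> V p \<and> emeasure \<mu> (M \<inter> V p) < \<infinity>" by metis
  have "M \<subseteq> (\<Union>p\<in>M. V p)" using V by blast
  then obtain P where P: "P \<subseteq> M" "finite P" "M \<subseteq> (\<Union>p\<in>P. V p)"
    using compactE_image[OF M(2), of M V] V by metis
  have "emeasure \<mu> (space \<mu>) = emeasure \<mu> M"
    using volume_spec_AE[OF \<mu> Mb] Mb volume_specD(1)[OF \<mu>] sets_eq_imp_space_eq[OF volume_specD(1)[OF \<mu>]]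
    by (intro emeasure_eq_AE) auto
  also have "M = (\<Union>p\<in>P. M \<inter> V p)" using P by blast
  also have "emeasure \<mu> (\<Union>p\<in>P. M \<inter> V p) \<le> (\<Sum>p\<in>P. emeasure \<mu> (M \<inter> V p))"
    using P V Mb volume_specD(1)[OF \<mu>] by (intro emeasure_subadditive_finite) auto
  also have "\<dots> < \<infinity>" using P V by (auto simp: ennreal_sum_less_top)
  finally show "emeasure \<mu> (space \<mu>) \<noteq> \<infinity>" by simp
qed

subsection \<open>Dual frame, mean curvature and the divergence in a chart\<close>

lemma Ck_on_det:
  fixes f :: "'n::finite \<Rightarrow> 'n \<Rightarrow> 'a::real_normed_vector \<Rightarrow> real"
  assumes "open S" "\<And>i j. Ck_on m S (f i j)"
  shows "Ck_on m S (\<lambda>x. det (\<chi> i j. f i j x))"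
  unfolding det_def by (simp, intro Ck_on_sum Ck_on_mult Ck_on_prod Ck_on_const assms)

lemma has_derivative_det:
  fixes A :: "'a::real_normed_vector \<Rightarrow> real ^ 'n ^ 'n"
  assumes "\<And>i j. ((\<lambda>x. A x $ i $ j) has_derivative (\<lambda>h. A' h $ i $ j)) (at x)"
  shows "((\<lambda>x. det (A x)) has_derivative (\<lambda>h. \<Sum>k\<in>UNIV. det (\<chi> i. if i = k then A' h $ i else A x $ i))) (at x)"
proof -
  have "((\<lambda>x. det (A x)) has_derivative (\<lambda>h. \<Sum>p\<in>{p. p permutes UNIV}. of_int (sign p) *
      (\<Sum>k\<in>UNIV. A' h $ k $ p k * (\<Prod>i\<in>UNIV - {k}. A x $ i $ p i)))) (at x)"
    unfolding det_def by (intro has_derivative_sum has_derivative_mult_right has_derivative_prod assms)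
  moreover have "(\<Sum>p\<in>{p. p permutes UNIV}. of_int (sign p) *
      (\<Sum>k\<in>UNIV. A' h $ k $ p k * (\<Prod>i\<in>UNIV - {k}. A x $ i $ p i))) =
      (\<Sum>k\<in>UNIV. det (\<chi> i. if i = k then A' h $ i else A x $ i))" for h
  proof -
    have "(\<Prod>i\<in>UNIV. (\<chi> i. if i = k then A' h $ i else A x $ i) $ i $ p i) =
        A' h $ k $ p k * (\<Prod>i\<in>UNIV - {k}. A x $ i $ p i)" for k and p :: "'n \<Rightarrow> 'n"
    proof -
      have "(\<Prod>i\<in>UNIV. (\<chi> i. if i = k then A' h $ i else A x $ i) $ i $ p i) =
        A' h $ k $ p k * (\<Prod>i\<in>UNIV - {k}. (\<chi> i. if i = k then A' h $ i else A x $ i) $ i $ p i)"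
        by (subst prod.remove[of UNIV k]) auto
      also have "(\<Prod>i\<in>UNIV - {k}. (\<chi> i. if i = k then A' h $ i else A x $ i) $ i $ p i) = (\<Prod>i\<in>UNIV - {k}. A x $ i $ p i)"
        by (intro prod.cong) auto
      finally show ?thesis .
    qed
    then show ?thesis
      unfolding det_def by (subst sum.swap) (simp add: sum_distrib_left)
  qed
  ultimately show ?thesis by simp
qed

text \<open>Since X A = 1, row k of the derivative is a linear combination of the rows of
  \<open>A\<close>, with coefficient vector (row k of A') X. Replacing row k by it multiplies the
  determinant by the k-th coefficient.\<close>

lemma jacobi_formula:
  fixes A :: "'a::real_normed_vector \<Rightarrow> real ^ 'n ^ 'n"
  assumes "\<And>i j. ((\<lambda>x. A x $ i $ j) has_derivative (\<lambda>h. A' h $ i $ j)) (at x)" and X: "A x ** X = mat 1"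
  shows "((\<lambda>x. det (A x)) has_derivative (\<lambda>h. det (A x) * (\<Sum>i\<in>UNIV. \<Sum>j\<in>UNIV. A' h $ i $ j * X $ j $ i))) (at x)"
proof -
  have X': "X ** A x = mat 1" using X by (simp add: matrix_left_right_inverse)
  have "det (\<chi> i. if i = k then A' h $ i else A x $ i) = det (A x) * (\<Sum>j\<in>UNIV. A' h $ k $ j * X $ j $ k)" for h k
  proof -
    define y :: "real ^ 'n" where "y = (\<chi> i. \<Sum>j\<in>UNIV. A' h $ k $ j * X $ j $ i)"
    have "(\<Sum>i\<in>UNIV. y $ i *s row i (A x)) $ l = A' h $ k $ l" for l
    proof -
      have "(\<Sum>i\<in>UNIV. y $ i *s row i (A x)) $ l = (\<Sum>i\<in>UNIV. \<Sum>j\<in>UNIV. A' h $ k $ j * X $ j $ i * A x $ i $ l)"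
        by (simp add: y_def row_def sum_distrib_right)
      also have "\<dots> = (\<Sum>j\<in>UNIV. A' h $ k $ j * (X ** A x) $ j $ l)"
        by (subst sum.swap) (simp add: matrix_matrix_mult_def sum_distrib_left mult.assoc)
      also have "\<dots> = A' h $ k $ l" unfolding X' by (simp add: mat_def if_distrib cong: if_cong)
      finally show ?thesis .
    qed
    then have "(\<Sum>i\<in>UNIV. y $ i *s row i (A x)) = A' h $ k" by (simp add: vec_eq_iff)
    moreover have "row i (A x) = A x $ i" for i by (simp add: row_def vec_eq_iff)
    ultimately have "(\<chi> i. if i = k then A' h $ i else A x $ i) = (\<chi> i. if i = k then (\<Sum>i\<in>UNIV. y $ i *s row i (A x)) else row i (A x))"
      by (simp add: vec_eq_iff)
    then show ?thesis using cramer_lemma_transpose[of k y "A x"] by (simp add: y_def)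
  qed
  then show ?thesis using has_derivative_det[OF assms(1)] by (simp add: sum_distrib_left)
qed

text \<open>The trace of DZ composed with the orthogonal projection to the tangent space, over the
  ambient basis. It agrees with the sum over any orthonormal tangent basis, but involves no choice
  of one.\<close>

definition submanifold_div :: "'a::euclidean_space set \<Rightarrow> ('a \<Rightarrow> 'a) \<Rightarrow> 'a \<Rightarrow> real" where
  "submanifold_div M Z p = (\<Sum>i\<in>Basis. pd Z (i - normal_part M p i) p \<bullet> i)"

section \<open>The dual frame and the tangential projection\<close>

context chart
begin

definition G :: "'a \<Rightarrow> real ^ 'a bidx ^ 'a bidx" where "G x = gmat B (d\<psi> x)"

text \<open>The inverse Gram matrix by Cramer's rule, which makes its differentiability evident.\<close>

definition Gi :: "'a \<Rightarrow> real ^ 'a bidx ^ 'a bidx" where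
  "Gi x = (\<chi> i j. det (\<chi> r s. if s = i then (if r = j then 1 else 0) else G x $ r $ s) / det (G x))"

definition ginv :: "'a \<Rightarrow> 'a \<Rightarrow> 'a \<Rightarrow> real" where
  "ginv b c x = Gi x $ bidx_of b $ bidx_of c"

text \<open>The coordinate vectors with the index raised: along \<open>M\<close> these are the
  gradients of the coordinate functions.\<close>

definition \<nu> :: "'a \<Rightarrow> 'a \<Rightarrow> 'a" where
  "\<nu> b x = (\<Sum>c\<in>B. ginv c b x *\<^sub>R pd \<psi> c x)"

definition J :: "'a \<Rightarrow> real" where "J x = sqrt (gram_det B \<psi> x)"

lemma G_nth: "x \<in> U \<Longrightarrow> G x $ i $ j =
    (if bvec i \<in> B \<and> bvec j \<in> B then pd \<psi> (bvec i) x \<bullet> pd \<psi> (bvec j) x else if i = j then 1 else 0)"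
  unfolding G_def by (rule gmat_nth[OF B linear_dpsi])

lemma det_G: "x \<in> U \<Longrightarrow> det (G x) = gram_det B \<psi> x"
  using gram_det_eq[OF B] by (simp add: G_def)

lemma det_G_pos: "x \<in> U \<Longrightarrow> det (G x) > 0"
  using gram_det_pos[OF _ B] by (simp add: det_G)

lemma J_pos: "x \<in> U \<Longrightarrow> J x > 0"
  using gram_det_pos[OF _ B] by (simp add: J_def)

lemma G_Gi: assumes "x \<in> U" shows "G x ** Gi x = mat 1"
proof -
  have "G x *v (\<chi> k. Gi x $ k $ j) = axis j 1" for j
    using cramer[of "G x" "\<chi> k. Gi x $ k $ j" "axis j 1"] det_G_pos[OF assms] by (simp add: Gi_def axis_def cong: if_cong)
  then have "(G x *v (\<chi> k. Gi x $ k $ j)) $ i = (axis j 1 :: real ^ 'a bidx) $ i" for i j by simp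
  then show ?thesis
    by (simp add: vec_eq_iff matrix_matrix_mult_def matrix_vector_mult_def mat_def axis_def)
qed

lemma Ck_G: "Ck_on n U (\<lambda>x. G x $ i $ j)"
proof -
  have "Ck_on n U (\<lambda>x. if bvec i \<in> B \<and> bvec j \<in> B then pd \<psi> (bvec i) x \<bullet> pd \<psi> (bvec j) x else if i = j then 1 else 0)"
    by (cases "bvec i \<in> B \<and> bvec j \<in> B") (auto intro!: Ck_on_inner open_U Ck_pd_psi)
  then show ?thesis by (rule Ck_on_cong[OF open_U, rotated]) (simp add: G_nth)
qed

lemma Ck_ginv: "Ck_on n U (ginv b c)"
proof -
  have d: "Ck_on n U (\<lambda>x. det (G x))"
    using Ck_on_det[OF open_U, where f="\<lambda>i j x. G x $ i $ j" and m=n] Ck_G by simp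
  have "Ck_on n U (\<lambda>x. det (\<chi> r s. if s = bidx_of b then (if r = bidx_of c then 1 else 0) else G x $ r $ s) / det (G x))"
  proof (intro Ck_on_divide open_U d)
    show "Ck_on n U (\<lambda>x. det (\<chi> r s. if s = bidx_of b then (if r = bidx_of c then 1 else 0) else G x $ r $ s))"
    proof (rule Ck_on_det[OF open_U])
      show "Ck_on n U (\<lambda>x. if s = bidx_of b then (if r = bidx_of c then 1 else 0) else G x $ r $ s)" for r s
        using Ck_on_const[OF open_U, of n "if r = bidx_of c then 1 else 0 :: real"] Ck_G[of n r s]
        by (cases "s = bidx_of b") simp_all
    qed
    show "det (G x) \<noteq> 0" if "x \<in> U" for x using det_G_pos[OF that] by simp
  qed
  then show ?thesis by (simp add: ginv_def[abs_def] Gi_def)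
qed

lemma Ck_nu: "Ck_on n U (\<nu> b)"
  unfolding \<nu>_def[abs_def] by (intro Ck_on_sum Ck_on_scaleR open_U Ck_ginv Ck_pd_psi)

lemma Ck_J: "Ck_on n U J"
  using Ck_sqrt_gram_det[OF B] by (simp add: J_def[abs_def])

lemma sum_bidx_of: "(\<Sum>i\<in>UNIV. f i) = (\<Sum>b\<in>Basis. f (bidx_of (b::'a)))"
  using sum_bvec[of "\<lambda>b. f (bidx_of b)"] by (simp add: bvec_inverse)

lemma bvec_bidx_of: "b \<in> B \<Longrightarrow> bvec (bidx_of b) = b"
  using B bidx_of_inverse by blast

text \<open>This is the \<open>B\<close>-block of the identity G G^-1 = 1. The sum over
  \<open>B\<close> extends to all of \<open>Basis\<close> because the mixed entries of the padded
  matrix vanish.\<close>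

lemma nu_dpsi:
  assumes x: "x \<in> U" and "b \<in> B" "c \<in> B"
  shows "\<nu> b x \<bullet> pd \<psi> c x = (if b = c then 1 else 0)"
proof -
  have bB: "b \<in> Basis" "c \<in> Basis" using assms B by auto
  have "\<nu> b x \<bullet> pd \<psi> c x = (\<Sum>a\<in>B. G x $ bidx_of c $ bidx_of a * Gi x $ bidx_of a $ bidx_of b)"
    unfolding \<nu>_def inner_sum_left
    by (intro sum.cong) (auto simp: G_nth[OF x] bvec_bidx_of assms ginv_def inner_commute)
  also have "\<dots> = (\<Sum>a\<in>Basis. G x $ bidx_of c $ bidx_of a * Gi x $ bidx_of a $ bidx_of b)"
  proof (rule sum.mono_neutral_left)
    show "\<forall>a\<in>Basis - B. G x $ bidx_of c $ bidx_of a * Gi x $ bidx_of a $ bidx_of b = 0"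
    proof
      fix a assume a: "a \<in> Basis - B"
      then have "bvec (bidx_of a) = a" by (simp add: bidx_of_inverse)
      then have "G x $ bidx_of c $ bidx_of a = 0"
        using a assms bvec_bidx_of[of c] by (auto simp: G_nth[OF x])
      then show "G x $ bidx_of c $ bidx_of a * Gi x $ bidx_of a $ bidx_of b = 0" by simp
    qed
  qed (use B in auto)
  also have "\<dots> = (G x ** Gi x) $ bidx_of c $ bidx_of b"
    by (simp add: matrix_matrix_mult_def sum_bidx_of)
  also have "\<dots> = (if b = c then 1 else 0)"
    unfolding G_Gi[OF x] using bvec_bidx_of[OF assms(2)] bvec_bidx_of[OF assms(3)] by (auto simp: mat_def)
  finally show ?thesis .
qed

lemma nu_nu: "x \<in> U \<Longrightarrow> b \<in> B \<Longrightarrow> c \<in> B \<Longrightarrow> \<nu> b x \<bullet> \<nu> c x = ginv b c x"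
proof -
  assume a: "x \<in> U" "b \<in> B" "c \<in> B"
  have "\<nu> b x \<bullet> \<nu> c x = (\<Sum>a\<in>B. ginv a c x * (\<nu> b x \<bullet> pd \<psi> a x))"
    by (subst (2) \<nu>_def) (simp add: inner_sum_right)
  also have "\<dots> = (\<Sum>d\<in>B. if d = b then ginv b c x else 0)"
    using a by (intro sum.cong) (auto simp: nu_dpsi)
  finally show ?thesis using a finite_B by simp
qed

lemma ginv_sym: "x \<in> U \<Longrightarrow> b \<in> B \<Longrightarrow> c \<in> B \<Longrightarrow> ginv b c x = ginv c b x"
  by (metis nu_nu inner_commute)

definition tang :: "'a \<Rightarrow> 'a \<Rightarrow> 'a" where
  "tang x w = (\<Sum>b\<in>B. (w \<bullet> \<nu> b x) *\<^sub>R pd \<psi> b x)"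

definition nrm :: "'a \<Rightarrow> 'a \<Rightarrow> 'a" where "nrm x w = w - tang x w"

lemma linear_tang: "linear (tang x)"
  by (rule linearI) (simp_all add: tang_def inner_add_left algebra_simps sum.distrib scaleR_sum_right)

lemma linear_nrm: "linear (nrm x)"
  unfolding nrm_def[abs_def] by (intro linear_compose_sub linear_ident linear_tang)

lemma tang_in: "x \<in> U \<Longrightarrow> tang x w \<in> d\<psi> x ` span B"
  unfolding tang_def
  by (intro subspace_sum subspace_scale linear_subspace_image[OF linear_dpsi subspace_span] imageI span_base) auto

lemma tang_dpsi:
  assumes x: "x \<in> U" and "u \<in> span B"
  shows "tang x (d\<psi> x u) = d\<psi> x u"
proof -
  have "tang x (pd \<psi> c x) = pd \<psi> c x" if "c \<in> B" for c
  proof -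
    have "tang x (pd \<psi> c x) = (\<Sum>b\<in>B. if b = c then pd \<psi> c x else 0)"
      unfolding tang_def using that x by (intro sum.cong) (auto simp: inner_commute[of _ "\<nu> _ x"] nu_dpsi)
    then show ?thesis using that finite_B by simp
  qed
  then show ?thesis
    using linear_eq_on_span[OF linear_compose[OF linear_dpsi[OF x] linear_tang[of x]] linear_dpsi[OF x], of B u] assms(2)
    by (auto simp: o_def)
qed

lemma nrm_dpsi: "x \<in> U \<Longrightarrow> u \<in> span B \<Longrightarrow> nrm x (d\<psi> x u) = 0"
  by (simp add: nrm_def tang_dpsi)

lemma nrm_pd: "x \<in> U \<Longrightarrow> b \<in> B \<Longrightarrow> nrm x (pd \<psi> b x) = 0"
  by (simp add: nrm_dpsi span_base)

text \<open>Rests on expanding \<partial>_b \<psi> in the dual frame. The error of this expansion is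
  tangential, so \<open>tang\<close> fixes it, and orthogonal to all coordinate vectors, so
  \<open>tang\<close> annihilates it.\<close>

lemma tang_inner: "x \<in> U \<Longrightarrow> b \<in> B \<Longrightarrow> tang x w \<bullet> pd \<psi> b x = w \<bullet> pd \<psi> b x"
proof -
  assume a: "x \<in> U" "b \<in> B"
  have "w \<bullet> pd \<psi> b x = w \<bullet> (\<Sum>c\<in>B. (pd \<psi> c x \<bullet> pd \<psi> b x) *\<^sub>R \<nu> c x)"
  proof -
    have "pd \<psi> b x = (\<Sum>c\<in>B. (pd \<psi> c x \<bullet> pd \<psi> b x) *\<^sub>R \<nu> c x)" (is "_ = ?r")
    proof -
      obtain u where u: "u \<in> span B" "?r = d\<psi> x u"
      proof -
        have "?r \<in> d\<psi> x ` span B"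
          unfolding \<nu>_def using a
          by (intro subspace_sum subspace_scale linear_subspace_image[OF linear_dpsi subspace_span] imageI span_base) auto
        then show ?thesis using that by blast
      qed
      have inn: "?r \<bullet> pd \<psi> d x = pd \<psi> b x \<bullet> pd \<psi> d x" if "d \<in> B" for d
      proof -
        have "?r \<bullet> pd \<psi> d x = (\<Sum>c\<in>B. if c = d then pd \<psi> d x \<bullet> pd \<psi> b x else 0)"
          unfolding inner_sum_left using that a by (intro sum.cong) (auto simp: nu_dpsi)
        then show ?thesis using that finite_B by (simp add: inner_commute)
      qed
      let ?d = "pd \<psi> b x - ?r"
      have dT: "?d = d\<psi> x (b - u)" using u(2) linear_diff[OF linear_dpsi[OF a(1)]] by simp
      have "?d \<bullet> pd \<psi> d x = 0" if "d \<in> B" for d using inn[OF that] by (simp add: inner_diff_left)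
      then have "?d \<bullet> \<nu> d x = 0" for d by (simp add: \<nu>_def inner_sum_right)
      then have "tang x ?d = 0" by (simp add: tang_def)
      then have "?d = 0" using tang_dpsi[of x "b - u"] a u(1) dT by (simp add: span_diff span_base)
      then show ?thesis by simp
    qed
    then show ?thesis by metis
  qed
  also have "\<dots> = (\<Sum>c\<in>B. (pd \<psi> c x \<bullet> pd \<psi> b x) * (w \<bullet> \<nu> c x))" by (simp add: inner_sum_right)
  also have "\<dots> = tang x w \<bullet> pd \<psi> b x" by (simp add: tang_def inner_sum_left mult.commute)
  finally show ?thesis by simp
qed

lemma nrm_inner: "x \<in> U \<Longrightarrow> u \<in> span B \<Longrightarrow> nrm x w \<bullet> d\<psi> x u = 0"
proof -
  assume a: "x \<in> U" "u \<in> span B"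
  have "nrm x w \<bullet> pd \<psi> b x = 0" if "b \<in> B" for b
    using tang_inner[OF a(1) that, of w] by (simp add: nrm_def inner_diff_left)
  moreover have "linear (\<lambda>u. nrm x w \<bullet> d\<psi> x u)"
    using linear_dpsi[OF a(1)] by (intro linearI) (simp_all add: linear_add linear_scale inner_add_right)
  ultimately show ?thesis
    using linear_eq_on_span[of "\<lambda>u. nrm x w \<bullet> d\<psi> x u" "\<lambda>u. 0" B u] a(2) linear_zero by auto
qed

lemma normal_part_eq:
  assumes x: "x \<in> U" "x \<in> model_slice B e"
  shows "normal_part M (\<psi> x) w = nrm x w"
  unfolding normal_part_def tangent_space_eq[OF x]
proof (rule the_equality)
  show "w - nrm x w \<in> d\<psi> x ` span B \<and> (\<forall>u\<in>d\<psi> x ` span B. nrm x w \<bullet> u = 0)"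
    using tang_in[OF x(1)] nrm_inner[OF x(1)] by (auto simp: nrm_def)
  fix z assume z: "w - z \<in> d\<psi> x ` span B \<and> (\<forall>u\<in>d\<psi> x ` span B. z \<bullet> u = 0)"
  have "tang x z = 0"
    using z unfolding tang_def \<nu>_def by (auto simp: inner_sum_right span_base)
  moreover have "tang x (w - z) = w - z" using z tang_dpsi[OF x(1)] by auto
  ultimately have "tang x w = w - z" using linear_diff[OF linear_tang, of x w z] by simp
  then show "z = nrm x w" by (simp add: nrm_def)
qed

lemma nrm_nrm_inner:
  assumes "x \<in> U"
  shows "nrm x w \<bullet> nrm x w = w \<bullet> nrm x w"
proof -
  obtain u where "u \<in> span B" "tang x w = d\<psi> x u" using tang_in[OF assms, of w] by blast
  then have "tang x w \<bullet> nrm x w = 0" using nrm_inner[OF assms, of u w] by (simp add: inner_commute)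
  moreover have "nrm x w \<bullet> nrm x w = w \<bullet> nrm x w - tang x w \<bullet> nrm x w"
    by (subst nrm_def) (rule inner_diff_left)
  ultimately show ?thesis by simp
qed

lemma has_derivative_pd_psi: "x \<in> U \<Longrightarrow> (pd \<psi> b has_derivative (\<lambda>h. pd (pd \<psi> b) h x)) (at x)"
  using Ck_on_has_derivative[OF Ck_pd_psi[of 1]] by simp

text \<open>Jacobi's formula gives dJ = (J / 2) tr(G^-1 dG). The two summands of the derivative of
  \<partial>_b \<psi> \<bullet> \<partial>_c \<psi> contribute equally by symmetry of the inverse
  matrix, which cancels the factor 1/2.\<close>

lemma has_derivative_J:
  assumes x: "x \<in> U"
  shows "(J has_derivative (\<lambda>h. J x * (\<Sum>b\<in>B. pd (pd \<psi> b) h x \<bullet> \<nu> b x))) (at x)"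
proof -
  define G' where "G' h = (\<chi> i j. if bvec i \<in> B \<and> bvec j \<in> B
      then pd \<psi> (bvec i) x \<bullet> pd (pd \<psi> (bvec j)) h x + pd (pd \<psi> (bvec i)) h x \<bullet> pd \<psi> (bvec j) x else (0 :: real))" for h
  have "((\<lambda>x. G x $ i $ j) has_derivative (\<lambda>h. G' h $ i $ j)) (at x)" for i j
  proof -
    have "((\<lambda>x. if bvec i \<in> B \<and> bvec j \<in> B then pd \<psi> (bvec i) x \<bullet> pd \<psi> (bvec j) x else if i = j then 1 else 0)
      has_derivative (\<lambda>h. G' h $ i $ j)) (at x)"
      by (cases "bvec i \<in> B \<and> bvec j \<in> B")
        (auto simp: G'_def intro!: has_derivative_inner has_derivative_pd_psi x)
    then show ?thesis
      by (rule has_derivative_transform_within_open[OF _ open_U x]) (simp add: G_nth)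
  qed
  from jacobi_formula[OF this G_Gi[OF x]]
  have d: "((\<lambda>x. det (G x)) has_derivative (\<lambda>h. det (G x) * (\<Sum>i\<in>UNIV. \<Sum>j\<in>UNIV. G' h $ i $ j * Gi x $ j $ i))) (at x)" .
  have s: "(\<Sum>i\<in>UNIV. \<Sum>j\<in>UNIV. G' h $ i $ j * Gi x $ j $ i) = 2 * (\<Sum>b\<in>B. pd (pd \<psi> b) h x \<bullet> \<nu> b x)" for h
  proof -
    have "(\<Sum>i\<in>UNIV. \<Sum>j\<in>UNIV. G' h $ i $ j * Gi x $ j $ i) =
       (\<Sum>b\<in>Basis. \<Sum>c\<in>Basis. G' h $ bidx_of b $ bidx_of c * Gi x $ bidx_of c $ bidx_of b)"
      by (simp add: sum_bidx_of)
    also have "\<dots> = (\<Sum>b\<in>B. \<Sum>c\<in>B. G' h $ bidx_of b $ bidx_of c * Gi x $ bidx_of c $ bidx_of b)"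
    proof -
      have "(\<Sum>c\<in>Basis. G' h $ bidx_of b $ bidx_of c * Gi x $ bidx_of c $ bidx_of b) =
        (\<Sum>c\<in>B. G' h $ bidx_of b $ bidx_of c * Gi x $ bidx_of c $ bidx_of b)" for b
        using B by (intro sum.mono_neutral_right) (auto simp: G'_def bidx_of_inverse)
      moreover have "(\<Sum>b\<in>Basis. \<Sum>c\<in>B. G' h $ bidx_of b $ bidx_of c * Gi x $ bidx_of c $ bidx_of b) =
        (\<Sum>b\<in>B. \<Sum>c\<in>B. G' h $ bidx_of b $ bidx_of c * Gi x $ bidx_of c $ bidx_of b)"
        using B by (intro sum.mono_neutral_right) (auto simp: G'_def bidx_of_inverse)
      ultimately show ?thesis by simp
    qed
    also have "\<dots> = (\<Sum>b\<in>B. \<Sum>c\<in>B. ginv c b x * (pd \<psi> b x \<bullet> pd (pd \<psi> c) h x))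
        + (\<Sum>b\<in>B. \<Sum>c\<in>B. ginv c b x * (pd (pd \<psi> b) h x \<bullet> pd \<psi> c x))"
      unfolding sum.distrib[symmetric]
      by (intro sum.cong refl) (simp add: G'_def bvec_bidx_of ginv_def algebra_simps)
    also have "(\<Sum>b\<in>B. \<Sum>c\<in>B. ginv c b x * (pd (pd \<psi> b) h x \<bullet> pd \<psi> c x)) = (\<Sum>b\<in>B. pd (pd \<psi> b) h x \<bullet> \<nu> b x)"
      by (simp add: \<nu>_def inner_sum_right)
    also have "(\<Sum>b\<in>B. \<Sum>c\<in>B. ginv c b x * (pd \<psi> b x \<bullet> pd (pd \<psi> c) h x)) = (\<Sum>c\<in>B. \<Sum>b\<in>B. ginv b c x * (pd (pd \<psi> c) h x \<bullet> pd \<psi> b x))"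
      by (subst sum.swap) (intro sum.cong refl, simp add: ginv_sym[OF x] inner_commute)
    also have "\<dots> = (\<Sum>b\<in>B. pd (pd \<psi> b) h x \<bullet> \<nu> b x)"
      by (simp add: \<nu>_def inner_sum_right)
    finally show ?thesis by simp
  qed
  have "((\<lambda>x. sqrt (det (G x))) has_derivative (\<lambda>h. J x * (\<Sum>b\<in>B. pd (pd \<psi> b) h x \<bullet> \<nu> b x))) (at x)"
  proof -
    have "det (G x) = J x * J x" using det_G_pos[OF x] by (simp add: J_def det_G[OF x])
    then show ?thesis
      by (intro has_derivative_eq_rhs[OF has_derivative_real_sqrt[OF det_G_pos[OF x] d]])
        (use J_pos[OF x] in \<open>simp add: s fun_eq_iff field_simps\<close>)
  qed
  then show ?thesis
    by (rule has_derivative_transform_within_open[OF _ open_U x]) (simp add: det_G J_def)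
qed

section \<open>Divergence of the weighted dual frame\<close>

definition Jnu_div :: "'a \<Rightarrow> 'a" where
  "Jnu_div x = (\<Sum>b\<in>B. pd (\<lambda>x. J x *\<^sub>R \<nu> b x) b x)"

text \<open>The trace of the second fundamental form, formed with the inverse metric;
  \<open>mean_curvature_eq\<close> identifies it with the coordinate-free
  \<open>mean_curvature\<close>.\<close>

definition H :: "'a \<Rightarrow> 'a" where
  "H x = (\<Sum>b\<in>B. \<Sum>c\<in>B. ginv c b x *\<^sub>R nrm x (pd (pd \<psi> c) b x))"

lemma Ck_Jnu: "Ck_on n U (\<lambda>x. J x *\<^sub>R \<nu> b x)"
  by (intro Ck_on_scaleR open_U Ck_J Ck_nu)

lemma has_derivative_Jnu: "x \<in> U \<Longrightarrow> ((\<lambda>x. J x *\<^sub>R \<nu> b x) has_derivative (\<lambda>h. pd (\<lambda>x. J x *\<^sub>R \<nu> b x) h x)) (at x)"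
  using Ck_on_has_derivative[OF Ck_Jnu[of 1 b]] by simp

text \<open>Differentiating J \<nu>^b \<bullet> \<partial>_c \<psi> = J \<delta>_bc and summing over
  b leaves \<partial>_c J minus J \<Sum>_b \<nu>^b \<bullet> \<partial>_b \<partial>_c \<psi>. By
  \<open>has_derivative_J\<close> and commuting second derivatives the two cancel.\<close>

lemma Jnu_div_tangential:
  assumes x: "x \<in> U" and c: "c \<in> B"
  shows "Jnu_div x \<bullet> pd \<psi> c x = 0"
proof -
  have "pd (\<lambda>x. J x *\<^sub>R \<nu> b x) b x \<bullet> pd \<psi> c x =
      (if b = c then J x * (\<Sum>a\<in>B. pd (pd \<psi> a) c x \<bullet> \<nu> a x) else 0) - J x * (\<nu> b x \<bullet> pd (pd \<psi> c) b x)" if b: "b \<in> B" for b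
  proof -
    have 1: "((\<lambda>x. (J x *\<^sub>R \<nu> b x) \<bullet> pd \<psi> c x) has_derivative
      (\<lambda>h. (J x *\<^sub>R \<nu> b x) \<bullet> pd (pd \<psi> c) h x + pd (\<lambda>x. J x *\<^sub>R \<nu> b x) h x \<bullet> pd \<psi> c x)) (at x)"
      by (intro has_derivative_inner has_derivative_Jnu has_derivative_pd_psi x)
    have "((\<lambda>x. if b = c then J x else 0) has_derivative (\<lambda>h. if b = c then J x * (\<Sum>a\<in>B. pd (pd \<psi> a) h x \<bullet> \<nu> a x) else 0)) (at x)"
      using has_derivative_J[OF x] by (cases "b = c") auto
    then have 2: "((\<lambda>x. (J x *\<^sub>R \<nu> b x) \<bullet> pd \<psi> c x) has_derivative
       (\<lambda>h. if b = c then J x * (\<Sum>a\<in>B. pd (pd \<psi> a) h x \<bullet> \<nu> a x) else 0)) (at x)"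
      by (rule has_derivative_transform_within_open[OF _ open_U x]) (simp add: nu_dpsi b c)
    have "(J x *\<^sub>R \<nu> b x) \<bullet> pd (pd \<psi> c) b x + pd (\<lambda>x. J x *\<^sub>R \<nu> b x) b x \<bullet> pd \<psi> c x
       = (if b = c then J x * (\<Sum>a\<in>B. pd (pd \<psi> a) b x \<bullet> \<nu> a x) else 0)"
      using fun_cong[OF has_derivative_unique[OF 1 2], of b] by simp
    then show ?thesis by (auto simp: algebra_simps)
  qed
  then have "Jnu_div x \<bullet> pd \<psi> c x = (\<Sum>b\<in>B. (if b = c then J x * (\<Sum>a\<in>B. pd (pd \<psi> a) c x \<bullet> \<nu> a x) else 0) - J x * (\<nu> b x \<bullet> pd (pd \<psi> c) b x))"
    unfolding Jnu_div_def inner_sum_left by (intro sum.cong) auto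
  also have "\<dots> = J x * (\<Sum>a\<in>B. pd (pd \<psi> a) c x \<bullet> \<nu> a x) - (\<Sum>b\<in>B. J x * (\<nu> b x \<bullet> pd (pd \<psi> c) b x))"
    using c finite_B by (simp add: sum_subtractf)
  also have "\<dots> = 0"
    by (simp add: sum_distrib_left inner_commute pd_commute[OF open_U Ck_psi x, of c])
  finally show ?thesis .
qed

text \<open>With J \<nu>^b written in the coordinate vectors, the derivatives of the coefficients
  multiply tangent vectors and vanish against \<open>z\<close>; only second derivatives of \<psi>
  survive.\<close>

lemma Jnu_div_normal:
  assumes x: "x \<in> U" and z: "\<And>c. c \<in> B \<Longrightarrow> pd \<psi> c x \<bullet> z = 0"
  shows "Jnu_div x \<bullet> z = J x * (H x \<bullet> z)"
proof -
  have nz: "nrm x w \<bullet> z = w \<bullet> z" for w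
    using z by (simp add: nrm_def tang_def inner_diff_left inner_sum_left)
  have "pd (\<lambda>x. J x *\<^sub>R \<nu> b x) b x \<bullet> z = (\<Sum>c\<in>B. J x * ginv c b x * (pd (pd \<psi> c) b x \<bullet> z))" if b: "b \<in> B" for b
  proof -
    have dg: "((\<lambda>x. J x * ginv c b x) has_derivative (\<lambda>h. pd (\<lambda>x. J x * ginv c b x) h x)) (at x)" for c
      using Ck_on_has_derivative[OF Ck_on_mult[OF open_U Ck_J Ck_ginv, of 1]] x by simp
    have 1: "((\<lambda>x. \<Sum>c\<in>B. (J x * ginv c b x) *\<^sub>R pd \<psi> c x) has_derivative
       (\<lambda>h. \<Sum>c\<in>B. (J x * ginv c b x) *\<^sub>R pd (pd \<psi> c) h x + pd (\<lambda>x. J x * ginv c b x) h x *\<^sub>R pd \<psi> c x)) (at x)"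
      by (intro has_derivative_sum has_derivative_scaleR dg has_derivative_pd_psi x)
    have eq: "(\<lambda>x. J x *\<^sub>R \<nu> b x) = (\<lambda>x. \<Sum>c\<in>B. (J x * ginv c b x) *\<^sub>R pd \<psi> c x)"
      by (simp add: \<nu>_def scaleR_sum_right)
    have "pd (\<lambda>x. J x *\<^sub>R \<nu> b x) b x = (\<Sum>c\<in>B. (J x * ginv c b x) *\<^sub>R pd (pd \<psi> c) b x + pd (\<lambda>x. J x * ginv c b x) b x *\<^sub>R pd \<psi> c x)"
      unfolding eq by (rule fun_cong[OF frechet_derivative_at[OF 1, symmetric]])
    then show ?thesis by (simp add: inner_sum_left inner_add_left z)
  qed
  then have "Jnu_div x \<bullet> z = (\<Sum>b\<in>B. \<Sum>c\<in>B. J x * ginv c b x * (pd (pd \<psi> c) b x \<bullet> z))"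
    unfolding Jnu_div_def inner_sum_left by (intro sum.cong) auto
  also have "\<dots> = J x * (H x \<bullet> z)"
    by (simp add: H_def inner_sum_left nz sum_distrib_left mult.assoc)
  finally show ?thesis .
qed

text \<open>\<open>Jnu_div x\<close> is itself normal, so it may be inserted for \<open>z\<close>;
  its squared norm then equals J times its inner product with H = 0.\<close>

lemma Jnu_div_zero:
  assumes x: "x \<in> U" and "H x = 0"
  shows "Jnu_div x = 0"
proof -
  have "Jnu_div x \<bullet> Jnu_div x = J x * (H x \<bullet> Jnu_div x)"
    by (rule Jnu_div_normal[OF x]) (simp add: inner_commute Jnu_div_tangential[OF x])
  then show ?thesis using assms(2) by simp
qed

text \<open>For any admissible extension Y of w, the composite with \<psi> equals its expansion in
  the coordinate vectors at all points of the slice. Differentiating in slice directions, the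
  derivatives of the coefficients multiply tangent vectors and disappear in the normal part, so the
  result depends on w alone.\<close>

lemma second_fundamental_form_eq:
  assumes x: "x \<in> U" "x \<in> model_slice B e" and u: "u \<in> tangent_space M (\<psi> x)" and w: "w \<in> tangent_space M (\<psi> x)"
  shows "second_fundamental_form M (\<psi> x) u w =
    (\<Sum>b\<in>B. \<Sum>c\<in>B. ((u \<bullet> \<nu> b x) * (w \<bullet> \<nu> c x)) *\<^sub>R nrm x (pd (pd \<psi> c) b x))" (is "_ = ?R")
proof -
  have T: "tang x a = a" if "a \<in> tangent_space M (\<psi> x)" for a
    using that tang_dpsi[OF x(1)] unfolding tangent_space_eq[OF x] by auto
  have key: "normal_part M (\<psi> x) (pd Y u (\<psi> x)) = ?R"
    if Y: "open W" "\<psi> x \<in> W" "smooth_on W Y" "\<forall>q\<in>M \<inter> W. Y q \<in> tangent_space M q" "Y (\<psi> x) = w" for W Y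
  proof -
    have dY: "(Y has_derivative frechet_derivative Y (at (\<psi> x))) (at (\<psi> x))"
      using Y(2,3) Ck_on_has_derivative[of 1 W Y] by (simp add: smooth_on_def)
    have linY: "linear (frechet_derivative Y (at (\<psi> x)))" using dY has_derivative_linear by blast
    define V where "V = U \<inter> \<psi> -` W"
    have V: "open V" "x \<in> V" using x Y Ck_on_continuous[OF Ck_psi[of 0]] open_U
      unfolding V_def by (auto intro!: continuous_open_preimage)
    define Yp where "Yp y = Y (\<psi> y)" for y
    have dYp: "(Yp has_derivative (\<lambda>h. pd Y (d\<psi> x h) (\<psi> x))) (at x)"
      unfolding Yp_def[abs_def] by (rule has_derivative_compose[OF has_derivative_psi[OF x(1)] dY])
    define f where "f c y = Yp y \<bullet> \<nu> c y" for c y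
    have dnu: "(\<nu> c has_derivative frechet_derivative (\<nu> c) (at x)) (at x)" for c
      using Ck_on_has_derivative[OF Ck_nu[of 1 c]] x(1) by simp
    have df: "(f c has_derivative (\<lambda>h. Yp x \<bullet> pd (\<nu> c) h x + pd Y (d\<psi> x h) (\<psi> x) \<bullet> \<nu> c x)) (at x)" for c
      unfolding f_def[abs_def] by (intro has_derivative_inner dYp dnu)
    let ?f' = "\<lambda>c h. Yp x \<bullet> pd (\<nu> c) h x + pd Y (d\<psi> x h) (\<psi> x) \<bullet> \<nu> c x"
    have dd: "((\<lambda>y. Yp y - (\<Sum>c\<in>B. f c y *\<^sub>R pd \<psi> c y)) has_derivative
      (\<lambda>h. pd Y (d\<psi> x h) (\<psi> x) - (\<Sum>c\<in>B. f c x *\<^sub>R pd (pd \<psi> c) h x + ?f' c h *\<^sub>R pd \<psi> c x))) (at x)"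
      by (intro has_derivative_diff has_derivative_sum has_derivative_scaleR df dYp has_derivative_pd_psi x(1))
    have zero: "Yp y - (\<Sum>c\<in>B. f c y *\<^sub>R pd \<psi> c y) = 0" if "y \<in> V" "y \<in> model_slice B e" for y
    proof -
      have y: "y \<in> U" using that(1) by (simp add: V_def)
      have yM: "\<psi> y \<in> M \<inter> W" using that in_M_iff by (simp add: V_def)
      have "Yp y \<in> d\<psi> y ` span B"
        using bspec[OF Y(4) yM] unfolding tangent_space_eq[OF y that(2)] Yp_def .
      then have "tang y (Yp y) = Yp y" using tang_dpsi[OF y] by auto
      then show ?thesis by (simp add: tang_def f_def)
    qed
    have fx: "f c x = w \<bullet> \<nu> c x" for c by (simp add: f_def Yp_def Y(5))
    have nb: "nrm x (pd Y (pd \<psi> b x) (\<psi> x)) = (\<Sum>c\<in>B. (w \<bullet> \<nu> c x) *\<^sub>R nrm x (pd (pd \<psi> c) b x))" if "b \<in> B" for b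
    proof -
      have "pd Y (d\<psi> x b) (\<psi> x) - (\<Sum>c\<in>B. f c x *\<^sub>R pd (pd \<psi> c) b x + ?f' c b *\<^sub>R pd \<psi> c x) = 0"
        by (rule derivative_zero_on_slice[OF V(2,1) x(2) dd zero span_base[OF that]])
      then have "pd Y (d\<psi> x b) (\<psi> x) = (\<Sum>c\<in>B. f c x *\<^sub>R pd (pd \<psi> c) b x + ?f' c b *\<^sub>R pd \<psi> c x)" by simp
      then have "nrm x (pd Y (d\<psi> x b) (\<psi> x)) = nrm x (\<Sum>c\<in>B. f c x *\<^sub>R pd (pd \<psi> c) b x + ?f' c b *\<^sub>R pd \<psi> c x)"
        by (rule arg_cong)
      also have "\<dots> = (\<Sum>c\<in>B. (w \<bullet> \<nu> c x) *\<^sub>R nrm x (pd (pd \<psi> c) b x))"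
        by (simp add: linear_sum[OF linear_nrm] linear_add[OF linear_nrm] linear_scale[OF linear_nrm] nrm_pd[OF x(1)] fx)
      finally show ?thesis .
    qed
    have "pd Y u (\<psi> x) = (\<Sum>b\<in>B. (u \<bullet> \<nu> b x) *\<^sub>R pd Y (pd \<psi> b x) (\<psi> x))"
      by (subst T[OF u, symmetric]) (simp add: tang_def linear_sum[OF linY] linear_scale[OF linY])
    then have "nrm x (pd Y u (\<psi> x)) = (\<Sum>b\<in>B. (u \<bullet> \<nu> b x) *\<^sub>R nrm x (pd Y (pd \<psi> b x) (\<psi> x)))"
      by (simp add: linear_sum[OF linear_nrm] linear_scale[OF linear_nrm])
    also have "\<dots> = ?R"
      by (intro sum.cong refl) (simp add: nb scaleR_sum_right)
    finally show ?thesis by (simp add: normal_part_eq[OF x])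
  qed
  \<comment> \<open>The existence witness: coefficients of w in the coordinate frame, kept constant
    across the chart.\<close>
  define Y where "Y q = (\<Sum>c\<in>B. (w \<bullet> \<nu> c x) *\<^sub>R pd \<psi> c (\<phi> q))" for q
  have Ysm: "smooth_on (\<psi> ` U) Y"
    unfolding smooth_on_def Y_def[abs_def]
    by (intro allI Ck_on_sum Ck_on_scaleR Ck_on_const open_image
        Ck_on_compose[OF open_image open_U Ck_phi Ck_pd_psi]) auto
  have YT: "\<forall>q\<in>M \<inter> \<psi> ` U. Y q \<in> tangent_space M q"
  proof
    fix q assume "q \<in> M \<inter> \<psi> ` U"
    then obtain y where y: "y \<in> U" "y \<in> model_slice B e" "q = \<psi> y" using M_eq by auto
    show "Y q \<in> tangent_space M q"
      unfolding y(3) tangent_space_eq[OF y(1,2)] Y_def using y(1)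
      by (intro subspace_sum subspace_scale linear_subspace_image[OF linear_dpsi subspace_span] imageI) (auto intro: span_base)
  qed
  have Yx: "Y (\<psi> x) = w" using T[OF w] x(1) by (simp add: Y_def tang_def)
  show ?thesis
    unfolding second_fundamental_form_def
  proof (rule the_equality)
    show "\<exists>W Y. open W \<and> \<psi> x \<in> W \<and> smooth_on W Y \<and> (\<forall>q\<in>M \<inter> W. Y q \<in> tangent_space M q) \<and> Y (\<psi> x) = w \<and>
        ?R = normal_part M (\<psi> x) (pd Y u (\<psi> x))"
      using open_image x(1) Ysm YT Yx key[OF open_image _ Ysm YT Yx] by (intro exI[of _ "\<psi> ` U"] exI[of _ Y]) auto
    fix z assume "\<exists>W Y. open W \<and> \<psi> x \<in> W \<and> smooth_on W Y \<and> (\<forall>q\<in>M \<inter> W. Y q \<in> tangent_space M q) \<and> Y (\<psi> x) = w \<and>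
        z = normal_part M (\<psi> x) (pd Y u (\<psi> x))"
    then show "z = ?R" using key by blast
  qed
qed

text \<open>The basis chosen by \<open>SOME\<close> cancels: by Parseval the sum over it of (y
  \<bullet> \<nu>^b)(y \<bullet> \<nu>^c) is \<nu>^b \<bullet> \<nu>^c, an entry of the inverse
  metric.\<close>

lemma mean_curvature_eq:
  assumes x: "x \<in> U" "x \<in> model_slice B e"
  shows "mean_curvature M (\<psi> x) = H x"
proof -
  let ?T = "tangent_space M (\<psi> x)"
  define E where "E = (SOME E. orthonormal_basis ?T E)"
  have sub: "subspace ?T" by (simp add: tangent_space_def)
  obtain E0 where "E0 \<subseteq> ?T" "pairwise orthogonal E0" "\<And>x. x \<in> E0 \<Longrightarrow> norm x = 1" "span E0 = ?T"
    using orthonormal_basis_subspace[OF sub] by metis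
  then have "orthonormal_basis ?T E0" by (simp add: orthonormal_basis_def)
  then have "orthonormal_basis ?T E" unfolding E_def by (rule someI)
  then have E: "pairwise orthogonal E" "\<And>y. y \<in> E \<Longrightarrow> norm y = 1" "span E = ?T"
    by (auto simp: orthonormal_basis_def)
  have "0 \<notin> E" using E(2) by force
  then have finE: "finite E"
    using pairwise_orthogonal_independent[OF E(1)] independent_imp_finite by blast
  have ET: "y \<in> ?T" if "y \<in> E" for y using E(3) that span_base by blast
  have nuT: "\<nu> b x \<in> span E" for b
    unfolding E(3) tangent_space_eq[OF x] \<nu>_def using x(1)
    by (intro subspace_sum subspace_scale linear_subspace_image[OF linear_dpsi subspace_span] imageI) (auto intro: span_base)
  have parseval: "(\<Sum>y\<in>E. (y \<bullet> \<nu> b x) * (y \<bullet> \<nu> c x)) = ginv c b x" if "b \<in> B" "c \<in> B" for b c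
  proof -
    have "\<nu> c x \<bullet> \<nu> b x = (\<Sum>y\<in>E. (\<nu> c x \<bullet> y) *\<^sub>R y) \<bullet> \<nu> b x"
      using orthonormal_basis_expand[OF E(1,2) nuT finE] by simp
    then show ?thesis using nu_nu[OF x(1), of c b] that by (simp add: inner_sum_left inner_sum_right inner_commute mult.commute)
  qed
  have "mean_curvature M (\<psi> x) = (\<Sum>y\<in>E. \<Sum>b\<in>B. \<Sum>c\<in>B. ((y \<bullet> \<nu> b x) * (y \<bullet> \<nu> c x)) *\<^sub>R nrm x (pd (pd \<psi> c) b x))"
    unfolding mean_curvature_def E_def[symmetric]
    by (intro sum.cong refl second_fundamental_form_eq[OF x]) (auto intro: ET)
  also have "\<dots> = (\<Sum>b\<in>B. \<Sum>c\<in>B. \<Sum>y\<in>E. ((y \<bullet> \<nu> b x) * (y \<bullet> \<nu> c x)) *\<^sub>R nrm x (pd (pd \<psi> c) b x))"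
    by (rule trans[OF sum.swap], rule sum.cong[OF refl], rule sum.swap)
  also have "\<dots> = H x"
    unfolding H_def by (intro sum.cong refl) (simp add: scaleR_sum_left[symmetric] parseval)
  finally show ?thesis .
qed

lemma submanifold_div_eq:
  assumes x: "x \<in> U" "x \<in> model_slice B e" and Z: "(Z has_derivative frechet_derivative Z (at (\<psi> x))) (at (\<psi> x))"
  shows "submanifold_div M Z (\<psi> x) = (\<Sum>b\<in>B. pd Z (pd \<psi> b x) (\<psi> x) \<bullet> \<nu> b x)"
proof -
  have lin: "linear (frechet_derivative Z (at (\<psi> x)))" using Z has_derivative_linear by blast
  have "submanifold_div M Z (\<psi> x) = (\<Sum>i\<in>Basis. pd Z (tang x i) (\<psi> x) \<bullet> i)"
    by (simp add: submanifold_div_def normal_part_eq[OF x] nrm_def)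
  also have "\<dots> = (\<Sum>i\<in>Basis. \<Sum>b\<in>B. (i \<bullet> \<nu> b x) * (pd Z (pd \<psi> b x) (\<psi> x) \<bullet> i))"
    by (simp add: tang_def linear_sum[OF lin] linear_scale[OF lin] inner_sum_left)
  also have "\<dots> = (\<Sum>b\<in>B. \<Sum>i\<in>Basis. (pd Z (pd \<psi> b x) (\<psi> x) \<bullet> i) * (\<nu> b x \<bullet> i))"
    by (subst sum.swap) (simp add: inner_commute mult.commute)
  finally show ?thesis by (simp add: euclidean_inner[symmetric])
qed

text \<open>By the product rule the right side exceeds the left by Z \<bullet>
  \<open>Jnu_div\<close>, which vanishes where the mean curvature does. This is where minimality
  enters.\<close>

lemma J_submanifold_div:
  assumes x: "x \<in> U" "x \<in> model_slice B e" and min: "mean_curvature M (\<psi> x) = 0"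
    and Z: "(Z has_derivative frechet_derivative Z (at (\<psi> x))) (at (\<psi> x))"
  shows "J x * submanifold_div M Z (\<psi> x) = (\<Sum>b\<in>B. pd (\<lambda>x. Z (\<psi> x) \<bullet> (J x *\<^sub>R \<nu> b x)) b x)"
proof -
  have dZ: "((\<lambda>x. Z (\<psi> x)) has_derivative (\<lambda>h. pd Z (d\<psi> x h) (\<psi> x))) (at x)"
    by (rule has_derivative_compose[OF has_derivative_psi[OF x(1)] Z])
  have "pd (\<lambda>x. Z (\<psi> x) \<bullet> (J x *\<^sub>R \<nu> b x)) b x =
     Z (\<psi> x) \<bullet> pd (\<lambda>x. J x *\<^sub>R \<nu> b x) b x + pd Z (d\<psi> x b) (\<psi> x) \<bullet> (J x *\<^sub>R \<nu> b x)" for b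
    by (rule fun_cong[OF frechet_derivative_at[OF has_derivative_inner[OF dZ has_derivative_Jnu[OF x(1), of b]], symmetric]])
  then have "(\<Sum>b\<in>B. pd (\<lambda>x. Z (\<psi> x) \<bullet> (J x *\<^sub>R \<nu> b x)) b x) = Z (\<psi> x) \<bullet> Jnu_div x + J x * (\<Sum>b\<in>B. pd Z (d\<psi> x b) (\<psi> x) \<bullet> \<nu> b x)"
    by (simp add: sum.distrib Jnu_div_def inner_sum_right sum_distrib_left)
  then show ?thesis
    using Jnu_div_zero[OF x(1)] mean_curvature_eq[OF x] min submanifold_div_eq[OF x Z] by simp
qed

text \<open>By Cramer's rule g^ee is the (e, e) cofactor divided by the determinant, and that
  cofactor is the Gram determinant of the remaining coordinates.\<close>

lemma gram_det_boundary:
  assumes x: "x \<in> U" and eB: "e \<in> B"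
  shows "gram_det (B - {e}) \<psi> x = ginv e e x * gram_det B \<psi> x"
proof -
  let ?N = "\<chi> r s. if s = bidx_of e then (if r = bidx_of e then 1 else 0) else G x $ r $ s"
  have be: "bvec (bidx_of e) = e" using bvec_bidx_of[OF eB] .
  have B': "B - {e} \<subseteq> Basis" using B by auto
  let ?G' = "gmat (B - {e}) (d\<psi> x)"
  have ne: "bvec r \<noteq> e" if "r \<noteq> bidx_of e" for r using that be bvec_inverse by metis
  \<comment> \<open>The matrices may differ in row e off the diagonal, so Leibniz terms are
    compared: both have a unit vector as column e, so terms of permutations moving e vanish on both
    sides, and the other terms agree.\<close>
  have "det ?N = det ?G'"
    unfolding det_def
  proof (intro sum.cong refl arg_cong2[where f="(*)"])
    fix p assume "p \<in> {p. p permutes (UNIV :: 'a bidx set)}"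
    then have p: "bij p" using permutes_bij by auto
    then obtain i where i: "p i = bidx_of e" by (metis bij_pointE)
    show "(\<Prod>i\<in>UNIV. ?N $ i $ p i) = (\<Prod>i\<in>UNIV. ?G' $ i $ p i)"
    proof (cases "i = bidx_of e")
      case True
      have "?N $ r $ p r = ?G' $ r $ p r" for r
      proof (cases "r = bidx_of e")
        case True
        then show ?thesis using i \<open>i = bidx_of e\<close> be by (simp add: gmat_nth[OF B' linear_dpsi[OF x]])
      next
        case False
        then have "p r \<noteq> bidx_of e" using i True p by (metis bij_is_inj injD)
        then show ?thesis using False ne by (simp add: gmat_nth[OF B' linear_dpsi[OF x]] G_nth[OF x])
      qed
      then show ?thesis by simp
    next
      case False
      have "?N $ i $ p i = 0" "?G' $ i $ p i = 0"
        using False i be by (simp_all add: gmat_nth[OF B' linear_dpsi[OF x]])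
      then have ex: "\<exists>r\<in>UNIV. ?N $ r $ p r = 0" "\<exists>r\<in>UNIV. ?G' $ r $ p r = 0" by blast+
      have "(\<Prod>i\<in>UNIV. ?N $ i $ p i) = 0" using finite ex(1) by (rule prod_zero)
      moreover have "(\<Prod>i\<in>UNIV. ?G' $ i $ p i) = 0" using finite ex(2) by (rule prod_zero)
      ultimately show ?thesis by (simp only:)
    qed
  qed
  then have "ginv e e x = det ?G' / det (G x)" by (simp add: ginv_def Gi_def)
  then show ?thesis
    using det_G_pos[OF x] gram_det_eq[OF B' x] det_G[OF x] by simp
qed

text \<open>\<nu>^e is tangent to \<open>M\<close> and orthogonal to the boundary coordinates, hence
  a multiple a of the unit conormal. From p \<bullet> p = 1 follows a^2 = g^ee, so J |a| is the
  boundary density; a \<le> 0 because -p points into the half-space.\<close>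

lemma boundary_flux:
  assumes x: "x \<in> U" "x \<in> model_slice B e" and bd: "e \<noteq> 0" "x \<bullet> e = 0"
    and con: "outward_unit_conormal k M (\<psi> x) p"
  shows "J x *\<^sub>R \<nu> e x = - sqrt (gram_det (B - {e}) \<psi> x) *\<^sub>R p"
proof -
  have eB: "e \<in> B" using e bd by auto
  interpret bc: chart "k - 1" "manifold_boundary k M" "B - {e}" 0 U \<psi> by (rule boundary_chart[OF bd(1)])
  have xb: "x \<in> model_slice (B - {e}) 0" using boundary_slice[OF bd(1)] x bd by simp
  obtain u where u: "u \<in> span B" "p = d\<psi> x u"
    using con unfolding outward_unit_conormal_def tangent_space_eq[OF x] by blast
  have np: "p \<bullet> p = 1" using con by (simp add: outward_unit_conormal_def dot_square_norm)
  have orth: "p \<bullet> pd \<psi> c x = 0" if "c \<in> B" "c \<noteq> e" for c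
  proof -
    have "pd \<psi> c x \<in> tangent_space (manifold_boundary k M) (\<psi> x)"
      unfolding bc.tangent_space_eq[OF x(1) xb] using that by (auto intro: span_base)
    then show ?thesis using con unfolding outward_unit_conormal_def by blast
  qed
  have tp: "tang x p = p" using tang_dpsi[OF x(1) u(1)] u(2) by simp
  have sume: "(\<Sum>b\<in>B. f b * (p \<bullet> pd \<psi> b x)) = f e * (p \<bullet> pd \<psi> e x)" for f
  proof -
    have "(\<Sum>b\<in>B. f b * (p \<bullet> pd \<psi> b x)) = (\<Sum>b\<in>B. if b = e then f e * (p \<bullet> pd \<psi> e x) else 0)"
      using orth by (intro sum.cong) auto
    then show ?thesis using eB finite_B by simp
  qed
  define a where "a = p \<bullet> \<nu> e x"
  define s where "s = p \<bullet> pd \<psi> e x"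
  have "p \<bullet> p = tang x p \<bullet> p" using tp by simp
  also have "\<dots> = (\<Sum>b\<in>B. (p \<bullet> \<nu> b x) * (p \<bullet> pd \<psi> b x))"
    by (simp add: tang_def inner_sum_left inner_sum_right inner_commute)
  finally have as: "a * s = 1" using np sume[of "\<lambda>b. p \<bullet> \<nu> b x"] by (simp add: a_def s_def)
  have ag: "a = ginv e e x * s"
    using sume[of "\<lambda>c. ginv c e x"] by (simp add: a_def s_def \<nu>_def inner_sum_right)
  have g: "ginv e e x = a\<^sup>2" using as ag by (metis mult.assoc mult.commute mult_1 power2_eq_square)
  have nue: "\<nu> e x = a *\<^sub>R p"
  proof -
    have "pd \<psi> c x \<bullet> (\<nu> e x - a *\<^sub>R p) = 0" if "c \<in> B" for c
      using that nu_dpsi[OF x(1) eB that] orth[OF that] as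
      by (cases "c = e") (auto simp: inner_diff_right inner_commute s_def)
    then have z: "(\<nu> e x - a *\<^sub>R p) \<bullet> \<nu> b x = 0" for b by (simp add: \<nu>_def[of b] inner_sum_right inner_commute)
    have "\<nu> e x \<in> d\<psi> x ` span B"
      unfolding \<nu>_def using x(1)
      by (intro subspace_sum subspace_scale linear_subspace_image[OF linear_dpsi subspace_span] imageI) (auto intro: span_base)
    then have "tang x (\<nu> e x) = \<nu> e x" using tang_dpsi[OF x(1)] by auto
    then have "\<nu> e x - a *\<^sub>R p = tang x (\<nu> e x - a *\<^sub>R p)"
      using tp by (simp add: linear_diff[OF linear_tang] linear_scale[OF linear_tang])
    also have "\<dots> = 0" using z by (simp add: tang_def)
    finally show ?thesis by simp
  qed
  have "a \<le> 0"
  proof -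
    have "initial_velocity M (\<psi> x) (- p)" using con by (simp add: outward_unit_conormal_def)
    then obtain w where w: "w \<in> span B" "0 \<le> w \<bullet> e" "- p = d\<psi> x w"
      using initial_velocity_iff[OF x] bd by blast
    have "linear (\<lambda>w. d\<psi> x w \<bullet> \<nu> e x)"
      using linear_dpsi[OF x(1)] by (intro linearI) (simp_all add: linear_add linear_scale inner_add_left)
    moreover have "linear (\<lambda>w. w \<bullet> e)" by (intro linearI) (simp_all add: inner_add_left)
    moreover have "d\<psi> x b \<bullet> \<nu> e x = b \<bullet> e" if "b \<in> B" for b
      using nu_dpsi[OF x(1) eB that] B eB that by (auto simp: inner_commute inner_Basis subset_iff)
    ultimately have "d\<psi> x w \<bullet> \<nu> e x = w \<bullet> e" using linear_eq_on_span w(1) by blast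
    then have "- a = w \<bullet> e" using w(3) by (metis a_def inner_minus_left)
    then show ?thesis using w(2) by simp
  qed
  have "sqrt (gram_det (B - {e}) \<psi> x) = \<bar>a\<bar> * J x"
    unfolding gram_det_boundary[OF x(1) eB] g by (simp add: real_sqrt_mult J_def)
  then show ?thesis using \<open>a \<le> 0\<close> by (simp add: nue)
qed

end

subsection \<open>Partition of unity and the divergence theorem\<close>

text \<open>A cutoff that is continuously differentiable, the regularity at which the divergence
  theorem is stated.\<close>

lemma Ck_on_max_power2: "Ck_on 1 UNIV (\<lambda>s::real. (max 0 s)\<^sup>2)"
proof -
  have "((\<lambda>s. (max 0 s)\<^sup>2) has_real_derivative 2 * max 0 s) (at s)" for s :: real
  proof -
    consider "s > 0" | "s < 0" | "s = 0" by linarith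
    then show ?thesis
    proof cases
      case 1
      have "((\<lambda>s. s\<^sup>2) has_real_derivative 2 * max 0 s) (at s)"
        using 1 by (auto intro!: derivative_eq_intros)
      then show ?thesis
        by (rule has_field_derivative_transform_within_open[of _ _ _ "{0<..}"]) (use 1 in auto)
    next
      case 2
      have "((\<lambda>s. 0) has_real_derivative 2 * max 0 s) (at s)"
        using 2 by (auto intro!: derivative_eq_intros)
      then show ?thesis
        by (rule has_field_derivative_transform_within_open[of _ _ _ "{..<0}"]) (use 2 in auto)
    next
      case 3
      \<comment> \<open>Caratheodory's criterion with slope function max 0 z, since (max 0 z)^2 =
        max 0 z * z.\<close>
      show ?thesis unfolding CARAT_DERIV
      proof (intro exI[of _ "\<lambda>z. max 0 z"] conjI allI)
        show "isCont (max 0) s" by (intro continuous_intros)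
      qed (use 3 in \<open>auto simp: power2_eq_square max_def\<close>)
    qed
  qed
  then have d: "((\<lambda>s. (max 0 s)\<^sup>2) has_derivative (\<lambda>h. 2 * max 0 s * h)) (at s)" for s :: real
    by (simp add: has_field_derivative_def)
  have "Ck_on (Suc 0) UNIV (\<lambda>s::real. (max 0 s)\<^sup>2)"
    by (rule Ck_on_SucI[OF open_UNIV d]) (simp, intro continuous_intros)
  then show ?thesis by simp
qed

text \<open>The functions sum to 1 on a neighbourhood of \<open>M\<close> and not merely on
  \<open>M\<close>, so that ambient derivatives of the sum can be taken at points of
  \<open>M\<close>.\<close>

lemma partition_of_unity:
  fixes M :: "'a::euclidean_space set"
  assumes "compact M" and W: "\<And>p. p \<in> M \<Longrightarrow> open (W p) \<and> p \<in> W p"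
  obtains P \<rho> K V where "finite P" "P \<subseteq> M" "open V" "M \<subseteq> V"
    and "\<forall>p\<in>P. Ck_on 1 UNIV (\<rho> p) \<and> compact (K p) \<and> K p \<subseteq> W p \<and> (\<forall>y. y \<notin> K p \<longrightarrow> \<rho> p y = (0::real))"
    and "\<forall>y\<in>V. (\<Sum>p\<in>P. \<rho> p y) = 1"
proof -
  have "\<forall>p\<in>M. \<exists>r>0. cball p r \<subseteq> W p" using W open_contains_cball by blast
  then obtain r where r: "\<forall>p\<in>M. r p > 0 \<and> cball p (r p) \<subseteq> W p" by metis
  obtain P where P: "P \<subseteq> M" "finite P" "M \<subseteq> (\<Union>p\<in>P. ball p (r p))"
  proof (rule compactE_image[OF assms(1), of M "\<lambda>p. ball p (r p)"])
    show "M \<subseteq> (\<Union>p\<in>M. ball p (r p))" using r by force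
  qed auto
  define \<beta> where "\<beta> p y = (max 0 ((r p)\<^sup>2 - (y - p) \<bullet> (y - p)))\<^sup>2" for p y
  define s where "s y = (\<Sum>p\<in>P. \<beta> p y)" for y
  have C\<beta>: "Ck_on 1 UNIV (\<beta> p)" for p
    unfolding \<beta>_def[abs_def]
    by (rule Ck_on_compose[OF open_UNIV open_UNIV _ Ck_on_max_power2])
      (intro Ck_on_diff Ck_on_inner Ck_on_id Ck_on_const open_UNIV subset_UNIV)+
  have Cs: "Ck_on 1 UNIV s"
    unfolding s_def[abs_def] by (intro Ck_on_sum C\<beta> open_UNIV)
  have nn: "\<beta> p y \<ge> 0" for p y by (simp add: \<beta>_def)
  have snn: "s y \<ge> 0" for y unfolding s_def by (intro sum_nonneg nn)
  have sM: "s y > 0" if y: "y \<in> M" for y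
  proof -
    obtain p where p: "p \<in> P" "dist p y < r p" using P(3) y by auto
    then have "(norm (y - p))\<^sup>2 < (r p)\<^sup>2"
      by (intro power_strict_mono) (auto simp: dist_norm norm_minus_commute)
    then have "\<beta> p y > 0" by (simp add: \<beta>_def power2_norm_eq_inner[symmetric])
    then show ?thesis unfolding s_def using p(1) P(2) nn by (intro sum_pos2[of P p]) auto
  qed
  obtain m where m: "m > 0" "\<And>y. y \<in> M \<Longrightarrow> s y > m"
  proof (cases "M = {}")
    case False
    obtain y0 where y0: "y0 \<in> M" "\<And>y. y \<in> M \<Longrightarrow> s y0 \<le> s y"
      using continuous_attains_inf[OF assms(1) False, of s] Ck_on_continuous[OF Cs] continuous_on_subset[of UNIV s M] by auto
    show ?thesis
    \<comment> \<open>Half the minimum, so that the inequality is strict on \<open>M\<close> and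
      defines an open neighbourhood.\<close>
    proof (rule that[of "s y0 / 2"])
      show "s y > s y0 / 2" if "y \<in> M" for y using y0(2)[OF that] sM[OF y0(1)] by linarith
    qed (use sM[OF y0(1)] in simp)
  qed (rule that[of 1], auto)
  \<comment> \<open>A denominator that is positive everywhere, also where all bumps vanish, and
    equal to their sum wherever that sum exceeds m.\<close>
  define \<theta> where "\<theta> y = s y + (max 0 (m - s y))\<^sup>2" for y
  have \<theta>: "\<theta> y > 0" for y
  proof (cases "s y = 0")
    case True
    then show ?thesis using m(1) by (simp add: \<theta>_def)
  next
    case False
    then show ?thesis using snn[of y] by (simp add: \<theta>_def add_pos_nonneg)
  qed
  have C\<theta>: "Ck_on 1 UNIV \<theta>"
    unfolding \<theta>_def[abs_def]
    by (intro Ck_on_add open_UNIV Cs Ck_on_compose[OF open_UNIV open_UNIV _ Ck_on_max_power2] Ck_on_diff Ck_on_const) auto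
  show ?thesis
  proof (rule that[of P "{y. s y > m}" "\<lambda>p y. \<beta> p y / \<theta> y" "\<lambda>p. cball p (r p)"])
    show "open {y. s y > m}"
      using Ck_on_continuous[OF Cs] by (intro open_Collect_less continuous_on_const)
    show "\<forall>p\<in>P. Ck_on 1 UNIV (\<lambda>y. \<beta> p y / \<theta> y) \<and> compact (cball p (r p)) \<and> cball p (r p) \<subseteq> W p \<and>
        (\<forall>y. y \<notin> cball p (r p) \<longrightarrow> \<beta> p y / \<theta> y = 0)"
    proof (intro ballI conjI allI impI)
      fix p assume p: "p \<in> P"
      show "Ck_on 1 UNIV (\<lambda>y. \<beta> p y / \<theta> y)"
        using \<theta> by (intro Ck_on_divide open_UNIV C\<beta> C\<theta>) (simp add: less_imp_neq[THEN not_sym])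
      show "cball p (r p) \<subseteq> W p" using r p P(1) by blast
      fix y assume "y \<notin> cball p (r p)"
      then have "(r p)\<^sup>2 < (norm (y - p))\<^sup>2"
        using r p P(1) by (intro power_strict_mono) (auto simp: dist_norm norm_minus_commute less_imp_le)
      then show "\<beta> p y / \<theta> y = 0" by (simp add: \<beta>_def power2_norm_eq_inner[symmetric])
    qed simp
    show "\<forall>y\<in>{y. s y > m}. (\<Sum>p\<in>P. \<beta> p y / \<theta> y) = 1"
    proof
      fix y assume "y \<in> {y. s y > m}"
      then have "\<theta> y = s y" by (simp add: \<theta>_def)
      then show "(\<Sum>p\<in>P. \<beta> p y / \<theta> y) = 1"
        using \<theta>[of y] by (simp add: sum_divide_distrib[symmetric] s_def[symmetric])
    qed
  qed (use P m in auto)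
qed

lemma pd_zero_outside:
  assumes "closed K" "\<And>y. y \<notin> K \<Longrightarrow> f y = 0" "x \<notin> K"
  shows "pd f u x = 0"
proof -
  have "((\<lambda>y. 0) has_derivative (\<lambda>h. 0)) (at x)" by simp
  then have "(f has_derivative (\<lambda>h. 0)) (at x)"
    by (rule has_derivative_transform_within_open[of _ _ _ _ "- K"]) (use assms in auto)
  then show ?thesis by (metis frechet_derivative_at)
qed

section \<open>The divergence theorem in a chart and on the whole submanifold\<close>

context chart
begin

lemma divergence_theorem_chart:
  assumes M: "submanifold_with_boundary k M" "compact M" and min: "\<And>p. p \<in> M \<Longrightarrow> mean_curvature M p = 0"
    and con: "\<And>p. p \<in> manifold_boundary k M \<Longrightarrow> outward_unit_conormal k M p p"
    and Z: "Ck_on 1 UNIV Z" and K: "compact K" "K \<subseteq> \<psi> ` U" "\<And>y. y \<notin> K \<Longrightarrow> Z y = 0"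
  shows "integrable (volume_measure k M) (\<lambda>p. indicator M p * submanifold_div M Z p)"
    and "integrable (volume_measure (k - 1) (manifold_boundary k M)) (\<lambda>p. Z p \<bullet> p)"
    and "(LINT p|volume_measure k M. indicator M p * submanifold_div M Z p) =
      (LINT p|volume_measure (k - 1) (manifold_boundary k M). Z p \<bullet> p)"
proof -
  let ?\<mu> = "volume_measure k M" and ?\<sigma> = "volume_measure (k - 1) (manifold_boundary k M)"
  have Mb [measurable]: "M \<in> sets borel" using M(2) by (simp add: borel_compact)
  have \<mu>: "volume_spec k M ?\<mu>" by (rule volume_spec_volume_measure[OF M])
  have bM: "submanifold_with_boundary (k - 1) (manifold_boundary k M)" "compact (manifold_boundary k M)"
    using submanifold_boundary[OF M(1)] compact_boundary[OF M] by auto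
  have \<sigma>: "volume_spec (k - 1) (manifold_boundary k M) ?\<sigma>" by (rule volume_spec_volume_measure[OF bM])
  have bMb: "manifold_boundary k M \<in> sets borel" using bM(2) by (simp add: borel_compact)
  have dZ: "(Z has_derivative frechet_derivative Z (at y)) (at y)" for y
    using Ck_on_has_derivative[OF Z] by simp
  define K' where "K' = \<phi> ` K"
  have K': "compact K'" "K' \<subseteq> U"
    unfolding K'_def using K Ck_on_continuous[OF Ck_phi[of 0]]
    by (auto intro!: compact_continuous_image intro: continuous_on_subset)
  \<comment> \<open>The components of J Z with respect to the dual frame, extended by 0. The support
    of Z pulls back to a compact subset of \<open>U\<close>, so the extension is C^1 on the whole
    space.\<close>
  define F where "F b x = (if x \<in> U then Z (\<psi> x) \<bullet> (J x *\<^sub>R \<nu> b x) else 0)" for b x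
  have F0: "F b x = 0" if "x \<notin> K'" for b x
  proof (cases "x \<in> U")
    case True
    then have "\<psi> x \<notin> K" using that phi_psi[OF True] unfolding K'_def by (metis imageI)
    then show ?thesis using K(3)[of "\<psi> x"] by (simp add: F_def)
  qed (simp add: F_def)
  have CFU: "Ck_on 1 U (\<lambda>x. Z (\<psi> x) \<bullet> (J x *\<^sub>R \<nu> b x))" for b
    by (intro Ck_on_inner open_U Ck_Jnu Ck_on_compose[OF open_U open_UNIV Ck_psi Z]) auto
  have CF: "Ck_on 1 UNIV (F b)" for b
  proof (rule Ck_on_on_local)
    fix x
    show "\<exists>T. open T \<and> x \<in> T \<and> Ck_on 1 T (F b)"
    proof (cases "x \<in> U")
      case True
      have "Ck_on 1 U (F b)" by (rule Ck_on_cong[OF open_U _ CFU[of b]]) (simp add: F_def)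
      then show ?thesis using open_U True by blast
    next
      case False
      have op: "open (- K')" using K'(1) compact_imp_closed by blast
      have "Ck_on 1 (- K') (F b)" by (rule Ck_on_cong[OF op _ Ck_on_const[OF op, of 1 0]]) (simp add: F0)
      then show ?thesis using op False K'(2) by blast
    qed
  qed
  obtain R where "\<forall>x\<in>K'. norm x \<le> R"
    using compact_imp_bounded[OF K'(1)] unfolding bounded_iff by blast
  then have R: "K' \<subseteq> cball 0 R" by auto
  have supp: "F b x = 0" if "norm x > R" for b x
  proof (rule F0)
    show "x \<notin> K'" using R that by auto
  qed
  define q where "q x = (\<Sum>b\<in>B. pd (F b) b x)" for x
  have qU: "q x = J x * submanifold_div M Z (\<psi> x)" if x: "x \<in> U" "x \<in> model_slice B e" for x
  proof -
    have "pd (F b) b x = pd (\<lambda>x. Z (\<psi> x) \<bullet> (J x *\<^sub>R \<nu> b x)) b x" for b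
    proof -
      have "F b differentiable at x" using Ck_on_has_derivative[OF CF] by (auto simp: differentiable_def)
      then show ?thesis
        using frechet_derivative_transform_within_open[of "F b" x U "\<lambda>x. Z (\<psi> x) \<bullet> (J x *\<^sub>R \<nu> b x)"] open_U x(1)
        by (simp add: F_def)
    qed
    then show ?thesis
      using J_submanifold_div[OF x min dZ] x in_M_iff by (simp add: q_def)
  qed
  have q0: "q x = 0" if "x \<notin> K'" for x
    unfolding q_def using pd_zero_outside[OF compact_imp_closed[OF K'(1)] F0 that] by simp
  have div0: "submanifold_div M Z y = 0" if "y \<notin> K" for y
    unfolding submanifold_div_def using pd_zero_outside[OF compact_imp_closed[OF K(1)] K(3) that] by simp
  let ?h = "\<lambda>p. indicator M p * submanifold_div M Z p"
  \<comment> \<open>\<open>normal_part\<close> is a pointwise description, so measurability is not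
    evident. On the chart part of \<open>M\<close> the divergence equals the quotient of
    \<open>q\<close> by J, transported by \<phi> and hence continuous; elsewhere the product
    vanishes.\<close>
  have hb: "?h \<in> borel_measurable borel"
  proof -
    have cq: "continuous_on UNIV q"
      unfolding q_def[abs_def] using CF by (intro continuous_on_sum) simp
    have "continuous_on (\<psi> ` U) (\<lambda>y. q (\<phi> y) / J (\<phi> y))"
    proof (intro continuous_on_divide)
      show "continuous_on (\<psi> ` U) (\<lambda>y. q (\<phi> y))"
        by (rule continuous_on_compose2[OF cq Ck_on_continuous[OF Ck_phi[of 0]]]) auto
      show "continuous_on (\<psi> ` U) (\<lambda>y. J (\<phi> y))"
        by (rule continuous_on_compose2[OF Ck_on_continuous[OF Ck_J[of 0]] Ck_on_continuous[OF Ck_phi[of 0]]]) auto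
      show "\<forall>y\<in>\<psi> ` U. J (\<phi> y) \<noteq> 0" using J_pos by (force simp: less_imp_neq[THEN not_sym])
    qed
    then have "continuous_on (M \<inter> \<psi> ` U) (\<lambda>y. q (\<phi> y) / J (\<phi> y))" by (rule continuous_on_subset) auto
    then have "(\<lambda>y. indicator (M \<inter> \<psi> ` U) y *\<^sub>R (q (\<phi> y) / J (\<phi> y))) \<in> borel_measurable borel"
      by (intro borel_measurable_continuous_on_indicator) auto
    moreover have "indicator (M \<inter> \<psi> ` U) y *\<^sub>R (q (\<phi> y) / J (\<phi> y)) = ?h y" for y
    proof (cases "y \<in> M \<inter> \<psi> ` U")
      case True
      then obtain x where x: "x \<in> U" "x \<in> model_slice B e" "y = \<psi> x" using M_eq by auto
      then show ?thesis using True qU[OF x(1,2)] J_pos[OF x(1)] by simp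
    next
      case False
      then show ?thesis using div0[of y] K(2) by (auto simp: indicator_def)
    qed
    ultimately show ?thesis by simp
  qed
  have intb: "integrable (slice_measure B) (\<lambda>x. indicator (model_slice B e) x * pd (F b) b x)"
    "(LINT x|slice_measure B. indicator (model_slice B e) x * pd (F b) b x) =
        (if b = e then - (LINT x|slice_measure (B - {e}). F e x) else 0)" if "b \<in> B" for b
    using integral_pd_slice[OF B that e CF supp] by auto
  have iq: "integrable (slice_measure B) (\<lambda>x. indicator (model_slice B e) x * q x)"
    unfolding q_def sum_distrib_left by (intro Bochner_Integration.integrable_sum intb)
  \<comment> \<open>Only the direction b = e produces a boundary term; in a chart with e = 0 there
    is none, as 0 is not in \<open>B\<close>.\<close>
  have Lq: "(LINT x|slice_measure B. indicator (model_slice B e) x * q x) =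
      (if e \<in> B then - (LINT x|slice_measure (B - {e}). F e x) else 0)"
    unfolding q_def sum_distrib_left
    by (subst Bochner_Integration.integral_sum) (auto simp: intb finite_B)
  note vol = integral_volume[OF \<mu> Mb hb _ _ _ iq]
  have v1: "?h y = 0" if "y \<in> M" "y \<notin> \<psi> ` U" for y using div0[of y] K(2) that by auto
  have v2: "q x = ?h (\<psi> x) * sqrt (gram_det B \<psi> x)" if "x \<in> U" "x \<in> model_slice B e" for x
    using qU[OF that] in_M_iff[OF that(1)] that(2) by (simp add: J_def)
  have v3: "q x = 0" if "x \<notin> U" for x using q0[of x] K'(2) that by blast
  show "integrable ?\<mu> ?h" by (rule vol(1)[OF v1 v2 v3])
  have L: "(LINT p|?\<mu>. ?h p) = (LINT x|slice_measure B. indicator (model_slice B e) x * q x)"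
    by (rule vol(2)[OF v1 v2 v3])
  have cZ: "continuous_on UNIV (\<lambda>p. Z p \<bullet> p)"
    using Ck_on_continuous[OF Z] by (intro continuous_intros)
  then have Zb: "(\<lambda>p. Z p \<bullet> p) \<in> borel_measurable borel" by (rule borel_measurable_continuous_onI)
  have "integrable ?\<sigma> (\<lambda>p. Z p \<bullet> p) \<and> (LINT p|?\<sigma>. Z p \<bullet> p) = (LINT x|slice_measure B. indicator (model_slice B e) x * q x)"
  proof (cases "e = 0")
    case True
    then have "e \<notin> B" using B by auto
    have ae: "AE p in ?\<sigma>. Z p \<bullet> p = 0"
      using volume_spec_AE[OF \<sigma> bMb]
    proof eventually_elim
      case (elim p)
      then have "p \<notin> K" using boundary_empty[OF True] K(2) by blast
      then show ?case using K(3) by simp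
    qed
    have Zm: "(\<lambda>p. Z p \<bullet> p) \<in> borel_measurable ?\<sigma>"
      using Zb volume_specD(1)[OF \<sigma>] by (simp cong: measurable_cong_sets)
    have "integrable ?\<sigma> (\<lambda>p. Z p \<bullet> p) \<longleftrightarrow> integrable ?\<sigma> (\<lambda>p. 0::real)"
      using Zm ae by (intro integrable_cong_AE) auto
    moreover have "(LINT p|?\<sigma>. Z p \<bullet> p) = (LINT p|?\<sigma>. 0)"
      using Zm ae by (intro integral_cong_AE) auto
    ultimately show ?thesis using Lq \<open>e \<notin> B\<close> by simp
  next
    case False
    then have eB: "e \<in> B" using e by auto
    interpret bc: chart "k - 1" "manifold_boundary k M" "B - {e}" 0 U \<psi> by (rule boundary_chart[OF False])
    have ib: "integrable (slice_measure (B - {e})) (\<lambda>x. indicator (model_slice (B - {e}) 0) x * (- F e x))"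
    proof (rule integrable_slice_measure[OF bc.B])
      show "continuous_on UNIV (\<lambda>x. - F e x)" using Ck_on_continuous[OF CF] by (intro continuous_intros)
      show "- F e x = 0" if "norm x > R" for x using supp[OF that] by simp
    qed (rule bc.slice_borel)
    have b1: "Z y \<bullet> y = 0" if "y \<in> manifold_boundary k M" "y \<notin> \<psi> ` U" for y
      using that K(2,3) by (metis inner_zero_left subsetD)
    \<comment> \<open>The conormal is the position vector, and the minus sign of
      \<open>boundary_flux\<close> cancels the one from the lower limit of integration.\<close>
    have b2: "- F e x = (Z (\<psi> x) \<bullet> \<psi> x) * sqrt (gram_det (B - {e}) \<psi> x)"
      if x: "x \<in> U" "x \<in> model_slice (B - {e}) 0" for x
    proof -
      have xs: "x \<in> model_slice B e" "x \<bullet> e = 0" using x(2) boundary_slice[OF False] by auto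
      then have "outward_unit_conormal k M (\<psi> x) (\<psi> x)"
        using con in_boundary_iff[OF x(1) xs(1)] False by blast
      from boundary_flux[OF x(1) xs(1) False xs(2) this]
      show ?thesis using x(1) by (simp add: F_def)
    qed
    have b3: "- F e x = 0" if "x \<notin> U" for x using that by (simp add: F_def)
    note bvol = bc.integral_volume[OF \<sigma> bMb Zb b1 b2 b3 ib]
    have "(LINT x|slice_measure (B - {e}). indicator (model_slice (B - {e}) 0) x * (- F e x)) =
      (LINT x|slice_measure (B - {e}). - F e x)"
    proof (rule integral_cong_AE)
      show "AE x in slice_measure (B - {e}). indicator (model_slice (B - {e}) 0) x * (- F e x) = - F e x"
        using AE_slice_measure[OF bc.B] by eventually_elim (simp add: model_slice_0)
      show "(\<lambda>x. - F e x) \<in> borel_measurable (slice_measure (B - {e}))"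
        using borel_measurable_continuous_onI[OF Ck_on_continuous[OF CF[of e]]] by measurable
    qed (use ib in \<open>simp add: borel_measurable_integrable\<close>)
    then show ?thesis using bvol Lq eB by simp
  qed
  then show "integrable ?\<sigma> (\<lambda>p. Z p \<bullet> p)" "(LINT p|?\<mu>. ?h p) = (LINT p|?\<sigma>. Z p \<bullet> p)" using L by auto
qed

end

text \<open>Each product of Z with a function of the partition has its support in one chart. The
  divergences add up to that of Z on \<open>M\<close> because the products sum to Z on an ambient
  neighbourhood.\<close>

theorem divergence_theorem_minimal:
  assumes M: "minimal_submanifold k M" "compact M"
    and con: "\<And>p. p \<in> manifold_boundary k M \<Longrightarrow> outward_unit_conormal k M p p"
    and Z: "Ck_on 1 UNIV Z"
  shows "integrable (volume_measure k M) (\<lambda>p. indicator M p * submanifold_div M Z p)"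
    and "(LINT p|volume_measure k M. indicator M p * submanifold_div M Z p) =
      (LINT p|volume_measure (k - 1) (manifold_boundary k M). Z p \<bullet> p)"
proof -
  let ?\<mu> = "volume_measure k M" and ?\<sigma> = "volume_measure (k - 1) (manifold_boundary k M)"
  have sM: "submanifold_with_boundary k M" and min: "\<And>p. p \<in> M \<Longrightarrow> mean_curvature M p = 0"
    using M(1) by (auto simp: minimal_submanifold_def)
  have bM: "submanifold_with_boundary (k - 1) (manifold_boundary k M)" "compact (manifold_boundary k M)"
    using submanifold_boundary[OF sM] compact_boundary[OF sM M(2)] by auto
  have \<sigma>: "volume_spec (k - 1) (manifold_boundary k M) ?\<sigma>" by (rule volume_spec_volume_measure[OF bM])
  have bMb: "manifold_boundary k M \<in> sets borel" using bM(2) by (simp add: borel_compact)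
  have "\<forall>p\<in>M. \<exists>W. open W \<and> p \<in> W \<and> (\<exists>B e U \<psi>. chart k M B e U \<psi> \<and> W = \<psi> ` U)"
  proof
    fix p assume "p \<in> M"
    then obtain B e U \<psi> x where c: "chart k M B e U \<psi>" "x \<in> U" "x \<in> model_slice B e" "\<psi> x = p"
      using submanifold_chart[OF sM] by metis
    then show "\<exists>W. open W \<and> p \<in> W \<and> (\<exists>B e U \<psi>. chart k M B e U \<psi> \<and> W = \<psi> ` U)"
      using chart.open_image[OF c(1)] by blast
  qed
  from bchoice[OF this] obtain W where
    "\<forall>p\<in>M. open (W p) \<and> p \<in> W p \<and> (\<exists>B e U \<psi>. chart k M B e U \<psi> \<and> W p = \<psi> ` U)" by (rule exE)
  note W = bspec[OF this]
  obtain P \<rho> K V where P: "finite P" "P \<subseteq> M" "open V" "M \<subseteq> V"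
    and \<rho>: "\<forall>p\<in>P. Ck_on 1 UNIV (\<rho> p) \<and> compact (K p) \<and> K p \<subseteq> W p \<and> (\<forall>y. y \<notin> K p \<longrightarrow> \<rho> p y = (0::real))"
    and sum1: "\<forall>y\<in>V. (\<Sum>p\<in>P. \<rho> p y) = 1"
    by (rule partition_of_unity[OF M(2), of W]) (use W in blast)+
  define Y where "Y p y = \<rho> p y *\<^sub>R Z y" for p y
  have CY: "Ck_on 1 UNIV (Y p)" if "p \<in> P" for p
    unfolding Y_def[abs_def] using \<rho> that Z by (intro Ck_on_scaleR) auto
  have loc: "integrable ?\<mu> (\<lambda>y. indicator M y * submanifold_div M (Y p) y) \<and> integrable ?\<sigma> (\<lambda>y. Y p y \<bullet> y) \<and>
     (LINT y|?\<mu>. indicator M y * submanifold_div M (Y p) y) = (LINT y|?\<sigma>. Y p y \<bullet> y)" if p: "p \<in> P" for p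
  proof -
    obtain B e U \<psi> where c: "chart k M B e U \<psi>" "W p = \<psi> ` U" using W[of p] p P(2) by blast
    then interpret chart k M B e U \<psi> by simp
    have K: "compact (K p)" "K p \<subseteq> \<psi> ` U"
      unfolding c(2)[symmetric] using bspec[OF \<rho> p] by blast+
    have 0: "Y p y = 0" if "y \<notin> K p" for y using \<rho> p that by (simp add: Y_def)
    show ?thesis
      using divergence_theorem_chart[OF sM M(2) min con CY[OF p] K 0] by blast
  qed
  have divsum: "indicator M y * submanifold_div M Z y = (\<Sum>p\<in>P. indicator M y * submanifold_div M (Y p) y)" for y
  proof (cases "y \<in> M")
    case True
    then have yV: "y \<in> V" using P(4) by blast
    have "((\<lambda>y. \<Sum>p\<in>P. Y p y) has_derivative (\<lambda>h. \<Sum>p\<in>P. pd (Y p) h y)) (at y)"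
      by (intro has_derivative_sum Ck_on_has_derivative[OF CY]) auto
    then have dZ: "(Z has_derivative (\<lambda>h. \<Sum>p\<in>P. pd (Y p) h y)) (at y)"
      by (rule has_derivative_transform_within_open[OF _ P(3) yV])
        (use sum1 in \<open>simp add: Y_def scaleR_sum_left[symmetric]\<close>)
    have "pd Z h y = (\<Sum>p\<in>P. pd (Y p) h y)" for h
      by (rule fun_cong[OF frechet_derivative_at[OF dZ, symmetric]])
    then have "submanifold_div M Z y = (\<Sum>i\<in>Basis. \<Sum>p\<in>P. pd (Y p) (i - normal_part M y i) y \<bullet> i)"
      unfolding submanifold_div_def by (simp add: inner_sum_left)
    also have "\<dots> = (\<Sum>p\<in>P. submanifold_div M (Y p) y)"
      unfolding submanifold_div_def by (rule sum.swap)
    finally show ?thesis using True by simp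
  qed simp
  show "integrable ?\<mu> (\<lambda>p. indicator M p * submanifold_div M Z p)"
    unfolding divsum using loc by (intro Bochner_Integration.integrable_sum) blast
  have "(LINT p|?\<mu>. indicator M p * submanifold_div M Z p) = (\<Sum>p\<in>P. LINT y|?\<sigma>. Y p y \<bullet> y)"
    unfolding divsum using loc by (subst Bochner_Integration.integral_sum) auto
  also have "\<dots> = (LINT y|?\<sigma>. (\<Sum>p\<in>P. Y p y \<bullet> y))"
    using loc by (subst Bochner_Integration.integral_sum) auto
  also have "\<dots> = (LINT y|?\<sigma>. Z y \<bullet> y)"
  proof (rule integral_cong_AE)
    show "AE y in ?\<sigma>. (\<Sum>p\<in>P. Y p y \<bullet> y) = Z y \<bullet> y"
      using volume_spec_AE[OF \<sigma> bMb]
    proof eventually_elim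
      case (elim y)
      then have "y \<in> V" using P(4) by (auto simp: manifold_boundary_def)
      then have "(\<Sum>p\<in>P. Y p y) = Z y" using sum1 by (simp add: Y_def scaleR_sum_left[symmetric])
      then show ?case by (metis inner_sum_left)
    qed
    show "(\<lambda>y. \<Sum>p\<in>P. Y p y \<bullet> y) \<in> borel_measurable ?\<sigma>"
      using loc by (intro borel_measurable_sum) (auto simp: borel_measurable_integrable)
    have "continuous_on UNIV (\<lambda>p. Z p \<bullet> p)"
      using Ck_on_continuous[OF Z] by (intro continuous_intros)
    then show "(\<lambda>y. Z y \<bullet> y) \<in> borel_measurable ?\<sigma>"
      using volume_specD(1)[OF \<sigma>] by (simp add: borel_measurable_continuous_onI cong: measurable_cong_sets)
  qed
  finally show "(LINT p|?\<mu>. indicator M p * submanifold_div M Z p) = (LINT p|?\<sigma>. Z p \<bullet> p)" .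
qed

text \<open>The identity part contributes the tangential trace card B = k, and the rank-one part
  contributes k times the squared length of the tangential part of v.\<close>

lemma (in chart) submanifold_div_linear_field:
  assumes x: "x \<in> U" "x \<in> model_slice B e" and v: "norm v = 1"
  shows "submanifold_div M (\<lambda>y. y - (real k * (y \<bullet> v)) *\<^sub>R v) (\<psi> x) = real k * (norm (normal_part M (\<psi> x) v))\<^sup>2"
proof -
  let ?Z = "\<lambda>y. y - (real k * (y \<bullet> v)) *\<^sub>R v"
  have d: "(?Z has_derivative (\<lambda>h. h - (real k * (h \<bullet> v)) *\<^sub>R v)) (at y)" for y
    by (auto intro!: derivative_eq_intros)
  have pdZ: "pd ?Z h y = h - (real k * (h \<bullet> v)) *\<^sub>R v" for h y
    by (rule fun_cong[OF frechet_derivative_at[OF d, symmetric]])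
  have "(?Z has_derivative frechet_derivative ?Z (at (\<psi> x))) (at (\<psi> x))"
    unfolding frechet_derivative_at[OF d, symmetric] by (rule d)
  from submanifold_div_eq[OF x this]
  have "submanifold_div M ?Z (\<psi> x) = (\<Sum>b\<in>B. (pd \<psi> b x - (real k * (pd \<psi> b x \<bullet> v)) *\<^sub>R v) \<bullet> \<nu> b x)"
    unfolding pdZ .
  also have "\<dots> = (\<Sum>b\<in>B. 1) - real k * (\<Sum>b\<in>B. (v \<bullet> \<nu> b x) * (pd \<psi> b x \<bullet> v))"
    unfolding sum_distrib_left sum_subtractf[symmetric]
    by (intro sum.cong refl) (simp add: inner_diff_left inner_commute[of "pd \<psi> _ x" "\<nu> _ x"] nu_dpsi[OF x(1)])
  also have "(\<Sum>b\<in>B. (v \<bullet> \<nu> b x) * (pd \<psi> b x \<bullet> v)) = tang x v \<bullet> v"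
    by (simp add: tang_def inner_sum_left)
  also have "tang x v \<bullet> v = 1 - (norm (nrm x v))\<^sup>2"
  proof -
    have "(norm (nrm x v))\<^sup>2 = v \<bullet> nrm x v"
      using nrm_nrm_inner[OF x(1)] by (simp add: power2_norm_eq_inner)
    also have "\<dots> = v \<bullet> v - tang x v \<bullet> v" by (simp add: nrm_def inner_diff_right inner_commute)
    finally show ?thesis using v by (simp add: dot_square_norm)
  qed
  finally show ?thesis by (simp add: card_B normal_part_eq[OF x] algebra_simps)
qed

text \<open>The divergence theorem for the field \<open>y \<mapsto> y - k (y \<bullet> v) v\<close>, whose divergence along \<open>M\<close> is
  \<open>k |v\<^sup>\<bottom>|\<^sup>2\<close>.\<close>

lemma flux_identity:
  assumes M: "minimal_submanifold k M" "compact M"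
    and con: "\<And>p. p \<in> manifold_boundary k M \<Longrightarrow> outward_unit_conormal k M p p"
    and v: "norm v = 1" and sph: "manifold_boundary k M \<subseteq> sphere 0 1"
  shows "real k * (LINT p:M|volume_measure k M. (norm (normal_part M p v))\<^sup>2) =
    (LINT p|volume_measure (k - 1) (manifold_boundary k M). 1 - real k * (p \<bullet> v)\<^sup>2)"
proof -
  let ?Z = "\<lambda>y. y - (real k * (y \<bullet> v)) *\<^sub>R v"
  let ?\<sigma> = "volume_measure (k - 1) (manifold_boundary k M)"
  have sM: "submanifold_with_boundary k M" using M(1) by (simp add: minimal_submanifold_def)
  have bM: "submanifold_with_boundary (k - 1) (manifold_boundary k M)" "compact (manifold_boundary k M)"
    using submanifold_boundary[OF sM] compact_boundary[OF sM M(2)] by auto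
  have \<sigma>: "volume_spec (k - 1) (manifold_boundary k M) ?\<sigma>" by (rule volume_spec_volume_measure[OF bM])
  have bMb: "manifold_boundary k M \<in> sets borel" using bM(2) by (simp add: borel_compact)
  have Z: "Ck_on 1 UNIV ?Z"
    by (intro Ck_on_diff Ck_on_scaleR Ck_on_mult Ck_on_inner Ck_on_id Ck_on_const open_UNIV)
  have "submanifold_div M ?Z p = real k * (norm (normal_part M p v))\<^sup>2" if pM: "p \<in> M" for p
  proof -
    obtain B e U \<psi> x where c: "chart k M B e U \<psi>" "x \<in> U" "x \<in> model_slice B e" "\<psi> x = p"
      using submanifold_chart[OF sM pM] by metis
    show ?thesis using chart.submanifold_div_linear_field[OF c(1,2,3) v] c(4) by simp
  qed
  then have e: "indicator M p * submanifold_div M ?Z p = real k * (indicator M p *\<^sub>R (norm (normal_part M p v))\<^sup>2)" for p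
    by (auto simp: indicator_def)
  have "real k * (LINT p:M|volume_measure k M. (norm (normal_part M p v))\<^sup>2) =
      (LINT p|volume_measure k M. indicator M p * submanifold_div M ?Z p)"
    unfolding e set_lebesgue_integral_def by (rule integral_mult_right_zero[symmetric])
  also have "\<dots> = (LINT p|?\<sigma>. ?Z p \<bullet> p)" by (rule divergence_theorem_minimal(2)[OF M con Z])
  also have "\<dots> = (LINT p|?\<sigma>. 1 - real k * (p \<bullet> v)\<^sup>2)"
  proof (rule integral_cong_AE)
    show "AE p in ?\<sigma>. ?Z p \<bullet> p = 1 - real k * (p \<bullet> v)\<^sup>2"
      using volume_spec_AE[OF \<sigma> bMb]
    proof eventually_elim
      case (elim p)
      then have "p \<bullet> p = 1" using sph by (auto simp: dot_square_norm)
      then show ?case by (simp add: inner_diff_left power2_eq_square inner_commute[of v p])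
    qed
    show "(\<lambda>p. ?Z p \<bullet> p) \<in> borel_measurable ?\<sigma>" "(\<lambda>p. 1 - real k * (p \<bullet> v)\<^sup>2) \<in> borel_measurable ?\<sigma>"
      using volume_specD(1)[OF \<sigma>]
      by (auto intro!: borel_measurable_continuous_onI continuous_intros cong: measurable_cong_sets)
  qed
  finally show ?thesis .
qed

subsection \<open>Volume of conformal images\<close>

text \<open>\<open>F\<close> is a diffeomorphism between open sets with inverse \<open>G\<close>, so
  its composition with \<psi> is again an ambient chart over the same model slice.\<close>

lemma chart_image:
  assumes "chart k N B e U \<psi>"
    and F: "open H" "open H'" "\<And>n. Ck_on n H F" "\<And>n. Ck_on n H' G"
    and FG: "\<And>x. x \<in> H \<Longrightarrow> F x \<in> H' \<and> G (F x) = x" "\<And>y. y \<in> H' \<Longrightarrow> G y \<in> H \<and> F (G y) = y"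
    and N: "N \<subseteq> H"
  shows "chart k (F ` N) B e (U \<inter> \<psi> -` H) (\<lambda>x. F (\<psi> x))"
proof
  interpret chart k N B e U \<psi> by fact
  let ?U = "U \<inter> \<psi> -` H" and ?F = "\<lambda>x. F (\<psi> x)"
  have U0: "open ?U"
    by (intro continuous_open_preimage Ck_on_continuous[OF Ck_psi[of 0]] open_U F(1))
  have im: "?F ` ?U = H' \<inter> G -` (\<psi> ` U)"
  proof (intro equalityI subsetI)
    fix y assume "y \<in> H' \<inter> G -` (\<psi> ` U)"
    then obtain x where x: "y \<in> H'" "x \<in> U" "G y = \<psi> x" by auto
    then have "\<psi> x \<in> H" "F (\<psi> x) = y" using FG(2)[of y] by auto
    then show "y \<in> ?F ` ?U" using x(2) by (intro image_eqI[of _ _ x]) auto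
  next
    fix y assume "y \<in> ?F ` ?U"
    then obtain x where x: "y = F (\<psi> x)" "x \<in> ?U" by (rule imageE)
    then have "\<psi> x \<in> H" by blast
    from FG(1)[OF this] have "F (\<psi> x) \<in> H'" "G (F (\<psi> x)) = \<psi> x" by simp_all
    then show "y \<in> H' \<inter> G -` (\<psi> ` U)" using x by simp
  qed
  have op: "open (?F ` ?U)"
    unfolding im by (intro continuous_open_preimage Ck_on_continuous[OF F(4)[of 0]] F(2) open_image)
  have inj': "inj_on ?F ?U"
  proof (rule inj_onI)
    fix x y assume xy: "x \<in> ?U" "y \<in> ?U" "F (\<psi> x) = F (\<psi> y)"
    have "\<psi> x = G (F (\<psi> x))" using FG(1)[of "\<psi> x"] xy(1) by simp
    also have "\<dots> = G (F (\<psi> y))" by (simp only: xy(3))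
    also have "\<dots> = \<psi> y" using FG(1)[of "\<psi> y"] xy(2) by simp
    finally show "x = y" using xy inj by (auto dest: inj_onD)
  qed
  have sm: "smooth_on ?U ?F"
    unfolding smooth_on_def
    by (intro allI Ck_on_compose[OF U0 F(1) Ck_on_subset[OF Ck_psi] F(3)]) auto
  have sm': "smooth_on (?F ` ?U) (inv_into ?U ?F)"
    unfolding smooth_on_def
  proof
    fix n
    have "Ck_on n (?F ` ?U) (\<lambda>y. \<phi> (G y))"
      by (rule Ck_on_compose[OF op open_image Ck_on_subset[OF F(4)] Ck_phi]) (auto simp: im)
    then show "Ck_on n (?F ` ?U) (inv_into ?U ?F)"
    proof (rule Ck_on_cong[OF op, rotated])
      fix y assume "y \<in> ?F ` ?U"
      then obtain x where x: "x \<in> ?U" "y = F (\<psi> x)" by blast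
      then show "\<phi> (G y) = inv_into ?U ?F y"
        using inv_into_f_f[OF inj' x(1)] FG(1)[of "\<psi> x"] by simp
    qed
  qed
  have "F ` N \<inter> ?F ` ?U = ?F ` (?U \<inter> model_slice B e)"
  proof (intro equalityI subsetI)
    fix y assume "y \<in> F ` N \<inter> ?F ` ?U"
    then obtain p x where px: "p \<in> N" "y = F p" "x \<in> ?U" "y = F (\<psi> x)" by blast
    then have "p = \<psi> x" using FG(1)[of p] FG(1)[of "\<psi> x"] N by (metis Int_iff subsetD vimage_eq)
    then show "y \<in> ?F ` (?U \<inter> model_slice B e)" using px in_M_imp_slice[of x] by blast
  next
    fix y assume "y \<in> ?F ` (?U \<inter> model_slice B e)"
    then show "y \<in> F ` N \<inter> ?F ` ?U" using in_M_iff by blast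
  qed
  then show "slice_chart k (F ` N) B e ?U ?F"
    unfolding slice_chart_def using B card_B e U0 op inj' sm sm' by blast
qed

lemma gram_det_conformal:
  assumes "finite B"
    and "\<And>b c. b \<in> B \<Longrightarrow> c \<in> B \<Longrightarrow> pd \<psi>1 b x \<bullet> pd \<psi>1 c x = l\<^sup>2 * (pd \<psi>2 b x \<bullet> pd \<psi>2 c x)"
  shows "gram_det B \<psi>1 x = (l ^ card B)\<^sup>2 * gram_det B \<psi>2 x"
proof -
  have "(\<Prod>b\<in>B. pd \<psi>1 b x \<bullet> pd \<psi>1 (\<pi> b) x) = (l ^ card B)\<^sup>2 * (\<Prod>b\<in>B. pd \<psi>2 b x \<bullet> pd \<psi>2 (\<pi> b) x)"
    if "\<pi> permutes B" for \<pi>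
  proof -
    have "(\<Prod>b\<in>B. pd \<psi>1 b x \<bullet> pd \<psi>1 (\<pi> b) x) = (\<Prod>b\<in>B. l\<^sup>2 * (pd \<psi>2 b x \<bullet> pd \<psi>2 (\<pi> b) x))"
      using assms(2) permutes_in_image[OF that] by (intro prod.cong) auto
    then show ?thesis by (simp add: prod.distrib power_mult[symmetric] mult.commute)
  qed
  then show ?thesis
    unfolding gram_det_def sum_distrib_left by (intro sum.cong) (auto simp: mult_ac)
qed

lemma volume_measure_conformal:
  fixes F G :: "'a::euclidean_space \<Rightarrow> 'a" and l :: "'a \<Rightarrow> real"
  assumes N: "submanifold_with_boundary m N" "compact N"
    and F: "open H" "open H'" "\<And>n. Ck_on n H F" "\<And>n. Ck_on n H' G"
    and FG: "\<And>x. x \<in> H \<Longrightarrow> F x \<in> H' \<and> G (F x) = x" "\<And>y. y \<in> H' \<Longrightarrow> G y \<in> H \<and> F (G y) = y"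
    and NH: "N \<subseteq> H"
    and meas: "F \<in> borel_measurable borel" "l \<in> borel_measurable borel"
    and l: "\<And>p. p \<in> N \<Longrightarrow> l p > 0"
    and conf: "\<And>p u w. p \<in> N \<Longrightarrow> u \<in> tangent_space N p \<Longrightarrow> w \<in> tangent_space N p \<Longrightarrow>
      pd F u p \<bullet> pd F w p = (l p)\<^sup>2 * (u \<bullet> w)"
  shows "submanifold_volume m (F ` N) = (LINT p|volume_measure m N. l p ^ m)"
proof -
  note [measurable] = meas
  let ?\<mu> = "volume_measure m N"
  have \<mu>: "volume_spec m N ?\<mu>" by (rule volume_spec_volume_measure[OF N])
  note [measurable_cong] = volume_specD(1)[OF \<mu>]
  have Nb [measurable]: "N \<in> sets borel" using N(2) by (simp add: borel_compact)
  have FN: "compact (F ` N)"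
    by (intro compact_continuous_image N(2) continuous_on_subset[OF Ck_on_continuous[OF F(3)[of 0]] NH])
  then have FNb [measurable]: "F ` N \<in> sets borel" by (simp add: borel_compact)
  have FNH': "F ` N \<subseteq> H'" using NH FG(1) by auto
  have GFN: "G ` (F ` N) = N" using NH FG(1) by (force simp: image_image)
  have sFN: "submanifold_with_boundary m (F ` N)"
    unfolding submanifold_with_boundary_def
  proof
    fix q assume "q \<in> F ` N"
    then obtain p where p: "p \<in> N" "q = F p" by blast
    obtain B e U \<psi> x where c: "chart m N B e U \<psi>" "x \<in> U" "x \<in> model_slice B e" "\<psi> x = p"
      using submanifold_chart[OF N(1) p(1)] by metis
    have "slice_chart m (F ` N) B e (U \<inter> \<psi> -` H) (\<lambda>x. F (\<psi> x))"
      using chart_image[OF c(1) F FG NH] unfolding chart_def .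
    moreover have "q \<in> (\<lambda>x. F (\<psi> x)) ` (U \<inter> \<psi> -` H)" using c p NH by blast
    ultimately show "\<exists>B e U \<psi>. slice_chart m (F ` N) B e U \<psi> \<and> q \<in> \<psi> ` U" by blast
  qed
  define \<rho> where "\<rho> = distr (density ?\<mu> (\<lambda>p. ennreal (l p ^ m))) borel F"
  have em\<rho>: "emeasure \<rho> A = (\<integral>\<^sup>+p. ennreal (l p ^ m) * indicator (N \<inter> F -` A) p \<partial>?\<mu>)" if A [measurable]: "A \<in> sets borel" for A
  proof -
    have FA: "F -` A \<in> sets borel" using measurable_sets_borel[OF meas(1) A] .
    have "emeasure \<rho> A = emeasure (density ?\<mu> (\<lambda>p. ennreal (l p ^ m))) (F -` A)"
      unfolding \<rho>_def using sets_eq_imp_space_eq[OF volume_specD(1)[OF \<mu>]] by (subst emeasure_distr) auto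
    also have "\<dots> = (\<integral>\<^sup>+p. ennreal (l p ^ m) * indicator (F -` A) p \<partial>?\<mu>)"
      using FA volume_specD(1)[OF \<mu>] by (intro emeasure_density) auto
    also have "\<dots> = (\<integral>\<^sup>+p. ennreal (l p ^ m) * indicator (N \<inter> F -` A) p \<partial>?\<mu>)"
      using volume_spec_AE[OF \<mu> Nb] by (intro nn_integral_cong_AE, eventually_elim) (auto simp: indicator_def)
    finally show ?thesis .
  qed
  have "volume_spec m (F ` N) \<rho>"
    unfolding volume_spec_def
  proof (intro conjI allI impI ballI)
    show "sets \<rho> = sets borel" by (simp add: \<rho>_def)
    have "N \<inter> F -` (- F ` N) = {}" by auto
    then show "emeasure \<rho> (- F ` N) = 0" using em\<rho>[of "- F ` N"] by simp
    fix B e U \<chi>1 A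
    assume c: "slice_chart m (F ` N) B e U \<chi>1" and A: "A \<in> sets borel" "A \<subseteq> F ` N \<inter> \<chi>1 ` U"
    interpret c: chart m "F ` N" B e U \<chi>1 using c by unfold_locales
    let ?U = "U \<inter> \<chi>1 -` H'" and ?G = "\<lambda>x. G (\<chi>1 x)"
    have "chart m (G ` (F ` N)) B e ?U ?G"
      using chart_image[OF c.chart_axioms F(2,1) F(4,3) FG(2,1) FNH'] .
    then interpret c': chart m N B e ?U ?G unfolding GFN .
    have A': "N \<inter> F -` A \<in> sets borel" using Nb measurable_sets_borel[OF meas(1) A(1)] by auto
    have sub: "N \<inter> F -` A \<subseteq> N \<inter> ?G ` ?U"
    proof
      fix p assume p: "p \<in> N \<inter> F -` A"
      then obtain x where x: "x \<in> U" "F p = \<chi>1 x" using A(2) by auto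
      then have "x \<in> ?U" "p = ?G x" using p NH FG(1)[of p] by auto
      then show "p \<in> N \<inter> ?G ` ?U" using p by blast
    qed
    have gram: "l (?G x) ^ m * sqrt (gram_det B ?G x) = sqrt (gram_det B \<chi>1 x)" if x: "x \<in> ?U" "?G x \<in> N" for x
    proof -
      have xs: "x \<in> model_slice B e" by (rule c'.in_M_imp_slice[OF x])
      have dF: "(F has_derivative frechet_derivative F (at (?G x))) (at (?G x))"
        using Ck_on_has_derivative[OF F(3)[of 1], of "?G x"] x NH by auto
      have "(\<chi>1 has_derivative (\<lambda>h. pd F (pd ?G h x) (?G x))) (at x)"
      proof (rule has_derivative_transform_within_open[OF _ c'.open_U x(1)])
        show "((\<lambda>x. F (?G x)) has_derivative (\<lambda>h. pd F (pd ?G h x) (?G x))) (at x)"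
          by (rule has_derivative_compose[OF c'.has_derivative_psi[OF x(1)] dF])
        show "F (?G y) = \<chi>1 y" if "y \<in> ?U" for y using that FG(2)[of "\<chi>1 y"] by auto
      qed
      then have d: "pd \<chi>1 h x = pd F (pd ?G h x) (?G x)" for h
        by (rule fun_cong[OF frechet_derivative_at, symmetric])
      have T: "pd ?G b x \<in> tangent_space N (?G x)" if "b \<in> B" for b
        unfolding c'.tangent_space_eq[OF x(1) xs] using that by (auto intro: span_base)
      have "gram_det B \<chi>1 x = (l (?G x) ^ card B)\<^sup>2 * gram_det B ?G x"
        by (rule gram_det_conformal[OF c.finite_B]) (simp add: d conf[OF x(2) T T])
      then show ?thesis using l[OF x(2)] c.card_B by (simp add: real_sqrt_mult)
    qed
    have "emeasure \<rho> A = (\<integral>\<^sup>+p. ennreal (l p ^ m) * indicator (N \<inter> F -` A) p \<partial>?\<mu>)" by (rule em\<rho>[OF A(1)])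
    also have "\<dots> = (\<integral>\<^sup>+x. ennreal (l (?G x) ^ m) * ennreal (sqrt (gram_det B ?G x)) *
        indicator (?U \<inter> ?G -` (N \<inter> F -` A)) x \<partial>slice_measure B)"
      by (rule c'.nn_integral_volume[OF \<mu> Nb _ A' sub]) measurable
    also have "\<dots> = (\<integral>\<^sup>+x. ennreal (sqrt (gram_det B \<chi>1 x)) * indicator (U \<inter> \<chi>1 -` A) x \<partial>slice_measure B)"
    proof (intro nn_integral_cong)
      fix x
      have iff: "x \<in> ?U \<inter> ?G -` (N \<inter> F -` A) \<longleftrightarrow> x \<in> U \<inter> \<chi>1 -` A"
      proof
        assume "x \<in> U \<inter> \<chi>1 -` A"
        then have "\<chi>1 x \<in> F ` N" "\<chi>1 x \<in> A" "x \<in> U" using A(2) by auto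
        moreover from this have "\<chi>1 x \<in> H'" "?G x \<in> N" using FNH' GFN by blast+
        ultimately show "x \<in> ?U \<inter> ?G -` (N \<inter> F -` A)" using FG(2)[of "\<chi>1 x"] by auto
      qed (use FG(2) in auto)
      show "ennreal (l (?G x) ^ m) * ennreal (sqrt (gram_det B ?G x)) * indicator (?U \<inter> ?G -` (N \<inter> F -` A)) x =
        ennreal (sqrt (gram_det B \<chi>1 x)) * indicator (U \<inter> \<chi>1 -` A) x"
      proof (cases "x \<in> ?U \<inter> ?G -` (N \<inter> F -` A)")
        case True
        then have x: "x \<in> ?U" "?G x \<in> N" by auto
        have "ennreal (l (?G x) ^ m) * ennreal (sqrt (gram_det B ?G x)) = ennreal (sqrt (gram_det B \<chi>1 x))"
          unfolding gram[OF x, symmetric] using l[OF x(2)] by (intro ennreal_mult'[symmetric]) simp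
        then show ?thesis using True iff by simp
      next
        case False
        then have "x \<notin> U \<inter> \<chi>1 -` A" using iff by blast
        then have "indicator (U \<inter> \<chi>1 -` A) x = (0 :: ennreal)" by (rule indicator_simps(2))
        moreover have "indicator (?U \<inter> ?G -` (N \<inter> F -` A)) x = (0 :: ennreal)"
          using False by (rule indicator_simps(2))
        ultimately show ?thesis by (simp only: mult_zero_right)
      qed
    qed
    finally show "emeasure \<rho> A = (\<integral>\<^sup>+x. ennreal (sqrt (gram_det B \<chi>1 x)) * indicator (U \<inter> \<chi>1 -` A) x \<partial>slice_measure B)" .
  qed
  then have "volume_measure m (F ` N) = \<rho>" by (rule volume_measure_eqI[OF sFN FN])
  then have "submanifold_volume m (F ` N) = enn2real (\<integral>\<^sup>+p. ennreal (l p ^ m) * indicator (N \<inter> F -` (F ` N)) p \<partial>?\<mu>)"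
    by (simp add: submanifold_volume_def measure_def em\<rho>)
  also have "(\<integral>\<^sup>+p. ennreal (l p ^ m) * indicator (N \<inter> F -` (F ` N)) p \<partial>?\<mu>) = (\<integral>\<^sup>+p. ennreal (l p ^ m) \<partial>?\<mu>)"
    using volume_spec_AE[OF \<mu> Nb] by (intro nn_integral_cong_AE, eventually_elim) (auto simp: indicator_def)
  also have "enn2real \<dots> = (LINT p|?\<mu>. l p ^ m)"
  proof (rule integral_eq_nn_integral[symmetric])
    show "AE p in ?\<mu>. 0 \<le> l p ^ m"
      using volume_spec_AE[OF \<mu> Nb] by eventually_elim (use l in \<open>simp add: less_imp_le\<close>)
  qed measurable
  finally show ?thesis .
qed

text \<open>Differentiate \<psi> \<bullet> \<psi> = 1, which holds on the slice, in slice
  directions.\<close>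

lemma tangent_space_sphere:
  assumes N: "submanifold_with_boundary m N" "N \<subseteq> sphere 0 1" and p: "p \<in> N" and u: "u \<in> tangent_space N p"
  shows "p \<bullet> u = 0"
proof -
  obtain B e U \<psi> x where c: "chart m N B e U \<psi>" "x \<in> U" "x \<in> model_slice B e" "\<psi> x = p"
    using submanifold_chart[OF N(1) p] by metis
  then interpret chart m N B e U \<psi> by simp
  obtain w where w: "w \<in> span B" "u = d\<psi> x w"
    using u unfolding c(4)[symmetric] tangent_space_eq[OF c(2,3)] by blast
  have d: "((\<lambda>x. \<psi> x \<bullet> \<psi> x) has_derivative (\<lambda>h. \<psi> x \<bullet> d\<psi> x h + d\<psi> x h \<bullet> \<psi> x)) (at x)"
    by (intro has_derivative_inner has_derivative_psi c(2))
  have "\<psi> z \<bullet> \<psi> z = 1" if "z \<in> U" "z \<in> model_slice B e" for z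
  proof -
    have "\<psi> z \<in> sphere 0 1" using in_M_iff[OF that(1)] that(2) N(2) by blast
    then show ?thesis by (simp add: dot_square_norm)
  qed
  from derivative_zero_on_slice[OF c(2) open_U c(3) d this w(1)]
  show ?thesis using w(2) c(4) by (simp add: inner_commute)
qed

subsection \<open>The conformal flow\<close>

text \<open>The time component of the boosted null vector (1, x). Its reciprocal is the conformal
  factor on the sphere.\<close>

definition boost_den :: "'a::euclidean_space \<Rightarrow> real \<Rightarrow> 'a \<Rightarrow> real" where
  "boost_den v t x = cosh t + sinh t * (x \<bullet> v)"

text \<open>The Lorentz boost in the direction \<open>v\<close>, in projective coordinates.\<close>

definition boost :: "'a::euclidean_space \<Rightarrow> real \<Rightarrow> 'a \<Rightarrow> 'a" where
  "boost v t x = inverse (boost_den v t x) *\<^sub>R (x + (sinh t + (cosh t - 1) * (x \<bullet> v)) *\<^sub>R v)"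

lemma cosh_add_sinh_pos: "\<bar>s\<bar> \<le> 1 \<Longrightarrow> cosh t + sinh t * s > (0::real)"
proof -
  assume s: "\<bar>s\<bar> \<le> 1"
  have "\<bar>sinh t\<bar> < cosh t"
    using sinh_less_cosh_real[of t] sinh_less_cosh_real[of "- t"] by (simp add: abs_less_iff)
  moreover have "\<bar>sinh t * s\<bar> \<le> \<bar>sinh t\<bar>" using s by (simp add: abs_mult mult_left_le)
  ultimately show ?thesis by linarith
qed

context
  fixes v :: "'a::euclidean_space"
  assumes v: "norm v = 1"
begin

lemma vv: "v \<bullet> v = 1" using v by (simp add: dot_square_norm)

lemma sphere_inner_le: "x \<in> sphere 0 1 \<Longrightarrow> \<bar>x \<bullet> v\<bar> \<le> 1"
  using Cauchy_Schwarz_ineq2[of x v] v by simp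

lemma boost_den_pos: "x \<in> sphere 0 1 \<Longrightarrow> boost_den v t x > 0"
  unfolding boost_den_def by (intro cosh_add_sinh_pos sphere_inner_le)

lemma boost_inner: "boost v t x \<bullet> v = (sinh t + cosh t * (x \<bullet> v)) / boost_den v t x"
  by (simp add: boost_def inner_add_left vv divide_inverse algebra_simps)

text \<open>Makes the boost by t and the boost by -t inverse maps between the open sets on which
  their denominators are positive.\<close>

lemma boost_den_boost:
  assumes "boost_den v t x \<noteq> 0"
  shows "boost_den v (- t) (boost v t x) = inverse (boost_den v t x)"
proof -
  have "boost_den v (- t) (boost v t x) = (cosh t * boost_den v t x - sinh t * (sinh t + cosh t * (x \<bullet> v))) / boost_den v t x"
    using assms by (subst boost_den_def) (simp add: boost_inner diff_divide_distrib)
  also have "cosh t * boost_den v t x - sinh t * (sinh t + cosh t * (x \<bullet> v)) = (cosh t)\<^sup>2 - (sinh t)\<^sup>2"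
    by (simp add: boost_den_def power2_eq_square algebra_simps)
  finally show ?thesis by (simp add: cosh_square_eq divide_inverse)
qed

lemma boost_inverse:
  assumes D: "boost_den v t x \<noteq> 0"
  shows "boost v (- t) (boost v t x) = x"
proof -
  let ?D = "boost_den v t x" and ?c = "cosh t" and ?s = "sinh t" and ?a = "x \<bullet> v"
  have "(- ?s + (?c - 1) * ((?s + ?c * ?a) / ?D)) = - inverse ?D * (?s + (?c - 1) * ?a)"
  proof -
    have "- ?s * ?D + (?c - 1) * (?s + ?c * ?a) = - (?s + (?c - 1) * ?a) + (?c\<^sup>2 - ?s\<^sup>2 - 1) * ?a"
      by (simp add: boost_den_def power2_eq_square algebra_simps)
    then have "- ?s * ?D + (?c - 1) * (?s + ?c * ?a) = - (?s + (?c - 1) * ?a)"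
      by (simp add: cosh_square_eq)
    then show ?thesis using D by (simp add: field_simps)
  qed
  then have "boost v t x + (- ?s + (?c - 1) * (boost v t x \<bullet> v)) *\<^sub>R v = inverse ?D *\<^sub>R x"
    by (simp add: boost_inner) (simp add: boost_def scaleR_add_right)
  then show ?thesis
    unfolding boost_def[of v "- t"] boost_den_boost[OF D] using D by simp
qed

text \<open>A Lorentz map preserves the light cone: the squared norm of the numerator equals the
  square of the denominator, by cosh^2 - sinh^2 = 1.\<close>

lemma norm_boost:
  assumes x: "x \<in> sphere 0 1"
  shows "norm (boost v t x) = 1"
proof -
  let ?D = "boost_den v t x" and ?c = "cosh t" and ?s = "sinh t" and ?a = "x \<bullet> v"
  let ?N = "x + (?s + (?c - 1) * ?a) *\<^sub>R v"
  have xx: "x \<bullet> x = 1" using x by (simp add: dot_square_norm)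
  have "?N \<bullet> ?N = 1 + 2 * (?s + (?c - 1) * ?a) * ?a + (?s + (?c - 1) * ?a)\<^sup>2"
    by (simp add: inner_add_left inner_add_right xx vv inner_commute[of v x] power2_eq_square algebra_simps)
  also have "\<dots> = ?D\<^sup>2 + (1 + ?s\<^sup>2 - ?c\<^sup>2) + (?c\<^sup>2 - 1 - ?s\<^sup>2) * ?a\<^sup>2"
    by (simp add: boost_den_def power2_eq_square algebra_simps)
  finally have "(norm ?N)\<^sup>2 = ?D\<^sup>2" by (simp add: power2_norm_eq_inner cosh_square_eq)
  then have "norm ?N = ?D" using boost_den_pos[OF x, of t] by (simp add: power2_eq_iff_nonneg less_imp_le)
  then show ?thesis using boost_den_pos[OF x, of t] by (simp add: boost_def)
qed

text \<open>The numerator has derivative D v and the denominator D has derivative D times boost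
  \<bullet> v, so the quotient rule yields v - (boost \<bullet> v) boost.\<close>

lemma has_vector_derivative_boost:
  assumes x: "x \<in> sphere 0 1"
  shows "((\<lambda>t. boost v t x) has_vector_derivative sphere_gradient v (boost v t x)) (at t)"
proof -
  let ?D = "boost_den v t x" and ?a = "x \<bullet> v"
  let ?N = "\<lambda>t. x + (sinh t + (cosh t - 1) * ?a) *\<^sub>R v"
  have D: "?D \<noteq> 0" using boost_den_pos[OF x, of t] by simp
  have 1: "((\<lambda>t. boost_den v t x) has_real_derivative (sinh t + cosh t * ?a)) (at t)"
    unfolding boost_den_def by (auto intro!: derivative_eq_intros)
  have 2: "((\<lambda>t. inverse (boost_den v t x)) has_real_derivative - ((sinh t + cosh t * ?a) / ?D\<^sup>2)) (at t)"
    using DERIV_inverse_fun[OF 1 D] by (simp add: divide_inverse power2_eq_square mult.commute)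
  have 3: "((\<lambda>t. sinh t + (cosh t - 1) * ?a) has_real_derivative ?D) (at t)"
    unfolding boost_den_def by (auto intro!: derivative_eq_intros)
  have 4: "(?N has_vector_derivative ?D *\<^sub>R v) (at t)"
    using has_vector_derivative_add[OF has_vector_derivative_const has_vector_derivative_scaleR[OF 3 has_vector_derivative_const], of x v] by simp
  have "((\<lambda>t. inverse (boost_den v t x) *\<^sub>R ?N t) has_vector_derivative
      inverse ?D *\<^sub>R (?D *\<^sub>R v) + (- ((sinh t + cosh t * ?a) / ?D\<^sup>2)) *\<^sub>R ?N t) (at t)"
    by (rule has_vector_derivative_scaleR[OF 2 4])
  moreover have "inverse ?D *\<^sub>R (?D *\<^sub>R v) + (- ((sinh t + cosh t * ?a) / ?D\<^sup>2)) *\<^sub>R ?N t = sphere_gradient v (boost v t x)"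
    using D unfolding sphere_gradient_def boost_inner
    by (simp add: boost_def[of v t x] divide_inverse power2_eq_square)
  ultimately show ?thesis by (simp add: boost_def)
qed

text \<open>Uniqueness by a Gronwall argument. The function \<alpha>, half the squared distance of
  the two trajectories on the sphere, satisfies a linear differential equation with bounded
  coefficient and vanishes at time 0.\<close>

lemma flow_eq_boost:
  assumes f: "flow_on (sphere 0 1) (sphere_gradient v) f" and x: "x \<in> sphere 0 1"
  shows "f t x = boost v t x"
proof -
  define \<alpha> where "\<alpha> t = 1 - f t x \<bullet> boost v t x" for t
  have fs: "f t x \<in> sphere 0 1" and df: "((\<lambda>s. f s x) has_vector_derivative sphere_gradient v (f t x)) (at t)"
    and f0: "f 0 x = x" for t using f x unfolding flow_on_def by auto
  have bs: "boost v t x \<in> sphere 0 1" for t using norm_boost[OF x] by simp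
  have \<alpha>nn: "\<alpha> t \<ge> 0" for t
    using norm_cauchy_schwarz[of "f t x" "boost v t x"] fs[of t] bs[of t] by (simp add: \<alpha>_def)
  have d\<alpha>: "(\<alpha> has_real_derivative - (f t x \<bullet> v + boost v t x \<bullet> v) * \<alpha> t) (at t)" for t
  proof -
    have "((\<lambda>t. f t x \<bullet> boost v t x) has_vector_derivative
       (f t x \<bullet> sphere_gradient v (boost v t x) + sphere_gradient v (f t x) \<bullet> boost v t x)) (at t)"
      using bounded_bilinear.has_vector_derivative[OF bounded_bilinear_inner df has_vector_derivative_boost[OF x]] .
    then have "(\<alpha> has_real_derivative - (f t x \<bullet> sphere_gradient v (boost v t x) + sphere_gradient v (f t x) \<bullet> boost v t x)) (at t)"
      unfolding \<alpha>_def[abs_def] has_real_derivative_iff_has_vector_derivative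
      using has_vector_derivative_diff[OF has_vector_derivative_const[of 1]] by fastforce
    moreover have "- (f t x \<bullet> sphere_gradient v (boost v t x) + sphere_gradient v (f t x) \<bullet> boost v t x)
        = - (f t x \<bullet> v + boost v t x \<bullet> v) * \<alpha> t"
      by (simp add: sphere_gradient_def \<alpha>_def inner_diff_left inner_diff_right inner_commute[of v] algebra_simps)
    ultimately show ?thesis by simp
  qed
  \<comment> \<open>The bound 2 makes exp(-2t) \<alpha> nonincreasing and exp(2t) \<alpha>
    nondecreasing; with \<alpha> 0 = 0 this gives \<alpha> \<le> 0 on both sides of time 0.\<close>
  have coef: "\<bar>f t x \<bullet> v + boost v t x \<bullet> v\<bar> \<le> 2" for t
    using sphere_inner_le[OF fs[of t]] sphere_inner_le[OF bs[of t]] by linarith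
  have "\<alpha> 0 = 0" using f0 x by (simp add: \<alpha>_def boost_def boost_den_def dot_square_norm)
  have "\<alpha> t = 0"
  proof (cases "0 \<le> t")
    case True
    have "\<exists>y. ((\<lambda>t. exp (- 2 * t) * \<alpha> t) has_real_derivative y) (at s) \<and> y \<le> 0" for s
    proof (intro exI conjI)
      show "((\<lambda>t. exp (- 2 * t) * \<alpha> t) has_real_derivative
          exp (- 2 * s) * (- (f s x \<bullet> v + boost v s x \<bullet> v) * \<alpha> s) + exp (- 2 * s) * (- 2) * \<alpha> s) (at s)"
        by (auto intro!: derivative_eq_intros d\<alpha>)
      have "(- (f s x \<bullet> v + boost v s x \<bullet> v) - 2) * \<alpha> s \<le> 0"
        using coef[of s] \<alpha>nn[of s] by (intro mult_nonpos_nonneg) linarith+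
      then have "exp (- 2 * s) * ((- (f s x \<bullet> v + boost v s x \<bullet> v) - 2) * \<alpha> s) \<le> 0"
        by (rule mult_nonneg_nonpos[OF less_imp_le[OF exp_gt_zero]])
      then show "exp (- 2 * s) * (- (f s x \<bullet> v + boost v s x \<bullet> v) * \<alpha> s) + exp (- 2 * s) * (- 2) * \<alpha> s \<le> 0"
        by (simp add: algebra_simps)
    qed
    then have "exp (- 2 * t) * \<alpha> t \<le> exp (- 2 * 0) * \<alpha> 0"
      by (intro DERIV_nonpos_imp_nonincreasing[OF True]) auto
    then have "\<alpha> t \<le> 0" using \<open>\<alpha> 0 = 0\<close> by (simp add: mult_le_0_iff)
    then show ?thesis using \<alpha>nn[of t] by simp
  next
    case False
    then have t: "t \<le> 0" by simp
    have "\<exists>y. ((\<lambda>t. exp (2 * t) * \<alpha> t) has_real_derivative y) (at s) \<and> 0 \<le> y" for s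
    proof (intro exI conjI)
      show "((\<lambda>t. exp (2 * t) * \<alpha> t) has_real_derivative
          exp (2 * s) * (- (f s x \<bullet> v + boost v s x \<bullet> v) * \<alpha> s) + exp (2 * s) * 2 * \<alpha> s) (at s)"
        by (auto intro!: derivative_eq_intros d\<alpha>)
      have "0 \<le> (- (f s x \<bullet> v + boost v s x \<bullet> v) + 2) * \<alpha> s"
        using coef[of s] \<alpha>nn[of s] by (intro mult_nonneg_nonneg) linarith+
      then have "0 \<le> exp (2 * s) * ((- (f s x \<bullet> v + boost v s x \<bullet> v) + 2) * \<alpha> s)"
        by (rule mult_nonneg_nonneg[OF less_imp_le[OF exp_gt_zero]])
      then show "0 \<le> exp (2 * s) * (- (f s x \<bullet> v + boost v s x \<bullet> v) * \<alpha> s) + exp (2 * s) * 2 * \<alpha> s"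
        by (simp add: algebra_simps)
    qed
    then have "exp (2 * t) * \<alpha> t \<le> exp (2 * 0) * \<alpha> 0"
      by (intro DERIV_nonneg_imp_nondecreasing[OF t]) auto
    then have "\<alpha> t \<le> 0" using \<open>\<alpha> 0 = 0\<close> by (simp add: mult_le_0_iff)
    then show ?thesis using \<alpha>nn[of t] by simp
  qed
  then have "f t x \<bullet> boost v t x = 1" by (simp add: \<alpha>_def)
  moreover have "(f t x - boost v t x) \<bullet> (f t x - boost v t x) =
      f t x \<bullet> f t x - 2 * (f t x \<bullet> boost v t x) + boost v t x \<bullet> boost v t x"
    by (simp add: inner_diff_left inner_diff_right inner_commute)
  moreover have "f t x \<bullet> f t x = 1" "boost v t x \<bullet> boost v t x = 1"
    using fs[of t] bs[of t] by (simp_all add: dot_square_norm)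
  ultimately have "(f t x - boost v t x) \<bullet> (f t x - boost v t x) = 0" by linarith
  then show ?thesis by simp
qed

text \<open>With N the numerator and w h its derivative, |N|^2 = D^2 and, for h tangent to the
  sphere, w h \<bullet> N = sinh t (h \<bullet> v) D. In the expanded product the contributions
  quadratic in sinh t cancel and D^-2 times h \<bullet> h' remains.\<close>

lemma boost_conformal:
  assumes x: "x \<in> sphere 0 1" and h: "x \<bullet> h = 0" "x \<bullet> h' = 0"
  shows "pd (boost v t) h x \<bullet> pd (boost v t) h' x = (inverse (boost_den v t x))\<^sup>2 * (h \<bullet> h')"
proof -
  let ?D = "boost_den v t x" and ?c = "cosh t" and ?s = "sinh t" and ?a = "x \<bullet> v"
  let ?m = "?s + (?c - 1) * ?a"
  let ?N = "x + ?m *\<^sub>R v"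
  define w where "w h = h + ((?c - 1) * (h \<bullet> v)) *\<^sub>R v" for h
  have D: "?D \<noteq> 0" using boost_den_pos[OF x, of t] by simp
  have pdb: "pd (boost v t) h x = inverse ?D *\<^sub>R (w h - (?s * (h \<bullet> v) * inverse ?D) *\<^sub>R ?N)" for h
  proof -
    have 1: "((\<lambda>x. boost_den v t x) has_derivative (\<lambda>h. ?s * (h \<bullet> v))) (at x)"
      unfolding boost_den_def by (auto intro!: derivative_eq_intros)
    have 2: "((\<lambda>x. x + (?s + (?c - 1) * (x \<bullet> v)) *\<^sub>R v) has_derivative w) (at x)"
      unfolding w_def[abs_def] by (auto intro!: derivative_eq_intros)
    have "(boost v t has_derivative (\<lambda>h. inverse ?D *\<^sub>R w h + (- (inverse ?D * (?s * (h \<bullet> v)) * inverse ?D)) *\<^sub>R ?N)) (at x)"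
      unfolding boost_def[abs_def] by (rule has_derivative_scaleR[OF Deriv.has_derivative_inverse[OF D 1] 2])
    from fun_cong[OF frechet_derivative_at[OF this, symmetric], of h]
    show ?thesis by (simp add: scaleR_diff_right mult_ac)
  qed
  have xx: "x \<bullet> x = 1" using x by (simp add: dot_square_norm)
  have c2: "?c\<^sup>2 = ?s\<^sup>2 + 1" by (rule cosh_square_eq)
  have NN: "?N \<bullet> ?N = ?D\<^sup>2"
  proof -
    have "?N \<bullet> ?N = 1 + 2 * ?m * ?a + ?m\<^sup>2"
      by (simp add: inner_add_left inner_add_right xx vv inner_commute[of v x] power2_eq_square algebra_simps)
    also have "\<dots> = ?D\<^sup>2 + (1 + ?s\<^sup>2 - ?c\<^sup>2) + (?c\<^sup>2 - 1 - ?s\<^sup>2) * ?a\<^sup>2"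
      by (simp add: boost_den_def power2_eq_square algebra_simps)
    finally show ?thesis by (simp add: c2)
  qed
  have ww: "w h \<bullet> w h' = h \<bullet> h' + ?s\<^sup>2 * ((h \<bullet> v) * (h' \<bullet> v))" for h h'
  proof -
    have "w h \<bullet> w h' = h \<bullet> h' + (?c\<^sup>2 - 1) * ((h \<bullet> v) * (h' \<bullet> v))"
      by (simp add: w_def inner_add_left inner_add_right vv inner_commute[of v h] inner_commute[of v h'] power2_eq_square algebra_simps)
    then show ?thesis by (simp add: c2)
  qed
  have wN: "w h \<bullet> ?N = ?s * (h \<bullet> v) * ?D" if "x \<bullet> h = 0" for h
  proof -
    have "w h \<bullet> ?N = (h \<bullet> v) * (?c * ?s + (?c\<^sup>2 - 1) * ?a)"
      using that by (simp add: w_def inner_add_left inner_add_right vv inner_commute[of v h] inner_commute[of v x] inner_commute[of h x] power2_eq_square algebra_simps)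
    also have "\<dots> = ?s * (h \<bullet> v) * ?D"
      unfolding c2 boost_den_def by (simp add: power2_eq_square algebra_simps)
    finally show ?thesis .
  qed
  have expand: "(a - p *\<^sub>R n) \<bullet> (b - q *\<^sub>R n) = a \<bullet> b - q * (a \<bullet> n) - p * (b \<bullet> n) + p * q * (n \<bullet> n)"
    for a b n :: 'a and p q
    unfolding inner_diff_left inner_diff_right inner_scaleR_left inner_scaleR_right inner_commute[of n b]
    by (simp add: algebra_simps)
  have "(w h - (?s * (h \<bullet> v) * inverse ?D) *\<^sub>R ?N) \<bullet> (w h' - (?s * (h' \<bullet> v) * inverse ?D) *\<^sub>R ?N) =
      w h \<bullet> w h' - (?s * (h' \<bullet> v) * inverse ?D) * (w h \<bullet> ?N) - (?s * (h \<bullet> v) * inverse ?D) * (w h' \<bullet> ?N)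
        + (?s * (h \<bullet> v) * inverse ?D) * (?s * (h' \<bullet> v) * inverse ?D) * (?N \<bullet> ?N)"
    by (rule expand)
  also have "\<dots> = h \<bullet> h'"
    unfolding ww NN wN[OF h(1)] wN[OF h(2)] using D by (simp add: field_simps power2_eq_square)
  finally show ?thesis unfolding pdb by (simp add: power2_eq_square)
qed

lemma volume_boost:
  assumes N: "submanifold_with_boundary m N" "compact N" "N \<subseteq> sphere 0 1"
  shows "submanifold_volume m (boost v t ` N) = (LINT p|volume_measure m N. inverse (boost_den v t p) ^ m)"
proof -
  define H where "H t = {x. boost_den v t x > 0}" for t
  have cD: "continuous_on S (boost_den v t)" for S t
    unfolding boost_den_def[abs_def] by (intro continuous_intros)
  have oH: "open (H t)" for t unfolding H_def by (intro open_Collect_less cD continuous_intros)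
  have CD: "Ck_on n S (boost_den v t)" if "open S" for n S t
    unfolding boost_den_def[abs_def] using that by (intro Ck_on_add Ck_on_mult Ck_on_inner Ck_on_const Ck_on_id)
  have Cb: "Ck_on n (H t) (boost v t)" for n t
    unfolding boost_def[abs_def] using oH[of t]
    by (intro Ck_on_scaleR Ck_on_add Ck_on_mult Ck_on_inner Ck_on_const Ck_on_id Ck_on_inverse CD) (auto simp: H_def)
  have inv: "boost v t x \<in> H (- t) \<and> boost v (- t) (boost v t x) = x" if "x \<in> H t" for x t
    using that boost_inverse[of t x] boost_den_boost[of t x] by (auto simp: H_def)
  have bD [measurable]: "boost_den v t \<in> borel_measurable borel"
    using cD by (rule borel_measurable_continuous_onI)
  have NH: "N \<subseteq> H t" using N(3) boost_den_pos by (auto simp: H_def)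
  show ?thesis
  proof (rule volume_measure_conformal[OF N(1,2) oH[of t] oH[of "- t"] Cb Cb inv[of _ t]])
    show "boost v (- t) y \<in> H t \<and> boost v t (boost v (- t) y) = y" if "y \<in> H (- t)" for y
      using inv[OF that] by simp
    show "N \<subseteq> H t" by (rule NH)
    show "boost v t \<in> borel_measurable borel" unfolding boost_def[abs_def] by measurable
    show "(\<lambda>p. inverse (boost_den v t p)) \<in> borel_measurable borel" by measurable
    show "inverse (boost_den v t p) > 0" if "p \<in> N" for p using that NH by (auto simp: H_def)
    fix p u w assume p: "p \<in> N" and u: "u \<in> tangent_space N p" and w: "w \<in> tangent_space N p"
    show "pd (boost v t) u p \<bullet> pd (boost v t) w p = (inverse (boost_den v t p))\<^sup>2 * (u \<bullet> w)"
      using boost_conformal[of p u w t] tangent_space_sphere[OF N(1,3) p] p u w N(3) by blast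
  qed
qed

end

text \<open>Differentiation under the integral with an explicit remainder: \<open>G2\<close> is
  bounded on the compact square, so the first-order Taylor error is at most C |a - t|^2 uniformly in
  s, and the measure is finite.\<close>

lemma has_real_derivative_integral_param:
  fixes G G1 G2 :: "real \<Rightarrow> real \<Rightarrow> real" and \<sigma> :: "'a \<Rightarrow> real"
  assumes \<mu>: "finite_measure \<mu>" and \<sigma>: "\<sigma> \<in> borel_measurable \<mu>" "\<And>p. \<sigma> p \<in> {-1..1}"
    and G: "continuous_on ({-1..1} \<times> {-1..1}) (\<lambda>(t, s). G t s)"
    and G1: "continuous_on ({-1..1} \<times> {-1..1}) (\<lambda>(t, s). G1 t s)"
    and G2: "continuous_on ({-1..1} \<times> {-1..1}) (\<lambda>(t, s). G2 t s)"
    and d1: "\<And>t s. s \<in> {-1..1} \<Longrightarrow> ((\<lambda>t. G t s) has_real_derivative G1 t s) (at t)"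
    and d2: "\<And>t s. s \<in> {-1..1} \<Longrightarrow> ((\<lambda>t. G1 t s) has_real_derivative G2 t s) (at t)"
    and t: "\<bar>t\<bar> < 1"
  shows "((\<lambda>t. LINT p|\<mu>. G t (\<sigma> p)) has_real_derivative (LINT p|\<mu>. G1 t (\<sigma> p))) (at t)"
proof -
  interpret finite_measure \<mu> by fact
  have int: "integrable \<mu> (\<lambda>p. K t (\<sigma> p))" if K: "continuous_on ({-1..1} \<times> {-1..1}) (\<lambda>(t, s). K t s)" and t: "t \<in> {-1..1}"
    for K :: "real \<Rightarrow> real \<Rightarrow> real" and t
  proof -
    have cK: "continuous_on {-1..1} (K t)"
    proof -
      have "continuous_on {-1..1} (\<lambda>s. (t, s))" by (intro continuous_intros)
      moreover have "(\<lambda>s. (t, s)) ` {-1..1} \<subseteq> {-1..1} \<times> {-1..1}" using t by auto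
      ultimately show ?thesis using continuous_on_compose2[OF K] by fastforce
    qed
    have "continuous_on UNIV (\<lambda>s. K t (max (-1) (min 1 s)))"
      by (rule continuous_on_compose2[OF cK]) (auto intro!: continuous_intros)
    then have "(\<lambda>p. K t (max (-1) (min 1 (\<sigma> p)))) \<in> borel_measurable \<mu>"
      by (intro measurable_compose[OF \<sigma>(1)] borel_measurable_continuous_onI)
    moreover have "max (-1) (min 1 (\<sigma> p)) = \<sigma> p" for p using \<sigma>(2)[of p] by auto
    ultimately have m: "(\<lambda>p. K t (\<sigma> p)) \<in> borel_measurable \<mu>" by simp
    have "bounded (K t ` {-1..1})" by (intro compact_imp_bounded compact_continuous_image cK) auto
    then obtain C where "\<forall>y\<in>K t ` {-1..1}. norm y \<le> C" unfolding bounded_iff by blast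
    then show ?thesis using \<sigma>(2) by (intro integrable_const_bound[OF _ m, of C] AE_I2) blast
  qed
  have "bounded ((\<lambda>(t, s). G2 t s) ` ({-1..1} \<times> {-1..1}))"
    by (intro compact_imp_bounded compact_continuous_image G2 compact_Times) auto
  then obtain C where C: "\<forall>y\<in>(\<lambda>(t, s). G2 t s) ` ({-1..1} \<times> {-1..1}). norm y \<le> C"
    unfolding bounded_iff by blast
  have C': "\<bar>G2 t s\<bar> \<le> C" if "t \<in> {-1..1}" "s \<in> {-1..1}" for t s using C that by force
  have C0: "C \<ge> 0" using C'[of 0 0] by simp
  have lip: "\<bar>G1 a s - G1 t s\<bar> \<le> C * \<bar>a - t\<bar>" if "\<bar>a\<bar> < 1" "s \<in> {-1..1}" for a s
  proof -
    have "norm (G1 a s - G1 t s) \<le> C * norm (a - t)"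
      by (rule field_differentiable_bound[of "{-1..1}" "\<lambda>t. G1 t s" "\<lambda>t. G2 t s"])
        (use that t C' in \<open>auto intro: has_field_derivative_at_within[OF d2]\<close>)
    then show ?thesis by simp
  qed
  have taylor: "\<bar>G a s - G t s - (a - t) * G1 t s\<bar> \<le> C * \<bar>a - t\<bar> * \<bar>a - t\<bar>" if a: "\<bar>a\<bar> < 1" and s: "s \<in> {-1..1}" for a s
  proof -
    \<comment> \<open>The mean value inequality for G minus its tangent line at t, whose derivative
      is at most C |a - t| on the segment.\<close>
    have "norm ((G a s - a * G1 t s) - (G t s - t * G1 t s)) \<le> (C * \<bar>a - t\<bar>) * norm (a - t)"
    proof (rule field_differentiable_bound[of "closed_segment t a" "\<lambda>b. G b s - b * G1 t s" "\<lambda>b. G1 b s - G1 t s"])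
      fix b assume b: "b \<in> closed_segment t a"
      show "((\<lambda>b. G b s - b * G1 t s) has_field_derivative G1 b s - G1 t s) (at b within closed_segment t a)"
        using DERIV_subset[OF d1[OF s]] by (auto intro!: derivative_eq_intros)
      have "\<bar>b\<bar> < 1" "\<bar>b - t\<bar> \<le> \<bar>a - t\<bar>"
        using b a t by (auto simp: closed_segment_eq_real_ivl split: if_splits)
      then have "\<bar>G1 b s - G1 t s\<bar> \<le> C * \<bar>b - t\<bar>" using lip s by blast
      also have "\<dots> \<le> C * \<bar>a - t\<bar>" using C0 \<open>\<bar>b - t\<bar> \<le> \<bar>a - t\<bar>\<close> by (rule mult_left_mono[rotated])
      finally show "norm (G1 b s - G1 t s) \<le> C * \<bar>a - t\<bar>" by simp
    qed auto
    then show ?thesis by (simp add: algebra_simps)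
  qed
  let ?L = "\<lambda>t. LINT p|\<mu>. G t (\<sigma> p)" and ?L1 = "LINT p|\<mu>. G1 t (\<sigma> p)"
  define m where "m = measure \<mu> (space \<mu>)"
  have bound: "\<bar>?L a - ?L t - (a - t) * ?L1\<bar> \<le> (C * m) * \<bar>a - t\<bar> * \<bar>a - t\<bar>" if a: "\<bar>a\<bar> < 1" for a
  proof -
    have i: "integrable \<mu> (\<lambda>p. G a (\<sigma> p))" "integrable \<mu> (\<lambda>p. G t (\<sigma> p))" "integrable \<mu> (\<lambda>p. G1 t (\<sigma> p))"
      using a t by (auto intro!: int G G1)
    have "?L a - ?L t - (a - t) * ?L1 = (LINT p|\<mu>. G a (\<sigma> p) - G t (\<sigma> p) - (a - t) * G1 t (\<sigma> p))"
      using i by simp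
    also have "\<bar>\<dots>\<bar> \<le> (LINT p|\<mu>. \<bar>G a (\<sigma> p) - G t (\<sigma> p) - (a - t) * G1 t (\<sigma> p)\<bar>)"
      by (rule integral_abs_bound)
    also have "\<dots> \<le> (LINT p|\<mu>. C * \<bar>a - t\<bar> * \<bar>a - t\<bar>)"
      using i taylor[OF a \<sigma>(2)] by (intro integral_mono) auto
    finally show ?thesis by (simp add: m_def mult_ac)
  qed
  show ?thesis
    unfolding has_field_derivative_iff
  proof (rule LIM_zero_cancel, rule Lim_null_comparison)
    have lim: "((\<lambda>a. \<bar>a - t\<bar>) \<longlongrightarrow> \<bar>t - t\<bar>) (at t)" by (intro tendsto_intros)
    show "((\<lambda>a. (C * m) * \<bar>a - t\<bar>) \<longlongrightarrow> 0) (at t)"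
      using tendsto_mult_left[OF lim, of "C * m"] by simp
    have "open {a::real. \<bar>a\<bar> < 1}" by (intro open_Collect_less continuous_intros)
    then have "\<forall>\<^sub>F a in at t. \<bar>a\<bar> < 1"
      using t eventually_at_in_open'[of "{a::real. \<bar>a\<bar> < 1}" t] by simp
    moreover have "\<forall>\<^sub>F a in at t. a \<noteq> t" by (simp add: eventually_at_filter)
    ultimately show "\<forall>\<^sub>F a in at t. norm ((?L a - ?L t) / (a - t) - ?L1) \<le> (C * m) * \<bar>a - t\<bar>"
    proof eventually_elim
      case (elim a)
      have "\<bar>(?L a - ?L t) / (a - t) - ?L1\<bar> = \<bar>?L a - ?L t - (a - t) * ?L1\<bar> / \<bar>a - t\<bar>"
        using elim(2) by (simp add: abs_divide[symmetric] diff_divide_distrib)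
      also have "\<dots> \<le> (C * m) * \<bar>a - t\<bar>"
        using bound[OF elim(1)] elim(2) by (simp add: divide_le_eq)
      finally show ?case by simp
    qed
  qed
qed

text \<open>The volume is the integral of a function of t and p \<bullet> v alone, so two
  applications of \<open>has_real_derivative_integral_param\<close> reduce the claim to calculus in
  the variables t and s.\<close>

lemma second_variation_boost:
  fixes v :: "'a::euclidean_space"
  assumes N: "submanifold_with_boundary m N" "compact N" "N \<subseteq> sphere 0 1" and v: "norm v = 1"
  shows "\<exists>L'. (\<forall>\<^sub>F t in nhds 0. ((\<lambda>t. submanifold_volume m (boost v t ` N)) has_real_derivative L' t) (at t)) \<and>
    (L' has_real_derivative (LINT p|volume_measure m N. real m * ((real m + 1) * (p \<bullet> v)\<^sup>2 - 1))) (at 0)"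
proof -
  let ?\<mu> = "volume_measure m N"
  have \<mu>: "volume_spec m N ?\<mu>" by (rule volume_spec_volume_measure[OF N(1,2)])
  have Nb: "N \<in> sets borel" using N(2) by (simp add: borel_compact)
  have fin: "finite_measure ?\<mu>" by (rule finite_volume_spec[OF N(1,2) \<mu>])
  note [measurable_cong] = volume_specD(1)[OF \<mu>]
  \<comment> \<open>Clipped because values in [-1, 1] are demanded everywhere, while |p \<bullet> v|
    \<le> 1 is known only on \<open>N\<close>, which carries the measure.\<close>
  define \<sigma> where "\<sigma> p = max (-1) (min 1 (p \<bullet> v))" for p :: 'a
  have \<sigma>m: "\<sigma> \<in> borel_measurable ?\<mu>" unfolding \<sigma>_def[abs_def] by measurable
  have \<sigma>r: "\<sigma> p \<in> {-1..1}" for p by (auto simp: \<sigma>_def)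
  have \<sigma>N: "\<sigma> p = p \<bullet> v" if "p \<in> N" for p
    using sphere_inner_le[OF v, of p] that N(3) by (auto simp: \<sigma>_def abs_le_iff)
  define D where "D t s = cosh t + sinh t * s" for t s :: real
  define D1 where "D1 t s = sinh t + cosh t * s" for t s :: real
  have Dpos: "D t s > 0" if "s \<in> {-1..1}" for t s
    unfolding D_def using that by (intro cosh_add_sinh_pos) (auto simp: abs_le_iff)
  have dD: "((\<lambda>t. D t s) has_real_derivative D1 t s) (at t)" "((\<lambda>t. D1 t s) has_real_derivative D t s) (at t)" for t s
    unfolding D_def D1_def by (auto intro!: derivative_eq_intros)
  have dI: "((\<lambda>t. inverse (D t s) ^ n) has_real_derivative - (real n * inverse (D t s) ^ (n + 1) * D1 t s)) (at t)"
    if s: "s \<in> {-1..1}" for n t s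
  proof -
    have ne: "D t s \<noteq> 0" using Dpos[OF s, of t] by simp
    have "((\<lambda>t. inverse (D t s) ^ n) has_real_derivative
        real n * (- (inverse (D t s) * D1 t s * inverse (D t s)) * inverse (D t s) ^ (n - Suc 0))) (at t)"
      by (rule DERIV_power[OF DERIV_inverse'[OF dD(1) ne]])
    moreover have "real n * (- (inverse (D t s) * D1 t s * inverse (D t s)) * inverse (D t s) ^ (n - Suc 0)) =
        - (real n * inverse (D t s) ^ (n + 1) * D1 t s)"
      by (cases n) (auto simp: mult_ac)
    ultimately show ?thesis by (simp only:)
  qed
  define G where "G t s = inverse (D t s) ^ m" for t s
  define G1 where "G1 t s = - (real m * inverse (D t s) ^ (m + 1) * D1 t s)" for t s
  define G2 where "G2 t s = real m * (real m + 1) * inverse (D t s) ^ (m + 2) * (D1 t s * D1 t s)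
      - real m * inverse (D t s) ^ (m + 1) * D t s" for t s
  \<comment> \<open>The third derivative in t: differentiating the integral of \<open>G1\<close>
    needs a continuous second derivative of \<open>G1\<close> to bound the remainder.\<close>
  define G3 where "G3 t s = real m * (real m + 1) * (- (real (m + 2) * inverse (D t s) ^ (m + 2 + 1) * D1 t s) * (D1 t s * D1 t s)
      + (D t s * D1 t s + D t s * D1 t s) * inverse (D t s) ^ (m + 2))
      - real m * (- (real (m + 1) * inverse (D t s) ^ (m + 1 + 1) * D1 t s) * D t s + D1 t s * inverse (D t s) ^ (m + 1))" for t s
  have dG: "((\<lambda>t. G t s) has_real_derivative G1 t s) (at t)" if "s \<in> {-1..1}" for t s
    unfolding G_def G1_def by (rule dI[OF that])
  have dG1: "((\<lambda>t. G1 t s) has_real_derivative G2 t s) (at t)" if s: "s \<in> {-1..1}" for t s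
  proof -
    have "((\<lambda>t. - (real m * (inverse (D t s) ^ (m + 1) * D1 t s))) has_real_derivative
       - (real m * (- (real (m + 1) * inverse (D t s) ^ (m + 1 + 1) * D1 t s) * D1 t s + D t s * inverse (D t s) ^ (m + 1)))) (at t)"
      by (intro DERIV_minus DERIV_cmult DERIV_mult dI[OF s] dD)
    moreover have "- (real m * (- (real (m + 1) * inverse (D t s) ^ (m + 1 + 1) * D1 t s) * D1 t s + D t s * inverse (D t s) ^ (m + 1))) = G2 t s"
      by (simp add: G2_def algebra_simps)
    ultimately show ?thesis unfolding G1_def by (simp only: mult.assoc)
  qed
  have dG2: "((\<lambda>t. G2 t s) has_real_derivative G3 t s) (at t)" if s: "s \<in> {-1..1}" for t s
  proof -
    have "((\<lambda>t. real m * (real m + 1) * (inverse (D t s) ^ (m + 2) * (D1 t s * D1 t s))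
        - real m * (inverse (D t s) ^ (m + 1) * D t s)) has_real_derivative G3 t s) (at t)"
      unfolding G3_def by (intro DERIV_diff DERIV_cmult DERIV_mult dI[OF s] dD)
    then show ?thesis unfolding G2_def by (simp only: mult.assoc)
  qed
  let ?Q = "{-1..1} \<times> {-1..1} :: (real \<times> real) set"
  have cD: "continuous_on ?Q (\<lambda>x. D (fst x) (snd x))" "continuous_on ?Q (\<lambda>x. D1 (fst x) (snd x))"
    unfolding D_def D1_def by (intro continuous_intros)+
  have cI: "continuous_on ?Q (\<lambda>x. inverse (D (fst x) (snd x)))"
    by (rule continuous_on_inverse[OF cD(1)]) (use Dpos in \<open>force simp: less_imp_neq[THEN not_sym]\<close>)
  have cG: "continuous_on ?Q (\<lambda>(t, s). G t s)" "continuous_on ?Q (\<lambda>(t, s). G1 t s)"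
    "continuous_on ?Q (\<lambda>(t, s). G2 t s)" "continuous_on ?Q (\<lambda>(t, s). G3 t s)"
    unfolding G_def G1_def G2_def G3_def case_prod_unfold
    by (intro continuous_on_add continuous_on_diff continuous_on_minus continuous_on_mult
        continuous_on_power continuous_on_const cD cI)+
  define L1 where "L1 t = (LINT p|?\<mu>. G1 t (\<sigma> p))" for t
  have L: "submanifold_volume m (boost v t ` N) = (LINT p|?\<mu>. G t (\<sigma> p))" for t
  proof -
    have "submanifold_volume m (boost v t ` N) = (LINT p|?\<mu>. inverse (boost_den v t p) ^ m)"
      by (rule volume_boost[OF v N])
    also have "\<dots> = (LINT p|?\<mu>. G t (\<sigma> p))"
    proof (rule integral_cong_AE)
      show "AE p in ?\<mu>. inverse (boost_den v t p) ^ m = G t (\<sigma> p)"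
        using volume_spec_AE[OF \<mu> Nb] by eventually_elim (simp add: \<sigma>N G_def D_def boost_den_def)
      show "(\<lambda>p. inverse (boost_den v t p) ^ m) \<in> borel_measurable ?\<mu>" unfolding boost_den_def by measurable
      show "(\<lambda>p. G t (\<sigma> p)) \<in> borel_measurable ?\<mu>" using \<sigma>m unfolding G_def D_def by measurable
    qed
    finally show ?thesis .
  qed
  have "((\<lambda>t. submanifold_volume m (boost v t ` N)) has_real_derivative L1 t) (at t)" if "\<bar>t\<bar> < 1" for t
    unfolding L L1_def by (rule has_real_derivative_integral_param[OF fin \<sigma>m \<sigma>r cG(1,2,3) dG dG1 that])
  moreover have "\<forall>\<^sub>F t :: real in nhds 0. \<bar>t\<bar> < 1"
    using eventually_nhds_in_open[of "{t::real. \<bar>t\<bar> < 1}" 0] by (simp add: open_Collect_less continuous_on_rabs)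
  ultimately have 1: "\<forall>\<^sub>F t in nhds 0. ((\<lambda>t. submanifold_volume m (boost v t ` N)) has_real_derivative L1 t) (at t)"
    by (auto elim: eventually_mono)
  have "(L1 has_real_derivative (LINT p|?\<mu>. G2 0 (\<sigma> p))) (at 0)"
    unfolding L1_def[abs_def] by (rule has_real_derivative_integral_param[OF fin \<sigma>m \<sigma>r cG(2,3,4) dG1 dG2]) auto
  moreover have "(LINT p|?\<mu>. G2 0 (\<sigma> p)) = (LINT p|?\<mu>. real m * ((real m + 1) * (p \<bullet> v)\<^sup>2 - 1))"
  proof (rule integral_cong_AE)
    \<comment> \<open>At t = 0 the denominator is 1 and its derivative is s, so \<open>G2\<close>
      becomes m (m + 1) s^2 - m.\<close>
    show "AE p in ?\<mu>. G2 0 (\<sigma> p) = real m * ((real m + 1) * (p \<bullet> v)\<^sup>2 - 1)"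
      using volume_spec_AE[OF \<mu> Nb]
      by eventually_elim (simp add: \<sigma>N G2_def D_def D1_def power2_eq_square algebra_simps)
    show "(\<lambda>p. G2 0 (\<sigma> p)) \<in> borel_measurable ?\<mu>" using \<sigma>m unfolding G2_def D_def D1_def by measurable
  qed measurable
  ultimately show ?thesis using 1 by (intro exI[of _ L1]) simp
qed

text \<open>The second derivative is expressed through a first derivative \<open>L'\<close> on a
  neighbourhood of 0, so that differentiability is asserted and not presupposed.\<close>

theorem theorem3p8:
  fixes M :: "'a::euclidean_space set" and k :: nat and v :: 'a
    and f :: "real \<Rightarrow> 'a \<Rightarrow> 'a"
  assumes "k \<ge> 1"
    and "compact M"
    and "minimal_submanifold k M"
    and "M \<subseteq> cball 0 1"
    and "manifold_boundary k M \<subseteq> sphere 0 1"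
    and "\<forall>p \<in> manifold_boundary k M. outward_unit_conormal k M p p"
    and "v \<in> sphere 0 1"
    and "flow_on (sphere 0 1) (sphere_gradient v) f"
  shows "(\<exists>L'. (\<forall>\<^sub>F t in nhds 0.
            ((\<lambda>t. submanifold_volume (k - 1) (f t ` manifold_boundary k M)) has_real_derivative L' t) (at t)) \<and>
          (L' has_real_derivative
             - ((real k - 1) * real k *
                 (LINT p:M|volume_measure k M. (norm (normal_part M p v))\<^sup>2))) (at 0)) \<and>
         - ((real k - 1) * real k *
             (LINT p:M|volume_measure k M. (norm (normal_part M p v))\<^sup>2)) \<le> 0"
proof -
  let ?N = "manifold_boundary k M"
  let ?I = "LINT p:M|volume_measure k M. (norm (normal_part M p v))\<^sup>2"
  let ?\<sigma> = "volume_measure (k - 1) ?N"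
  have v: "norm v = 1" using assms(7) by simp
  have sM: "submanifold_with_boundary k M" using assms(3) by (simp add: minimal_submanifold_def)
  have N: "submanifold_with_boundary (k - 1) ?N" "compact ?N"
    using submanifold_boundary[OF sM] compact_boundary[OF sM assms(2)] by auto
  have rk: "real (k - 1) = real k - 1" using assms(1) by (simp add: of_nat_diff)
  have "f t ` ?N = boost v t ` ?N" for t
    using flow_eq_boost[OF v assms(8)] assms(5) by (intro image_cong) auto
  \<comment> \<open>With m = k - 1 the integrand m ((m + 1) s^2 - 1) is -(k - 1) times the flux 1 -
    k s^2; here k \<ge> 1 makes the subtraction on naturals exact.\<close>
  moreover have "(LINT p|?\<sigma>. real (k - 1) * ((real (k - 1) + 1) * (p \<bullet> v)\<^sup>2 - 1)) = - ((real k - 1) * real k * ?I)"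
  proof -
    have "(LINT p|?\<sigma>. real (k - 1) * ((real (k - 1) + 1) * (p \<bullet> v)\<^sup>2 - 1)) =
        (LINT p|?\<sigma>. - (real k - 1) * (1 - real k * (p \<bullet> v)\<^sup>2))"
      unfolding rk by (intro Bochner_Integration.integral_cong refl) (simp add: algebra_simps)
    also have "\<dots> = - (real k - 1) * (LINT p|?\<sigma>. 1 - real k * (p \<bullet> v)\<^sup>2)"
      by (rule integral_mult_right_zero)
    also have "(LINT p|?\<sigma>. 1 - real k * (p \<bullet> v)\<^sup>2) = real k * ?I"
      using flux_identity[OF assms(3,2) _ v assms(5)] assms(6) by simp
    finally show ?thesis by (simp only: mult_minus_left mult.assoc)
  qed
  moreover have "?I \<ge> 0"
    unfolding set_lebesgue_integral_def by (intro integral_nonneg_AE AE_I2) simp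
  then have "(real k - 1) * real k * ?I \<ge> 0"
    using assms(1) by (intro mult_nonneg_nonneg) auto
  ultimately show ?thesis
    using second_variation_boost[OF N assms(5) v] by simp
qed

end
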